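(* A graph is a $2$-vertex $n$-extremal minimal bipartite matching covered graph if and only if it is obtained from a cubic Halin tree by isomorphic leaf matching.
   Context: All graphs are finite and loopless; parallel edges are allowed. For a graph $G=(V,E)$ write $n=|V|$. A connected graph on four or more vertices is matching covered if every edge lies in some perfect matching. A matching covered graph is minimal if deleting any single edge yields a graph that is not matching covered. $V_2$ denotes the set of vertices of degree two. A minimal bipartite matching covered graph is $2$-vertex $n$-extremal if $|V_2|=\frac{n}{2}+2$. A cubic Halin tree is a tree on at least two vertices all of whose non-leaves have degree exactly three ($K_2$, both of whose vertices are leaves, is included). A graph $H$ is obtained from a tree $T$ (on at least two vertices) by isomorphic leaf matching if, for a disjoint copy $T'$ of $T$ and some fixed isomorphism from $T$ to $T'$, $H$ is obtained from $T\cup T'$ by adding, for each leaf of $T$, one edge joining this leaf to the corresponding leaf of $T'$ under the isomorphism. *)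

theory Defs
  imports Complex_Main
begin

(* Finite loopless undirected multigraphs.  Edges are named, so that parallel edges are
   distinct elements of edges G with the same set of ends. *)

record ('v, 'e) mgraph =
  verts :: "'v set"
  edges :: "'e set"
  ends  :: "'e \<Rightarrow> 'v set"

definition multigraph :: "('v, 'e) mgraph \<Rightarrow> bool" where
  "multigraph G \<longleftrightarrow> finite (verts G) \<and> finite (edges G) \<and>
     (\<forall>e\<in>edges G. ends G e \<subseteq> verts G \<and> card (ends G e) = 2)"

definition degree :: "('v, 'e) mgraph \<Rightarrow> 'v \<Rightarrow> nat" where
  "degree G v = card {e \<in> edges G. v \<in> ends G e}"

definition delete_edge :: "('v, 'e) mgraph \<Rightarrow> 'e \<Rightarrow> ('v, 'e) mgraph" where
  "delete_edge G e = G\<lparr>edges := edges G - {e}\<rparr>"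

definition walk :: "('v, 'e) mgraph \<Rightarrow> 'v list \<Rightarrow> 'e list \<Rightarrow> bool" where
  "walk G vs es \<longleftrightarrow> length vs = Suc (length es) \<and> set vs \<subseteq> verts G \<and>
     (\<forall>i<length es. es ! i \<in> edges G \<and> ends G (es ! i) = {vs ! i, vs ! Suc i})"

definition connected_graph :: "('v, 'e) mgraph \<Rightarrow> bool" where
  "connected_graph G \<longleftrightarrow> verts G \<noteq> {} \<and>
     (\<forall>u\<in>verts G. \<forall>v\<in>verts G. \<exists>vs es. walk G vs es \<and> hd vs = u \<and> last vs = v)"

(* Two parallel edges form a cycle of length two; distinctness of the edges
   excludes traversing one edge back and forth. *)
definition cycle :: "('v, 'e) mgraph \<Rightarrow> 'v list \<Rightarrow> 'e list \<Rightarrow> bool" where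
  "cycle G vs es \<longleftrightarrow>
     walk G vs es \<and> es \<noteq> [] \<and> hd vs = last vs \<and> distinct (tl vs) \<and> distinct es"

definition bipartite :: "('v, 'e) mgraph \<Rightarrow> bool" where
  "bipartite G \<longleftrightarrow> (\<exists>A B. A \<union> B = verts G \<and> A \<inter> B = {} \<and>
     (\<forall>e\<in>edges G. \<exists>a\<in>A. \<exists>b\<in>B. ends G e = {a, b}))"

definition perfect_matching :: "('v, 'e) mgraph \<Rightarrow> 'e set \<Rightarrow> bool" where
  "perfect_matching G M \<longleftrightarrow> M \<subseteq> edges G \<and> (\<forall>v\<in>verts G. \<exists>!e. e \<in> M \<and> v \<in> ends G e)"

definition matching_covered :: "('v, 'e) mgraph \<Rightarrow> bool" where
  "matching_covered G \<longleftrightarrow> multigraph G \<and> connected_graph G \<and> 4 \<le> card (verts G) \<and>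
     (\<forall>e\<in>edges G. \<exists>M. perfect_matching G M \<and> e \<in> M)"

definition minimal_matching_covered :: "('v, 'e) mgraph \<Rightarrow> bool" where
  "minimal_matching_covered G \<longleftrightarrow>
     matching_covered G \<and> (\<forall>e\<in>edges G. \<not> matching_covered (delete_edge G e))"

definition V2 :: "('v, 'e) mgraph \<Rightarrow> 'v set" where
  "V2 G = {v \<in> verts G. degree G v = 2}"

definition two_vertex_n_extremal :: "('v, 'e) mgraph \<Rightarrow> bool" where
  "two_vertex_n_extremal G \<longleftrightarrow> minimal_matching_covered G \<and> bipartite G \<and>
     real (card (V2 G)) = real (card (verts G)) / 2 + 2"

definition tree :: "('v, 'e) mgraph \<Rightarrow> bool" where
  "tree T \<longleftrightarrow> multigraph T \<and> connected_graph T \<and> (\<nexists>vs es. cycle T vs es)"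

definition leaves :: "('v, 'e) mgraph \<Rightarrow> 'v set" where
  "leaves T = {v \<in> verts T. degree T v = 1}"

definition cubic_halin_tree :: "('v, 'e) mgraph \<Rightarrow> bool" where
  "cubic_halin_tree T \<longleftrightarrow> tree T \<and> 2 \<le> card (verts T) \<and>
     (\<forall>v\<in>verts T - leaves T. degree T v = 3)"

definition isomorphism ::
  "('v, 'e) mgraph \<Rightarrow> ('w, 'f) mgraph \<Rightarrow> ('v \<Rightarrow> 'w) \<Rightarrow> ('e \<Rightarrow> 'f) \<Rightarrow> bool" where
  "isomorphism G H f g \<longleftrightarrow>
     bij_betw f (verts G) (verts H) \<and> bij_betw g (edges G) (edges H) \<and>
     (\<forall>e\<in>edges G. ends H (g e) = f ` ends G e)"

(* T and its disjoint copy T' are taken as subgraphs of H itself, and m l is the new edge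
   at the leaf l.  As T may be any tree in the vertex and edge types of H, the property
   that such a T exists is invariant under isomorphism of H. *)
definition isomorphic_leaf_matching :: "('v, 'e) mgraph \<Rightarrow> ('v, 'e) mgraph \<Rightarrow> bool" where
  "isomorphic_leaf_matching T H \<longleftrightarrow> tree T \<and> 2 \<le> card (verts T) \<and>
     (\<exists>T' f g m.
        isomorphism T T' f g \<and>
        verts T \<inter> verts T' = {} \<and> edges T \<inter> edges T' = {} \<and>
        inj_on m (leaves T) \<and> m ` leaves T \<inter> (edges T \<union> edges T') = {} \<and>
        verts H = verts T \<union> verts T' \<and>
        edges H = edges T \<union> edges T' \<union> m ` leaves T \<and>
        (\<forall>e\<in>edges T. ends H e = ends T e) \<and>
        (\<forall>e\<in>edges T'. ends H e = ends T' e) \<and>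
        (\<forall>l\<in>leaves T. ends H (m l) = {l, f l}))"

end

theory Submission
  imports Defs
begin

text \<open>
  A bipartite graph with classes of equal size is matching covered iff every nonempty proper
  subset \<open>X\<close> of one class has more than \<open>|X|\<close> neighbours, so in a minimal one every edge
  \<open>ab\<close> comes with a tight set: some \<open>X\<close> with \<open>|X| + 1\<close> neighbours in which \<open>a\<close> is the only
  neighbour of \<open>b\<close>.  Give a vertex of degree two weight \<open>1\<close> and a vertex of degree \<open>d \<ge> 3\<close>
  weight \<open>2 - d\<close>; the total weight is \<open>|V\<^sub>2| - 2 (m - n)\<close>.  By induction it is at least \<open>4\<close>, with
  equality only for doubled trees.  If a degree-two vertex has no neighbour of degree two, contracting
  it together with its neighbours lowers the weight by one.  Otherwise a smallest tight set belonging
  to an edge \<open>ab\<close> with \<open>deg a \<ge> 3\<close> is contracted to an edge: uncrossing shows that the result is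
  again minimal, counting shows that the weight does not increase, and equality forces the contracted
  part to consist of two adjacent copies of a star with their leaves matched.  For an extremal graph
  \<open>|V\<^sub>2| = n/2 + 2\<close> forces weight \<open>4\<close> and maximum degree three.

  Conversely, a doubled tree is matching covered because any tree has matchings that cover all
  non-leaves and contain a prescribed edge or avoid a prescribed leaf; it is minimal because a tree edge
  and its copy form a 2-edge cut with a side of even order.
\<close>

section \<open>Elementary bipartite graphs and tight sets\<close>

text \<open>The bound behind the result is |V2| >= n/2 + 2, but this inequality does not survive
  induction, since the reductions create vertices of large degree. The weight does: for d, d' >= 3
  the value 2 - d is additive when vertices of degrees d and d' merge into one of degree d + d' - 2.
  A vertex of degree other than two counts at most -1, so weight at least 4 implies the bound, and
  equality in the bound forces degree three. For this reason the equality case is carried for trees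
  without vertices of degree two; cubic trees appear only at the end. The constant 4 is the weight
  of the four-cycle, the doubled \<open>K2\<close>. The obstacle is to keep every edge indispensable
  after contracting a tight set. The set is therefore smallest over both colour classes, and taken
  only when bicontraction does not apply: an edge entering the contracted part whose own tight set
  crosses the chosen one then has a tail of degree two, and edges at such vertices are always
  indispensable. The part has equally many vertices of both colours, hence shrinks to an edge; in
  the equality case this edge is where the two stars are put back. In the comments below, N(X) is
  the set of neighbours of X.\<close>

locale elementary =
  fixes A B :: "'a set" and E :: "('a \<times> 'a) set"
  assumes finA: "finite A" and finB: "finite B"
    and sub: "E \<subseteq> A \<times> B" and disj: "A \<inter> B = {}"
    and cardAB: "card A = card B" and two: "2 \<le> card A"
    and hall: "\<And>X. X \<subset> A \<Longrightarrow> X \<noteq> {} \<Longrightarrow> card X < card (E `` X)"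
begin

lemma finE: "finite E"
  using finite_subset[OF sub] finA finB by blast

lemma image_sub: "E `` X \<subseteq> B"
  using sub by blast

lemma finite_image [simp]: "finite (E `` X)"
  using image_sub finB finite_subset by blast

lemma finite_converse_image [simp]: "finite (E\<inverse> `` X)"
  using sub finA by (meson finE finite_Image finite_converse)

lemma full: "E `` A = B"
proof -
  obtain a where a: "a \<in> A" using two by fastforce
  have c: "card (A - {a}) = card A - 1" using a finA by simp
  then have "card (A - {a}) \<noteq> 0" using two by linarith
  then have "A - {a} \<noteq> {}" by (metis card.empty)
  then have "card (A - {a}) < card (E `` (A - {a}))"
    using a by (intro hall) auto
  then have "card B \<le> card (E `` (A - {a}))" using c cardAB by linarith
  then have "E `` (A - {a}) = B" using image_sub finB by (meson card_seteq)
  then show ?thesis using image_sub by blast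
qed

text \<open>If Y violates the strict condition on the side of B, then A - N(Y) violates it on the
  side of A, because its neighbours avoid Y. Hence every later fact about one class transfers to the
  other through the converse relation.\<close>

lemma swap: "elementary B A (E\<inverse>)"
proof
  fix Y assume Y: "Y \<subset> B" "Y \<noteq> {}"
  show "card Y < card (E\<inverse> `` Y)"
  proof (rule ccontr)
    assume n: "\<not> card Y < card (E\<inverse> `` Y)"
    let ?X = "A - E\<inverse> `` Y"
    have finY: "finite Y" using Y finB finite_subset by blast
    have s: "E\<inverse> `` Y \<subseteq> A" using sub by blast
    have cX: "card ?X = card A - card (E\<inverse> `` Y)" using s by (simp add: card_Diff_subset)
    have cB: "card (B - Y) = card B - card Y" using Y finY by (simp add: card_Diff_subset psubset_imp_subset)
    have lt: "card Y < card B" using Y finB by (simp add: psubset_card_mono)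
    have ge: "card (B - Y) \<le> card ?X" using cX cB n cardAB by linarith
    then have "?X \<noteq> {}" using cB lt by (metis card.empty le_zero_eq zero_less_diff not_less0)
    moreover have "?X \<noteq> A"
    proof -
      obtain y where "y \<in> Y" "y \<in> B" using Y by blast
      then obtain x where "x \<in> A" "(x, y) \<in> E" using full by blast
      then show ?thesis using \<open>y \<in> Y\<close> by blast
    qed
    ultimately have "card ?X < card (E `` ?X)" by (intro hall) auto
    also have "E `` ?X \<subseteq> B - Y" using sub by blast
    then have "card (E `` ?X) \<le> card (B - Y)" using finB by (simp add: card_mono)
    finally show False using ge by simp
  qed
qed (use finA finB sub disj cardAB two in auto)

lemma degA: "a \<in> A \<Longrightarrow> 2 \<le> card (E `` {a})"
proof -
  assume a: "a \<in> A"
  have "{a} \<noteq> A" using two by auto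
  then have "{a} \<subset> A" using a by blast
  then show ?thesis using hall[of "{a}"] by auto
qed

lemma degB: "b \<in> B \<Longrightarrow> 2 \<le> card (E\<inverse> `` {b})"
  using elementary.degA[OF swap] by blast

lemma card_image_Un_Int:
  "card (E `` (X \<union> T)) + card (E `` X \<inter> E `` T) = card (E `` X) + card (E `` T)"
  using card_Un_Int[of "E `` X" "E `` T"] by (simp add: Image_Un)

text \<open>The surplus |N(X)| - |X| is submodular and at least 1 on nonempty proper subsets. Two
  sets of surplus 1 therefore pass surplus 1 to union and intersection, and no slack remains in the
  inclusion of N(X \<inter> T) in N(X) \<inter> N(T).\<close>

lemma uncross:
  assumes X: "X \<subset> A" "card (E `` X) = Suc (card X)"
    and T: "T \<subset> A" "card (E `` T) = Suc (card T)"
    and ne: "X \<inter> T \<noteq> {}" and un: "X \<union> T \<noteq> A"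
  shows "card (E `` (X \<union> T)) = Suc (card (X \<union> T)) \<and>
    card (E `` (X \<inter> T)) = Suc (card (X \<inter> T)) \<and> E `` (X \<inter> T) = E `` X \<inter> E `` T"
proof -
  have fin: "finite X" "finite T" using X(1) T(1) finA finite_subset by blast+
  have c: "card (X \<union> T) + card (X \<inter> T) = card X + card T" using card_Un_Int[OF fin] by simp
  have s: "E `` (X \<inter> T) \<subseteq> E `` X \<inter> E `` T" by blast
  then have le: "card (E `` (X \<inter> T)) \<le> card (E `` X \<inter> E `` T)" by (simp add: card_mono)
  have "X \<inter> T \<subset> A" "X \<union> T \<subset> A" "X \<union> T \<noteq> {}" using X(1) T(1) ne un by blast+
  then have 1: "card (X \<inter> T) < card (E `` (X \<inter> T))" and 2: "card (X \<union> T) < card (E `` (X \<union> T))"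
    using hall ne by blast+
  note m = card_image_Un_Int[of X T] 1 2 c le X(2) T(2)
  have "card (E `` (X \<inter> T)) = card (E `` X \<inter> E `` T)" using m by linarith
  then have "E `` (X \<inter> T) = E `` X \<inter> E `` T" using s by (simp add: card_subset_eq)
  moreover have "card (E `` (X \<union> T)) = Suc (card (X \<union> T))"
    "card (E `` (X \<inter> T)) = Suc (card (X \<inter> T))" using m by linarith+
  ultimately show ?thesis by blast
qed

text \<open>Dropping \<open>a\<close> would cost X one vertex but two neighbours, \<open>b\<close>
  and \<open>v\<close>, so X - {a} would have as many neighbours as elements. This is the standard
  contradiction for a vertex of degree at least three in a tight set.\<close>

lemma two_pendant:
  assumes X: "X \<subset> A" "card (E `` X) = Suc (card X)" and a: "a \<in> X" "3 \<le> card (E `` {a})"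
    and bv: "b \<noteq> v" "(a, b) \<in> E" "(a, v) \<in> E"
    and ub: "\<forall>x\<in>X. (x, b) \<in> E \<longrightarrow> x = a" and uv: "\<forall>x\<in>X. (x, v) \<in> E \<longrightarrow> x = a"
  shows False
proof (cases "X = {a}")
  case True
  then show False using X a by simp
next
  case False
  have "finite X" using X finA finite_subset by blast
  have "card (X - {a}) < card (E `` (X - {a}))" using X a False by (intro hall) auto
  also have "E `` (X - {a}) \<subseteq> E `` X - {b, v}" using ub uv by blast
  then have "card (E `` (X - {a})) \<le> card (E `` X - {b, v})" by (simp add: card_mono)
  also have "card (E `` X - {b, v}) = card (E `` X) - 2"
    using bv a by (subst card_Diff_subset) auto
  finally show False using X a \<open>finite X\<close> by (simp add: card_gt_0_iff)
qed

end

text \<open>X certifies that the edge (a, b) cannot be deleted: without it, X loses the neighbour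
  \<open>b\<close> and keeps only |X| neighbours.\<close>

definition tight_at :: "'a set \<Rightarrow> ('a \<times> 'a) set \<Rightarrow> 'a set \<Rightarrow> 'a \<Rightarrow> 'a \<Rightarrow> bool" where
  "tight_at A E X a b \<longleftrightarrow> X \<subset> A \<and> a \<in> X \<and> (a, b) \<in> E \<and> card (E `` X) = Suc (card X) \<and>
     (\<forall>x\<in>X. (x, b) \<in> E \<longrightarrow> x = a)"

lemma (in elementary) tight_atI:
  assumes "X \<subset> A" "a \<in> X" "(a, b) \<in> E" "card (E `` X) \<le> Suc (card X)" "\<forall>x\<in>X. (x, b) \<in> E \<longrightarrow> x = a"
  shows "tight_at A E X a b"
proof -
  have "card X < card (E `` X)" using hall assms(1,2) by blast
  then have "card (E `` X) = Suc (card X)" using assms(4) by linarith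
  then show ?thesis using assms unfolding tight_at_def by blast
qed

lemma (in elementary) tight_at_degree_two:
  assumes "(a, b) \<in> E" "card (E `` {a}) = 2"
  shows "tight_at A E {a} a b"
proof -
  have "{a} \<noteq> A" using two by auto
  then show ?thesis using assms sub by (intro tight_atI) auto
qed

text \<open>Vertices outside N(X) have no neighbour in X, and \<open>b\<close> has only
  \<open>a\<close> there, so the set on the other side has its neighbours in A - X together with
  \<open>a\<close>. The second part gives its size, needed to compare tight sets of different
  colours.\<close>

lemma (in elementary) tight_at_swap:
  assumes t: "tight_at A E X a b"
  shows "tight_at B (E\<inverse>) (insert b (B - E `` X)) b a"
    and "card (insert b (B - E `` X)) = card A - card X"
proof -
  interpret S: elementary B A "E\<inverse>" by (rule swap)
  let ?Y = "insert b (B - E `` X)"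
  from t have X: "X \<subset> A" "a \<in> X" "(a, b) \<in> E" "card (E `` X) = Suc (card X)"
    "\<forall>x\<in>X. (x, b) \<in> E \<longrightarrow> x = a" unfolding tight_at_def by auto
  have finX: "finite X" using X finA finite_subset by blast
  have b: "b \<in> B" "b \<in> E `` X" using X sub by auto
  have lt: "card X < card A" using X finA by (simp add: psubset_card_mono)
  have pos: "0 < card X" using X finX by (auto simp: card_gt_0_iff)
  have "card (B - E `` X) = card B - Suc (card X)" using X image_sub by (simp add: card_Diff_subset)
  then show c: "card ?Y = card A - card X" using b finB lt cardAB by simp
  have "?Y \<noteq> B" using c cardAB lt pos by (metis diff_less less_irrefl less_trans)
  moreover have "E\<inverse> `` ?Y \<subseteq> insert a (A - X)" using X(5) sub by blast
  then have "card (E\<inverse> `` ?Y) \<le> card (insert a (A - X))" using finA by (simp add: card_mono)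
  then have "card (E\<inverse> `` ?Y) \<le> Suc (card ?Y)"
    using c X(1,2) finA finX by (simp add: card_Diff_subset psubset_imp_subset)
  ultimately show "tight_at B (E\<inverse>) ?Y b a"
    using X(2,3) b by (intro S.tight_atI) auto
qed

locale minimal_elementary = elementary +
  assumes tight: "\<And>a b. (a, b) \<in> E \<Longrightarrow> \<exists>X. tight_at A E X a b"

lemma (in minimal_elementary) minimal_swap: "minimal_elementary B A (E\<inverse>)"
proof -
  interpret S: elementary B A "E\<inverse>" by (rule swap)
  show ?thesis using tight tight_at_swap by unfold_locales blast
qed

section \<open>Vertex weights and bicontraction\<close>

definition vertex_weight :: "nat \<Rightarrow> int" where
  "vertex_weight d = (if d = 2 then 1 else 2 - int d)"

definition weight :: "'a set \<Rightarrow> 'a set \<Rightarrow> ('a \<times> 'a) set \<Rightarrow> int" where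
  "weight A B E = (\<Sum>a\<in>A. vertex_weight (card (E `` {a}))) + (\<Sum>b\<in>B. vertex_weight (card (E\<inverse> `` {b})))"

lemma weight_swap: "weight B A (E\<inverse>) = weight A B E"
  by (simp add: weight_def)

text \<open>The path a, b, a' is shrunk to \<open>a\<close>. No parallel edges arise, so the new
  degree is d + d' - 2 and the weights 2 - d and 2 - d' add up exactly; only the weight 1 of
  \<open>b\<close> is lost.\<close>

lemma (in minimal_elementary) bicontraction:
  assumes b: "b \<in> B" "E\<inverse> `` {b} = {a, a'}" "a \<noteq> a'"
    and deg: "3 \<le> card (E `` {a})" "3 \<le> card (E `` {a'})"
  defines "E' \<equiv> {(x, y). y \<noteq> b \<and> x \<noteq> a' \<and> ((x, y) \<in> E \<or> x = a \<and> (a', y) \<in> E)}"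
  shows "minimal_elementary (A - {a'}) (B - {b}) E'"
    and "weight A B E = weight (A - {a'}) (B - {b}) E' + 1"
proof -
  have ab: "(a, b) \<in> E" "(a', b) \<in> E" "a \<in> A" "a' \<in> A" using b sub by blast+
  have nb: "\<And>x. (x, b) \<in> E \<Longrightarrow> x = a \<or> x = a'" using b by blast
  have E'iff: "(x, y) \<in> E' \<longleftrightarrow> y \<noteq> b \<and> x \<noteq> a' \<and> ((x, y) \<in> E \<or> x = a \<and> (a', y) \<in> E)" for x y
    by (simp add: E'_def)
  have E'D: "y \<noteq> b \<and> x \<noteq> a' \<and> ((x, y) \<in> E \<or> x = a \<and> (a', y) \<in> E)" if "(x, y) \<in> E'" for x y
    using that E'iff by simp
  have E'I: "(x, y) \<in> E \<Longrightarrow> y \<noteq> b \<Longrightarrow> x \<noteq> a' \<Longrightarrow> (x, y) \<in> E'"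
    "(a', y) \<in> E \<Longrightarrow> y \<noteq> b \<Longrightarrow> (a, y) \<in> E'" for x y
    using E'iff b(3) by auto
  \<comment> \<open>A tight set for (a, v) cannot contain a', which is also adjacent to v; in it
    both b and v then hang on \<open>a\<close> alone.\<close>
  have common: "v = b" if v: "(a, v) \<in> E" "(a', v) \<in> E" for v
  proof (rule ccontr)
    assume "v \<noteq> b"
    obtain T where T: "tight_at A E T a v" using tight v by blast
    then have "a' \<notin> T" using v b(3) unfolding tight_at_def by blast
    then show False
      using two_pendant[of T a b v] T deg(1) ab \<open>v \<noteq> b\<close> nb unfolding tight_at_def by blast
  qed
  \<comment> \<open>A set containing the merged vertex stands for the old set with both a and a';
    the balance is kept because one vertex and the neighbour b disappear together.\<close>
  have img1: "E' `` X = E `` insert a' X - {b}" if "a \<in> X" "a' \<notin> X" for X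
    using that by (auto simp: E'iff)
  have img2: "E' `` X = E `` X" if "a \<notin> X" "a' \<notin> X" for X
    proof (intro equalityI subsetI)
    fix y assume "y \<in> E' `` X"
    then show "y \<in> E `` X" using that E'D by blast
  next
    fix y assume "y \<in> E `` X"
    then obtain x where x: "x \<in> X" "(x, y) \<in> E" by blast
    then have "x \<noteq> a'" "y \<noteq> b" using that nb by blast+
    then show "y \<in> E' `` X" using x E'I by blast
  qed
  have "card (E `` {a}) \<le> card B" using image_sub finB by (simp add: card_mono)
  then have three: "3 \<le> card A" using deg cardAB by linarith
  have E'sub: "E' \<subseteq> (A - {a'}) \<times> (B - {b})" using sub ab b(3) by (auto simp: E'iff)
  have cm: "card (A - {a'}) = card A - 1" "card (B - {b}) = card B - 1"
    using ab b finA finB by simp_all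
  interpret C: elementary "A - {a'}" "B - {b}" E'
  proof
    fix X assume X: "X \<subset> A - {a'}" "X \<noteq> {}"
    have finX: "finite X" and a'X: "a' \<notin> X" using X finA finite_subset by blast+
    show "card X < card (E' `` X)"
    proof (cases "a \<in> X")
      case True
      have "insert a' X \<subset> A" using X ab by blast
      then have "card (insert a' X) < card (E `` insert a' X)" using hall by blast
      moreover have "card (E `` insert a' X - {b}) = card (E `` insert a' X) - 1"
        using ab by (subst card_Diff_singleton) auto
      ultimately show ?thesis using img1[OF True a'X] a'X finX by simp
    next
      case False
      have "X \<subset> A" using X by blast
      then show ?thesis using img2[OF False a'X] hall X by metis
    qed
  next
    show "card (A - {a'}) = card (B - {b})" using cm cardAB by simp
    show "2 \<le> card (A - {a'})" using cm three by simp
    show "E' \<subseteq> (A - {a'}) \<times> (B - {b})" by (rule E'sub)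
    show "(A - {a'}) \<inter> (B - {b}) = {}" using disj by blast
  qed (use finA finB in auto)
  show "minimal_elementary (A - {a'}) (B - {b}) E'"
  proof
    fix x y assume xy: "(x, y) \<in> E'"
    then obtain x0 where x0: "(x0, y) \<in> E" "x0 = x \<and> x \<noteq> a' \<or> x = a \<and> x0 = a'" and yb: "y \<noteq> b"
      using E'D by blast
    have xa': "x \<noteq> a'" using xy E'D by blast
    obtain T where "tight_at A E T x0 y" using tight x0 by blast
    then have T: "T \<subset> A" "x0 \<in> T" "card (E `` T) = Suc (card T)" "\<forall>z\<in>T. (z, y) \<in> E \<longrightarrow> z = x0"
      unfolding tight_at_def by blast+
    have finT: "finite T" using T(1) finA finite_subset by blast
    \<comment> \<open>If T contains exactly one of a, a', this vertex is dropped from T; b then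
      leaves the neighbourhood, so the surplus does not grow.\<close>
    have red: "card (E `` (T - {c})) \<le> Suc (card (T - {c}))" if "c \<in> T" "(c, b) \<in> E" "T \<inter> {a, a'} = {c}" for c
    proof -
      have "E `` (T - {c}) \<subseteq> E `` T - {b}" using nb that by blast
      then have "card (E `` (T - {c})) \<le> card (E `` T - {b})" by (simp add: card_mono)
      also have "\<dots> = card T" using that T(3) by (subst card_Diff_singleton) auto
      also have "\<dots> \<le> Suc (card (T - {c}))" using that finT by (simp add: card_Suc_Diff1)
      finally show ?thesis .
    qed
    \<comment> \<open>The dropped vertex is never the tail of the edge under consideration, since
      otherwise b and y would both hang on it.\<close>
    have x0c: "x0 \<noteq> c" if "c = a \<or> c = a'" "T \<inter> {a, a'} = {c}" for c
      using two_pendant[OF T(1,3), of c b y] that T x0 yb deg ab nb by blast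
    show "\<exists>X. tight_at (A - {a'}) E' X x y"
    proof (cases "a \<in> T"; cases "a' \<in> T")
      assume aT: "a \<in> T" "a' \<in> T"
      have "E' `` (T - {a'}) = E `` T - {b}" using img1[of "T - {a'}"] aT b(3) by (simp add: insert_absorb)
      moreover have "card (E `` T - {b}) = card T" using aT ab T(3) by (subst card_Diff_singleton) auto
      moreover have "card T = Suc (card (T - {a'}))" using aT finT by (metis card_Suc_Diff1)
      ultimately have "card (E' `` (T - {a'})) = Suc (card (T - {a'}))" by simp
      moreover have "\<forall>z\<in>T - {a'}. (z, y) \<in> E' \<longrightarrow> z = x" using T(4) x0 aT E'D by blast
      moreover have "x \<in> T - {a'}" using T(2) x0(2) aT xa' by blast
      moreover have "T - {a'} \<subset> A - {a'}" using T(1) aT by blast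
      ultimately show ?thesis using xy unfolding tight_at_def by blast
    next
      assume aT: "a \<notin> T" "a' \<notin> T"
      then have "card (E' `` T) = Suc (card T)" using img2 T by simp
      moreover have "\<forall>z\<in>T. (z, y) \<in> E' \<longrightarrow> z = x" using T(2,4) x0 aT E'D by blast
      moreover have "x \<in> T" using T(2) x0(2) aT by blast
      moreover have "T \<subset> A - {a'}" using T(1) aT ab(3) b(3) by blast
      ultimately show ?thesis using xy unfolding tight_at_def by blast
    next
      assume aT: "a \<in> T" "a' \<notin> T"
      then have i: "T \<inter> {a, a'} = {a}" by blast
      have xx: "x = x0" "x \<noteq> a" using x0c[OF _ i] x0(2) aT T(2) by blast+
      have "card (E' `` (T - {a})) \<le> Suc (card (T - {a}))"
        using img2[of "T - {a}"] red[OF aT(1) ab(1) i] aT by simp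
      moreover have "\<forall>z\<in>T - {a}. (z, y) \<in> E' \<longrightarrow> z = x" using T(4) xx E'D by blast
      moreover have "x \<in> T - {a}" using T(2) xx by blast
      moreover have "T - {a} \<subset> A - {a'}" using T(1) aT ab(3) b(3) by blast
      ultimately show ?thesis using xy C.tight_atI by blast
    next
      assume aT: "a \<notin> T" "a' \<in> T"
      then have i: "T \<inter> {a, a'} = {a'}" by blast
      have xx: "x = x0" "x \<noteq> a'" using x0c[OF _ i] x0(2) xa' by blast+
      have "card (E' `` (T - {a'})) \<le> Suc (card (T - {a'}))"
        using img2[of "T - {a'}"] red[OF aT(2) ab(2) i] aT by simp
      moreover have "\<forall>z\<in>T - {a'}. (z, y) \<in> E' \<longrightarrow> z = x" using T(4) xx aT E'D by blast
      moreover have "x \<in> T - {a'}" using T(2) xx by blast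
      moreover have "T - {a'} \<subset> A - {a'}" using T(1) aT by blast
      ultimately show ?thesis using xy C.tight_atI by blast
    qed
  qed
  have degrest: "card (E' `` {x}) = card (E `` {x})" if "x \<noteq> a" "x \<noteq> a'" for x
    using img2[of "{x}"] that by simp
  have "E' `` {a} = (E `` {a} - {b}) \<union> (E `` {a'} - {b})" using img1[of "{a}"] b(3) by auto
  moreover have "(E `` {a} - {b}) \<inter> (E `` {a'} - {b}) = {}" using common by blast
  ultimately have "card (E' `` {a}) = card (E `` {a} - {b}) + card (E `` {a'} - {b})"
    by (simp add: card_Un_disjoint)
  moreover have "card (E `` {a} - {b}) = card (E `` {a}) - 1" "card (E `` {a'} - {b}) = card (E `` {a'}) - 1"
    using ab by (subst card_Diff_singleton, auto)+
  ultimately have dega: "int (card (E' `` {a})) = int (card (E `` {a})) + int (card (E `` {a'})) - 2" using deg by simp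
  \<comment> \<open>A neighbour of a' gets \<open>a\<close> in exchange, and by
    \<open>common\<close> it was not adjacent to \<open>a\<close> before.\<close>
  have degy: "card (E'\<inverse> `` {y}) = card (E\<inverse> `` {y})" if y: "y \<noteq> b" for y
  proof (cases "(a', y) \<in> E")
    case True
    then have "a \<notin> E\<inverse> `` {y}" using common y by blast
    moreover have "E'\<inverse> `` {y} = insert a (E\<inverse> `` {y} - {a'})" using True y b(3) by (auto simp: E'iff)
    moreover have "card (E\<inverse> `` {y}) = Suc (card (E\<inverse> `` {y} - {a'}))"
      using True card.remove[of "E\<inverse> `` {y}" a'] by simp
    ultimately show ?thesis by simp
  next
    case False
    then have "E'\<inverse> `` {y} = E\<inverse> `` {y}" using y by (auto simp: E'iff)
    then show ?thesis by simp
  qed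
  have "(\<Sum>x\<in>A. vertex_weight (card (E `` {x})))
      = vertex_weight (card (E `` {a'})) + (vertex_weight (card (E `` {a}))
        + (\<Sum>x\<in>A - {a'} - {a}. vertex_weight (card (E `` {x}))))"
    using ab finA b(3) by (simp add: sum.remove[of A a'] sum.remove[of "A - {a'}" a])
  also have "(\<Sum>x\<in>A - {a'} - {a}. vertex_weight (card (E `` {x})))
      = (\<Sum>x\<in>A - {a'} - {a}. vertex_weight (card (E' `` {x})))"
    using degrest by (intro sum.cong) auto
  finally have sA: "(\<Sum>x\<in>A. vertex_weight (card (E `` {x})))
      = vertex_weight (card (E `` {a'})) + (vertex_weight (card (E `` {a}))
        + (\<Sum>x\<in>A - {a'} - {a}. vertex_weight (card (E' `` {x}))))" .
  have sA': "(\<Sum>x\<in>A - {a'}. vertex_weight (card (E' `` {x})))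
      = vertex_weight (card (E' `` {a})) + (\<Sum>x\<in>A - {a'} - {a}. vertex_weight (card (E' `` {x})))"
    using ab finA b(3) by (simp add: sum.remove[of "A - {a'}" a])
  have "(\<Sum>y\<in>B. vertex_weight (card (E\<inverse> `` {y})))
     = vertex_weight (card (E\<inverse> `` {b})) + (\<Sum>y\<in>B - {b}. vertex_weight (card (E\<inverse> `` {y})))"
    using b(1) finB by (simp add: sum.remove[of B b])
  also have "(\<Sum>y\<in>B - {b}. vertex_weight (card (E\<inverse> `` {y}))) = (\<Sum>y\<in>B - {b}. vertex_weight (card (E'\<inverse> `` {y})))"
    using degy by (intro sum.cong) auto
  finally have sB: "(\<Sum>y\<in>B. vertex_weight (card (E\<inverse> `` {y})))
     = vertex_weight (card (E\<inverse> `` {b})) + (\<Sum>y\<in>B - {b}. vertex_weight (card (E'\<inverse> `` {y})))" .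
  have "card (E\<inverse> `` {b}) = 2" using b by simp
  then show "weight A B E = weight (A - {a'}) (B - {b}) E' + 1"
    unfolding weight_def sA sA' sB using dega deg by (simp add: vertex_weight_def)
qed

section \<open>A smallest tight set at a vertex of degree at least three\<close>

text \<open>Minimality of \<open>X\<close> ranges over the tight sets of both colour classes, so that the complement of
  a tight set can be compared with \<open>X\<close>; \<open>pairA\<close> and \<open>pairB\<close> exclude the case settled by bicontraction.\<close>

locale hub_tight = minimal_elementary +
  fixes X a b
  assumes X: "tight_at A E X a b" and hub: "3 \<le> card (E `` {a})"
    and minA: "\<And>X' a' b'. tight_at A E X' a' b' \<Longrightarrow> 3 \<le> card (E `` {a'}) \<Longrightarrow> card X \<le> card X'"
    and minB: "\<And>Y' b' a'. tight_at B (E\<inverse>) Y' b' a' \<Longrightarrow> 3 \<le> card (E\<inverse> `` {b'}) \<Longrightarrow> card X \<le> card Y'"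
    and pairA: "\<And>u. u \<in> A \<Longrightarrow> card (E `` {u}) = 2 \<Longrightarrow> \<exists>v. (u, v) \<in> E \<and> card (E\<inverse> `` {v}) = 2"
    and pairB: "\<And>v. v \<in> B \<Longrightarrow> card (E\<inverse> `` {v}) = 2 \<Longrightarrow> \<exists>u. (u, v) \<in> E \<and> card (E `` {u}) = 2"
begin

text \<open>Removing \<open>b\<close> balances the pair: |Y| = |X|, and (a, b) is the only edge from
  X that does not end in Y.\<close>

definition Y where "Y = E `` X - {b}"
definition F where "F = E\<inverse> `` Y - X"

section \<open>Edges inside the smallest tight set and edges entering it\<close>

lemma basics: "X \<subset> A" "a \<in> X" "(a, b) \<in> E" "card (E `` X) = Suc (card X)" "a \<in> A" "b \<in> B"
  using X sub unfolding tight_at_def by blast+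

lemma unique_b: "x \<in> X \<Longrightarrow> (x, b) \<in> E \<Longrightarrow> x = a"
  using X unfolding tight_at_def by blast

lemma finX: "finite X" using basics(1) finA finite_subset by blast

lemma NX: "E `` X = insert b Y" "b \<notin> Y" "Y \<subseteq> B" "finite Y"
  using basics sub finB unfolding Y_def by (blast, blast, blast, simp)

lemma cardY: "card Y = card X"
  using NX basics(4) by simp

lemma card_X: "2 \<le> card X"
proof -
  have "card (E `` {a}) \<le> card (E `` X)" using basics(2) by (intro card_mono) auto
  then show ?thesis using hub basics(4) by linarith
qed

lemma Fsub: "F \<subseteq> A - X" "finite F"
  using sub finA unfolding F_def by auto

lemma b_outside: obtains c where "c \<in> A" "c \<notin> X" "(c, b) \<in> E"
proof -
  have "\<not> E\<inverse> `` {b} \<subseteq> {a}"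
  proof
    assume "E\<inverse> `` {b} \<subseteq> {a}"
    then have "card (E\<inverse> `` {b}) \<le> 1" by (metis card.empty card_insert_disjoint card_mono empty_iff finite.emptyI finite_insert One_nat_def)
    then show False using degB[OF basics(6)] by linarith
  qed
  then obtain c where c: "(c, b) \<in> E" "c \<noteq> a" by blast
  then show ?thesis using that[of c] unique_b sub by blast
qed

text \<open>On the other side, T turns into a tight set at v of size |A - T|. As A - T is a proper
  subset of X, the minimality of X over both classes forbids v to have degree at least
  three.\<close>

lemma complement_card:
  assumes "tight_at A E T u v" "X \<union> T = A" "X \<inter> T \<noteq> {}"
  shows "card (E\<inverse> `` {v}) = 2"
proof (rule ccontr)
  assume n: "card (E\<inverse> `` {v}) \<noteq> 2"
  have v: "v \<in> B" and T: "T \<subset> A" using assms(1) sub unfolding tight_at_def by blast+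
  have finT: "finite T" using T finA finite_subset by blast
  have "3 \<le> card (E\<inverse> `` {v})" using degB[OF v] n by linarith
  then have "card X \<le> card A - card T"
    using minB[OF tight_at_swap(1)[OF assms(1)]] tight_at_swap(2)[OF assms(1)] by simp
  also have "card A - card T = card (A - T)" using T finT by (simp add: card_Diff_subset psubset_imp_subset)
  also have "A - T \<subset> X" using assms(2,3) by blast
  then have "card (A - T) < card X" using finX by (simp add: psubset_card_mono)
  finally show False by simp
qed

text \<open>If both ends had degree at least three, a tight set T for the edge could be cut down to
  one smaller than X: to X \<inter> T by uncrossing, or to X - {a} when T contains X. The case X
  \<union> T = A is excluded by \<open>complement_card\<close>.\<close>

lemma inner:
  assumes uv: "(u, v) \<in> E" "u \<in> X" "v \<in> Y"
  shows "card (E `` {u}) = 2 \<or> card (E\<inverse> `` {v}) = 2"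
proof (rule ccontr)
  assume n: "\<not> ?thesis"
  have "u \<in> A" "v \<in> B" using uv sub by blast+
  then have d: "3 \<le> card (E `` {u})" "3 \<le> card (E\<inverse> `` {v})"
    using degA[of u] degB[of v] n by linarith+
  obtain T where tT: "tight_at A E T u v" using tight uv by blast
  then have T: "T \<subset> A" "u \<in> T" "card (E `` T) = Suc (card T)" "\<forall>z\<in>T. (z, v) \<in> E \<longrightarrow> z = u"
    unfolding tight_at_def by blast+
  have un: "X \<union> T \<noteq> A" using complement_card[OF tT] n uv T by blast
  show False
  proof (cases "X \<subseteq> T")
    case True
    show False
    proof (cases "u = a")
      case True
      have "\<forall>x\<in>X. (x, v) \<in> E \<longrightarrow> x = a" using T(4) True \<open>X \<subseteq> T\<close> by blast
      moreover have "b \<noteq> v" using uv NX by blast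
      ultimately show False
        using two_pendant[OF basics(1,4,2) hub, of b v] basics(3) uv(1) True unique_b by blast
    next
      case False
      \<comment> \<open>Without \<open>a\<close> the set X also loses b, so X - {a} is again tight,
        now for (u, v), and too small.\<close>
      have "E `` (X - {a}) \<subseteq> E `` X - {b}" using unique_b by blast
      then have "card (E `` (X - {a})) \<le> card (E `` X - {b})" by (intro card_mono) auto
      also have "\<dots> = card Y" unfolding Y_def ..
      also have "\<dots> = Suc (card (X - {a}))" using cardY card_Suc_Diff1[OF finX basics(2)] by simp
      finally have "tight_at A E (X - {a}) u v"
        using T(4) basics(1) False uv True by (intro tight_atI) blast+
      then have "card X \<le> card (X - {a})" using minA d by blast
      then show False using card_Suc_Diff1[OF finX basics(2)] by simp
    qed
  next
    case False
    have "X \<inter> T \<noteq> {}" using uv T by blast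
    then have "card (E `` (X \<inter> T)) = Suc (card (X \<inter> T))"
      using uncross[OF basics(1,4) T(1,3)] un by blast
    then have "tight_at A E (X \<inter> T) u v"
      unfolding tight_at_def using T(2,4) uv(1,2) basics(1) by blast
    then have "card X \<le> card (X \<inter> T)" using minA d by blast
    moreover have "card (X \<inter> T) < card X" using False finX by (intro psubset_card_mono) blast+
    ultimately show False by simp
  qed
qed

text \<open>Uncrossing would give v a neighbour in X \<inter> T, although u outside X is its only
  neighbour in T; so X \<union> T = A and v has degree two. By \<open>pairB\<close> one of its two
  neighbours has degree two. If that is the neighbour x in X, then x can be removed from X together
  with v, against minimality.\<close>

lemma entering:
  assumes uv: "(u, v) \<in> E" "u \<notin> X" "v \<in> Y" and tT: "tight_at A E T u v" and ne: "X \<inter> T \<noteq> {}"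
  shows "card (E `` {u}) = 2"
proof (rule ccontr)
  assume n: "card (E `` {u}) \<noteq> 2"
  from tT have T: "T \<subset> A" "u \<in> T" "card (E `` T) = Suc (card T)" "\<forall>z\<in>T. (z, v) \<in> E \<longrightarrow> z = u"
    unfolding tight_at_def by blast+
  have "v \<in> E `` X" using uv unfolding Y_def by blast
  then obtain x where x: "x \<in> X" "(x, v) \<in> E" by blast
  have "X \<union> T = A"
  proof (rule ccontr)
    assume "X \<union> T \<noteq> A"
    then have "E `` (X \<inter> T) = E `` X \<inter> E `` T" using uncross[OF basics(1,4) T(1,3) ne] by blast
    then have "v \<in> E `` (X \<inter> T)" using x uv T by blast
    then show False using T(4) uv(2) by blast
  qed
  then have dv: "card (E\<inverse> `` {v}) = 2" using complement_card[OF tT] ne by blast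
  have "x \<noteq> u" using x uv by blast
  then have "card {x, u} = 2" by simp
  moreover have "{x, u} \<subseteq> E\<inverse> `` {v}" using x uv by blast
  ultimately have nv: "E\<inverse> `` {v} = {x, u}" using dv by (metis card_subset_eq finite_converse_image)
  have "v \<in> B" using uv sub by blast
  then obtain w where w: "(w, v) \<in> E" "card (E `` {w}) = 2" using pairB dv by blast
  then have "w = x" using nv n by blast
  then have "x \<noteq> a" using w hub by auto
  have "E `` (X - {x}) \<subseteq> E `` X - {v}" using nv uv by blast
  then have "card (E `` (X - {x})) \<le> card (E `` X - {v})" by (intro card_mono) auto
  also have "\<dots> = card X" using basics(4) x by (subst card_Diff_singleton) auto
  also have "\<dots> = Suc (card (X - {x}))" using card_Suc_Diff1[OF finX x(1)] by simp
  finally have "tight_at A E (X - {x}) a b"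
    using basics \<open>x \<noteq> a\<close> unique_b by (intro tight_atI) blast+
  then have "card X \<le> card (X - {x})" using minA hub by blast
  then show False using card_Suc_Diff1[OF finX x(1)] by simp
qed

text \<open>Submodularity bounds N(X) \<inter> N(T) by 1 if X \<union> T is proper. If X \<union> T
  = A the bound is only 2, but then one of the common neighbours is b, which is not in Y.\<close>

lemma disjoint_tight:
  assumes T: "T \<subset> A" "card (E `` T) = Suc (card T)" and dj: "X \<inter> T = {}"
  shows "card (E `` T \<inter> Y) \<le> 1"
proof -
  have finT: "finite T" using T finA finite_subset by blast
  have c: "card (X \<union> T) = card X + card T" using card_Un_disjoint[OF finX finT dj] .
  have m: "card (E `` (X \<union> T)) + card (E `` X \<inter> E `` T) = card X + card T + 2"
    using card_image_Un_Int[of X T] basics(4) T(2) by simp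
  show ?thesis
  proof (cases "X \<union> T = A")
    case False
    then have "X \<union> T \<subset> A" using basics(1) T by blast
    then have "card (X \<union> T) < card (E `` (X \<union> T))" using hall basics(2) by blast
    then have "card (E `` X \<inter> E `` T) \<le> 1" using m c by linarith
    moreover have "card (E `` T \<inter> Y) \<le> card (E `` X \<inter> E `` T)"
      unfolding Y_def by (intro card_mono) auto
    ultimately show ?thesis by linarith
  next
    case True
    then have "card (E `` (X \<union> T)) = card X + card T" using full c cardAB by simp
    then have i: "card (E `` X \<inter> E `` T) = 2" using m by linarith
    obtain c where "c \<in> A" "c \<notin> X" "(c, b) \<in> E" by (rule b_outside)
    then have "b \<in> E `` X \<inter> E `` T" using True basics by blast
    moreover have "E `` T \<inter> Y = (E `` X \<inter> E `` T) - {b}" unfolding Y_def by blast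
    ultimately show ?thesis using i by (simp add: card_Diff_singleton)
  qed
qed

text \<open>This ensures that redirecting the entering edges to one vertex creates no parallel
  edges, and that |F| counts these edges.\<close>

lemma unique_entry:
  assumes "u \<notin> X" "v \<in> Y" "v' \<in> Y" "(u, v) \<in> E" "(u, v') \<in> E"
  shows "v = v'"
proof (rule ccontr)
  assume ne: "v \<noteq> v'"
  obtain T where tT: "tight_at A E T u v" using tight assms by blast
  then have T: "T \<subset> A" "u \<in> T" "card (E `` T) = Suc (card T)" unfolding tight_at_def by blast+
  show False
  proof (cases "X \<inter> T = {}")
    case True
    have "{v, v'} \<subseteq> E `` T \<inter> Y" using assms T by blast
    then have "card {v, v'} \<le> card (E `` T \<inter> Y)" using NX by (intro card_mono) auto
    then show False using disjoint_tight[OF T(1,3) True] ne by simp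
  next
    case False
    then have "card (E `` {u}) = 2" using entering assms tT by blast
    moreover have "{v, v'} \<subseteq> E `` {u}" "card {v, v'} = 2" using assms ne by auto
    ultimately have nu: "E `` {u} = {v, v'}" by (metis card_subset_eq finite_image)
    \<comment> \<open>All neighbours of u lie in Y, so adding u to X gives no new neighbour and uses
      up the surplus 1. Hence X and u exhaust A, and u would be the second neighbour of b.\<close>
    have "E `` insert u X = E `` {u} \<union> E `` X" by blast
    also have "E `` {u} \<subseteq> E `` X" using nu assms(2,3) unfolding Y_def by simp
    finally have img: "E `` insert u X = E `` X" by blast
    have "u \<in> A" using assms sub by blast
    have "insert u X = A"
    proof (rule ccontr)
      assume "insert u X \<noteq> A"
      then have "insert u X \<subset> A" using \<open>u \<in> A\<close> basics(1) by blast
      then have "card (insert u X) < card (E `` insert u X)" using hall by blast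
      then show False using img basics(4) assms(1) finX by simp
    qed
    moreover obtain c where "c \<in> A" "c \<notin> X" "(c, b) \<in> E" by (rule b_outside)
    ultimately have "b \<in> E `` {u}" by blast
    then show False using nu assms(2,3) NX(2) by auto
  qed
qed


text \<open>The balanced pair \<open>(X, Y)\<close> is replaced by the single edge \<open>(a, w)\<close>; the edges entering \<open>Y\<close> from
  outside \<open>X\<close>, whose tails form \<open>F\<close>, are redirected to \<open>w\<close>.\<close>

definition contraction :: "'a \<Rightarrow> ('a \<times> 'a) set" where
  "contraction w = E \<inter> (A - X) \<times> (B - Y) \<union> {(a, b), (a, w)} \<union> F \<times> {w}"

lemma contraction_iff:
  assumes "w \<in> Y"
  shows "(x, y) \<in> contraction w \<longleftrightarrow>
    (x \<notin> X \<and> y \<notin> Y \<and> (x, y) \<in> E) \<or> (x = a \<and> (y = b \<or> y = w)) \<or> (x \<in> F \<and> y = w)"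
  using sub unfolding contraction_def by auto

lemma F_iff: "x \<in> F \<longleftrightarrow> x \<notin> X \<and> (\<exists>v\<in>Y. (x, v) \<in> E)"
  unfolding F_def by blast

text \<open>A set containing \<open>a\<close> represents X \<union> T: its neighbourhood is N(X
  \<union> T) with Y shrunk to w. A set avoiding X only has its neighbours in Y merged into
  w.\<close>

lemma contraction_image:
  assumes w: "w \<in> Y" and T: "X \<inter> T = {}"
  shows "contraction w `` T = (E `` T - Y) \<union> (if E `` T \<inter> Y = {} then {} else {w})"
    and "contraction w `` insert a T = (E `` T - Y) \<union> {b, w}"
proof -
  have aT: "a \<notin> T" and aF: "a \<notin> F" using basics(2) T F_iff by blast+
  have 1: "contraction w `` T = (E `` T - Y) \<union> (if T \<inter> F = {} then {} else {w})"
  proof (rule set_eqI)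
    fix y
    have "y \<in> contraction w `` T \<longleftrightarrow> (\<exists>x\<in>T. y \<notin> Y \<and> (x, y) \<in> E \<or> x \<in> F \<and> y = w)"
      unfolding Image_iff contraction_iff[OF w] using T aT by blast
    then show "y \<in> contraction w `` T \<longleftrightarrow> y \<in> (E `` T - Y) \<union> (if T \<inter> F = {} then {} else {w})"
      by (simp add: Image_iff) blast
  qed
  have "T \<inter> F = {} \<longleftrightarrow> E `` T \<inter> Y = {}" using T F_iff by blast
  then show 2: "contraction w `` T = (E `` T - Y) \<union> (if E `` T \<inter> Y = {} then {} else {w})"
    using 1 by simp
  have "contraction w `` {a} = {b, w}" using aF basics(2) by (auto simp: contraction_iff[OF w])
  moreover have "contraction w `` insert a T = contraction w `` {a} \<union> contraction w `` T" by blast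
  ultimately show "contraction w `` insert a T = (E `` T - Y) \<union> {b, w}" using 2 by auto
qed

text \<open>An outside vertex has at most one edge into Y, so redirecting to w merges
  nothing.\<close>

lemma contraction_degreeA:
  assumes w: "w \<in> Y" and x: "x \<notin> X"
  shows "card (contraction w `` {x}) = card (E `` {x})"
proof (cases "E `` {x} \<inter> Y = {}")
  case True
  then show ?thesis using contraction_image(1)[OF w, of "{x}"] x by (simp add: Diff_triv)
next
  case False
  then obtain v where v: "v \<in> Y" "(x, v) \<in> E" by blast
  then have "E `` {x} - Y = E `` {x} - {v}" using unique_entry[OF x] by blast
  then have "contraction w `` {x} = insert w (E `` {x} - {v})"
    using contraction_image(1)[OF w, of "{x}"] x False by simp
  moreover have "w \<notin> E `` {x} - {v}" using unique_entry[OF x] w v by blast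
  moreover have "Suc (card (E `` {x} - {v})) = card (E `` {x})" using v by (intro card_Suc_Diff1) auto
  ultimately show ?thesis by simp
qed

lemma contraction_degreeB:
  assumes w: "w \<in> Y" and y: "y \<notin> Y"
  shows "(contraction w)\<inverse> `` {y} = E\<inverse> `` {y}"
proof -
  have "y \<noteq> w" using w y by blast
  moreover have "x = a \<and> y = b" if "(x, y) \<in> E" "x \<in> X" for x
    using that y unique_b unfolding Y_def by blast
  ultimately show ?thesis using y basics(3) by (auto simp: contraction_iff[OF w])
qed

lemma contraction_degree_w:
  assumes w: "w \<in> Y"
  shows "(contraction w)\<inverse> `` {w} = insert a F"
  using w NX(2) by (auto simp: contraction_iff[OF w])

lemma card_parts: "card (A - X) + card X = card A" "card (B - Y) + card X = card A"
proof -
  show "card (A - X) + card X = card A"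
    using card_Diff_subset[of X A] card_mono[of A X] finA finX basics(1) by auto
  show "card (B - Y) + card X = card A"
    using card_Diff_subset[of Y B] card_mono[of B Y] finB NX(3,4) cardY cardAB by auto
qed

text \<open>Sets containing \<open>a\<close> are compared with X \<union> T0, from which |X| = |Y|
  cancels. For sets that avoid \<open>a\<close> but see Y, the new neighbour w supplies the
  strictness.\<close>

lemma contraction_elementary:
  assumes w: "w \<in> Y"
  shows "elementary (insert a (A - X)) (insert w (B - Y)) (contraction w)"
proof
  show "finite (insert a (A - X))" "finite (insert w (B - Y))" using finA finB by simp_all
  show "contraction w \<subseteq> insert a (A - X) \<times> insert w (B - Y)"
    using Fsub basics NX(2) unfolding contraction_def by blast
  show "insert a (A - X) \<inter> insert w (B - Y) = {}" using disj basics w NX(3) by blast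
  have c: "card (insert a (A - X)) = Suc (card (A - X))" "card (insert w (B - Y)) = Suc (card (B - Y))"
    using basics(2) w finA finB by simp_all
  then show "card (insert a (A - X)) = card (insert w (B - Y))" using card_parts by linarith
  have "A - X \<noteq> {}" using basics(1) by blast
  then have "card (A - X) \<noteq> 0" using finA by simp
  then show "2 \<le> card (insert a (A - X))" using c by linarith
  fix T assume T: "T \<subset> insert a (A - X)" "T \<noteq> {}"
  have finT: "finite T" using T finA finite_subset by (metis finite_Diff finite_insert psubset_imp_subset)
  show "card T < card (contraction w `` T)"
  proof (cases "a \<in> T")
    case True
    define T0 where "T0 = T - {a}"
    have T0: "T0 \<subset> A - X" "X \<inter> T0 = {}" "insert a T0 = T" using T True unfolding T0_def by blast+
    have finT0: "finite T0" using finT T0_def by simp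
    have cT: "card T = Suc (card T0)" using T0 finT0 basics(2) by (metis card_insert_disjoint disjoint_iff)
    have "card (X \<union> T0) = card X + card T0" using card_Un_disjoint[OF finX finT0 T0(2)] .
    moreover have "X \<union> T0 \<subset> A" "X \<union> T0 \<noteq> {}" using T0(1) basics(1,2) by blast+
    then have "card (X \<union> T0) < card (E `` (X \<union> T0))" using hall by blast
    moreover have "E `` (X \<union> T0) = Y \<union> ((E `` T0 - Y) \<union> {b})" using NX(1) by (auto simp: Image_Un)
    then have "card (E `` (X \<union> T0)) \<le> card Y + card ((E `` T0 - Y) \<union> {b})" by (metis card_Un_le)
    moreover have "contraction w `` T = insert w ((E `` T0 - Y) \<union> {b})"
      using contraction_image(2)[OF w T0(2)] T0(3) by auto
    then have "card (contraction w `` T) = Suc (card ((E `` T0 - Y) \<union> {b}))"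
      using w NX(2) by (metis Diff_iff UnE card_insert_disjoint finite_Diff finite_Un finite_image finite.emptyI finite_insert singletonD)
    ultimately show ?thesis using cT cardY by linarith
  next
    case False
    then have TX: "X \<inter> T = {}" and TA: "T \<subset> A" using T(1) basics(1,5) by blast+
    show ?thesis
    proof (cases "E `` T \<inter> Y = {}")
      case True
      then have "contraction w `` T = E `` T" using contraction_image(1)[OF w TX] by (simp add: Diff_triv)
      then show ?thesis using hall[OF TA T(2)] by simp
    next
      case False
      have "contraction w `` T = insert w (E `` T - Y)" using contraction_image(1)[OF w TX] False by simp
      then have cc: "card (contraction w `` T) = Suc (card (E `` T - Y))" using w by simp
      have "card (X \<union> T) = card X + card T" using card_Un_disjoint[OF finX finT TX] .
      \<comment> \<open>The neighbour b of X may be absent from N(T); strict Hall pays for it when X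
        \<union> T is proper, and when X \<union> T = A it belongs to N(T) anyway.\<close>
      moreover have "card (X \<union> T) \<le> card Y + card (E `` T - Y)"
      proof (cases "X \<union> T = A")
        case True
        obtain c where "c \<in> A" "c \<notin> X" "(c, b) \<in> E" by (rule b_outside)
        then have "b \<in> E `` T" using True by blast
        have "B = E `` (X \<union> T)" using True full by simp
        also have "\<dots> = Y \<union> (E `` T - Y)" using NX(1) \<open>b \<in> E `` T\<close> by (auto simp: Image_Un)
        finally have "card B \<le> card Y + card (E `` T - Y)" by (metis card_Un_le)
        then show ?thesis using True cardAB by simp
      next
        case False
        then have "X \<union> T \<subset> A" "X \<union> T \<noteq> {}" using TA basics(1,2) by blast+
        then have "card (X \<union> T) < card (E `` (X \<union> T))" using hall by blast
        also have "E `` (X \<union> T) = insert b (Y \<union> (E `` T - Y))" using NX(1) by (auto simp: Image_Un)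
        then have "card (E `` (X \<union> T)) \<le> Suc (card (Y \<union> (E `` T - Y)))" by (simp add: card_insert_le_m1 card_insert_if)
        also have "card (Y \<union> (E `` T - Y)) \<le> card Y + card (E `` T - Y)" by (rule card_Un_le)
        finally show ?thesis by simp
      qed
      ultimately show ?thesis using cc cardY by linarith
    qed
  qed
qed

text \<open>Replacing X by \<open>a\<close> in T and Y by w in N(T) lowers both cardinalities by |X|
  - 1, so tightness is kept.\<close>

lemma contraction_tight_absorb:
  assumes w: "w \<in> Y" and tT: "tight_at A E T x y" and XT: "X \<subseteq> T" and x: "x \<notin> X" and y: "y \<notin> Y"
  shows "tight_at (insert a (A - X)) (contraction w) (insert a (T - X)) x y"
proof -
  from tT have T: "T \<subset> A" "x \<in> T" "(x, y) \<in> E" "card (E `` T) = Suc (card T)" "\<forall>z\<in>T. (z, y) \<in> E \<longrightarrow> z = x"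
    unfolding tight_at_def by blast+
  have finT: "finite T" using T finA finite_subset by blast
  interpret C: elementary "insert a (A - X)" "insert w (B - Y)" "contraction w"
    by (rule contraction_elementary[OF w])
  have d: "X \<inter> (T - X) = {}" by blast
  have "E `` T = E `` X \<union> E `` (T - X)" using XT by blast
  then have ET: "E `` T = Y \<union> ((E `` (T - X) - Y) \<union> {b})" using NX(1) by auto
  have "card (E `` T) = card Y + card ((E `` (T - X) - Y) \<union> {b})"
    unfolding ET using NX(2,4) by (intro card_Un_disjoint) auto
  moreover have "contraction w `` insert a (T - X) = insert w ((E `` (T - X) - Y) \<union> {b})"
    using contraction_image(2)[OF w d] by auto
  then have "card (contraction w `` insert a (T - X)) \<le> Suc (card ((E `` (T - X) - Y) \<union> {b}))"
    by (simp add: card_insert_if)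
  moreover have "card T = card X + card (T - X)"
    using card_Un_disjoint[OF finX _ d] finT XT by (simp add: Un_absorb1)
  moreover have "card (insert a (T - X)) = Suc (card (T - X))" using finT basics(2) by simp
  ultimately have cc: "card (contraction w `` insert a (T - X)) \<le> Suc (card (insert a (T - X)))"
    using T(4) cardY by linarith
  have "z = x" if z: "z \<in> insert a (T - X)" "(z, y) \<in> contraction w" for z
  proof -
    have "y \<noteq> w" using w y by blast
    then have "(z, y) \<in> E" using z(2) basics(3) by (auto simp: contraction_iff[OF w])
    then show ?thesis using z(1) T(5) XT basics(2) by blast
  qed
  moreover have "insert a (T - X) \<subset> insert a (A - X)"
  proof -
    obtain t where "t \<in> A" "t \<notin> T" using T(1) by blast
    moreover from this have "t \<noteq> a" "t \<notin> X" using XT basics(2) by auto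
    ultimately show ?thesis using T(1) by blast
  qed
  moreover have "(x, y) \<in> contraction w" using T(3) x y by (simp add: contraction_iff[OF w])
  ultimately show ?thesis using cc T(2) x by (intro C.tight_atI) blast+
qed

text \<open>Merging the neighbours in Y can only shrink the neighbourhood of a set disjoint from X,
  so only the uniqueness of x remains as a condition.\<close>

lemma contraction_tight_disjoint:
  assumes w: "w \<in> Y" and T: "T \<subset> A" "card (E `` T) = Suc (card T)" "x \<in> T" and XT: "X \<inter> T = {}"
    and xy: "(x, y) \<in> contraction w" and u: "\<forall>z\<in>T. (z, y) \<in> contraction w \<longrightarrow> z = x"
  shows "tight_at (insert a (A - X)) (contraction w) T x y"
proof -
  interpret C: elementary "insert a (A - X)" "insert w (B - Y)" "contraction w"
    by (rule contraction_elementary[OF w])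
  have "card (contraction w `` T) \<le> card (E `` T)"
  proof (cases "E `` T \<inter> Y = {}")
    case True
    then show ?thesis using contraction_image(1)[OF w XT] by (simp add: Diff_triv)
  next
    case False
    then have "E `` T - Y \<subset> E `` T" by blast
    then have "card (E `` T - Y) < card (E `` T)" by (intro psubset_card_mono) auto
    moreover have "contraction w `` T = insert w (E `` T - Y)" using contraction_image(1)[OF w XT] False by simp
    then have "card (contraction w `` T) \<le> Suc (card (E `` T - Y))" by (simp add: card_insert_if)
    ultimately show ?thesis by linarith
  qed
  then have "card (contraction w `` T) \<le> Suc (card T)" using T(2) by simp
  moreover have "T \<subset> insert a (A - X)" using T(1) XT basics(2) by blast
  ultimately show ?thesis using T(3) xy u by (intro C.tight_atI)
qed

text \<open>Edges at \<open>a\<close> are indispensable because \<open>a\<close> now has degree two.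
  For any other edge, a tight set of the original edge is reused when disjoint from X; when it
  crosses X, it is joined with X, or a vertex of degree two settles the case.\<close>

lemma contraction_minimal:
  assumes w: "w \<in> Y"
  shows "minimal_elementary (insert a (A - X)) (insert w (B - Y)) (contraction w)"
proof -
  interpret C: elementary "insert a (A - X)" "insert w (B - Y)" "contraction w"
    by (rule contraction_elementary[OF w])
  note iff = contraction_iff[OF w]
  show ?thesis
  proof
    fix x y assume xy: "(x, y) \<in> contraction w"
    then consider "x \<notin> X" "y \<notin> Y" "(x, y) \<in> E" | "x = a" | "x \<in> F" "y = w"
      by (auto simp: iff)
    then show "\<exists>T. tight_at (insert a (A - X)) (contraction w) T x y"
    proof cases
      case 2
      have "contraction w `` insert a {} = {b, w}" using contraction_image(2)[OF w, of "{}"] by simp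
      moreover have "b \<noteq> w" using w NX(2) by blast
      ultimately have "card (contraction w `` {x}) = 2" using 2 by simp
      then show ?thesis using C.tight_at_degree_two[OF xy] by blast
    next
      case 1
      obtain T where tT: "tight_at A E T x y" using tight 1 by blast
      then have T: "T \<subset> A" "x \<in> T" "card (E `` T) = Suc (card T)" "\<forall>z\<in>T. (z, y) \<in> E \<longrightarrow> z = x"
        unfolding tight_at_def by blast+
      have yw: "y \<noteq> w" using w 1 by blast
      show ?thesis
      proof (cases "X \<inter> T = {}")
        case True
        have "z = x" if "z \<in> T" "(z, y) \<in> contraction w" for z
        proof -
          have "z \<noteq> a" using that True basics(2) by blast
          then have "(z, y) \<in> E" using that(2) yw by (auto simp: iff)
          then show ?thesis using T(4) that by blast
        qed
        then show ?thesis using contraction_tight_disjoint[OF w T(1,3,2) True xy] by blast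
      next
        case ne: False
        have yX: "z = a \<and> y = b" if "z \<in> X" "(z, y) \<in> E" for z
          using that 1 unique_b unfolding Y_def by blast
        show ?thesis
        proof (cases "X \<union> T = A")
          case True
          \<comment> \<open>Within T only x is adjacent to y, and within X at most \<open>a\<close>;
            as these sets cover A, y has degree two and the certificate comes from the other
            side.\<close>
          have "E\<inverse> `` {y} \<subseteq> {x, a}" using True T(4) yX sub by blast
          then have "E\<inverse> `` {y} \<subseteq> {x, a}" "card {x, a} \<le> 2" by (simp, simp add: card_insert_if)
          moreover have "y \<in> B" using 1 sub by blast
          then have "2 \<le> card (E\<inverse> `` {y})" by (rule degB)
          ultimately have "card (E\<inverse> `` {y}) = 2"
            by (meson card_mono finite.emptyI finite.insertI le_antisym order_trans)
          then have "card ((contraction w)\<inverse> `` {y}) = 2" using contraction_degreeB[OF w 1(2)] by simp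
          moreover have "(y, x) \<in> (contraction w)\<inverse>" using xy by simp
          ultimately have "tight_at (insert w (B - Y)) ((contraction w)\<inverse>) {y} y x"
            using elementary.tight_at_degree_two[OF C.swap] by blast
          from elementary.tight_at_swap(1)[OF C.swap this] show ?thesis by auto
        next
          case False
          have u: "card (E `` (X \<union> T)) = Suc (card (X \<union> T))" "E `` (X \<inter> T) = E `` X \<inter> E `` T"
            using uncross[OF basics(1,4) T(1,3) ne False] by blast+
          have "z = x" if "z \<in> X \<union> T" "(z, y) \<in> E" for z
          proof (rule ccontr)
            \<comment> \<open>By uncrossing, y would have a neighbour in X \<inter> T, but its only
              neighbour in T is x, which lies outside X.\<close>
            assume zx: "z \<noteq> x"
            then have "z \<in> X" using that T(4) by blast
            then have "y \<in> E `` X \<inter> E `` T" using that 1 T(2) by blast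
            then obtain z' where "z' \<in> X" "z' \<in> T" "(z', y) \<in> E" using u(2) by blast
            then show False using T(4) 1(1) by blast
          qed
          then have "tight_at A E (X \<union> T) x y"
            unfolding tight_at_def using u(1) T(1,2) basics(1) False 1(3) by blast
          then show ?thesis using contraction_tight_absorb[OF w _ _ 1(1,2)] by blast
        qed
      qed
    next
      case 3
      then obtain v where v: "v \<in> Y" "(x, v) \<in> E" and xX: "x \<notin> X" using F_iff by blast
      obtain T where tT: "tight_at A E T x v" using tight v by blast
      then have T: "T \<subset> A" "x \<in> T" "card (E `` T) = Suc (card T)" "\<forall>z\<in>T. (z, v) \<in> E \<longrightarrow> z = x"
        unfolding tight_at_def by blast+
      show ?thesis
      proof (cases "X \<inter> T = {}")
        case True
        \<comment> \<open>Since T sees only one vertex of Y, the edges from T redirected to w all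
          came from v.\<close>
        have "z = x" if z: "z \<in> T" "(z, y) \<in> contraction w" for z
        proof -
          have "z \<noteq> a" using that True basics(2) by blast
          then have "z \<in> F" using z(2) 3(2) w by (auto simp: iff)
          then obtain v' where v': "v' \<in> Y" "(z, v') \<in> E" using F_iff by blast
          have "finite (E `` T \<inter> Y)" by simp
          moreover have "v \<in> E `` T \<inter> Y" "v' \<in> E `` T \<inter> Y" using v v' z T(2) by blast+
          ultimately have "v = v'" using disjoint_tight[OF T(1,3) True]
            by (metis One_nat_def card_le_Suc0_iff_eq)
          then show ?thesis using T(4) v' z by blast
        qed
        then show ?thesis using contraction_tight_disjoint[OF w T(1,3,2) True xy] by blast
      next
        case False
        then have "card (E `` {x}) = 2" using entering[OF v(2) xX v(1) tT] by blast
        then have "card (contraction w `` {x}) = 2" using contraction_degreeA[OF w xX] by simp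
        then show ?thesis using C.tight_at_degree_two[OF xy] by blast
      qed
    qed
  qed
qed


section \<open>Counting at the vertices of degree at least three in the contracted part\<close>

definition hubsA where "hubsA = {x \<in> X. 3 \<le> card (E `` {x})}"
definition hubsB where "hubsB = {y \<in> Y. 3 \<le> card (E\<inverse> `` {y})}"

lemma hubs_sub: "hubsA \<subseteq> X" "hubsB \<subseteq> Y" "finite hubsA" "finite hubsB"
  unfolding hubsA_def hubsB_def using finX NX(4) by auto

lemma not_hubA: "x \<in> X \<Longrightarrow> x \<notin> hubsA \<Longrightarrow> card (E `` {x}) = 2"
  using degA[of x] basics(1) unfolding hubsA_def by fastforce

lemma not_hubB: "y \<in> Y \<Longrightarrow> y \<notin> hubsB \<Longrightarrow> card (E\<inverse> `` {y}) = 2"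
  using degB[of y] NX(3) unfolding hubsB_def by fastforce

lemma aH: "a \<in> hubsA"
  using basics(2) hub unfolding hubsA_def by blast

lemma degX: "x \<in> X \<Longrightarrow> card (E `` {x}) = card (E `` {x} \<inter> Y) + (if x = a then 1 else 0)"
proof -
  assume x: "x \<in> X"
  show ?thesis
  proof (cases "x = a")
    case True
    have "E `` {a} \<subseteq> E `` X" using basics(2) by blast
    then have "E `` {a} = insert b (E `` {a} \<inter> Y)" using NX(1) basics(3) by auto
    then have "card (E `` {a}) = card (insert b (E `` {a} \<inter> Y))" by (rule arg_cong)
    then show ?thesis using True NX(2) by simp
  next
    case False
    then have "b \<notin> E `` {x}" using x unique_b by blast
    moreover have "E `` {x} \<subseteq> E `` X" using x by blast
    ultimately have "E `` {x} \<inter> Y = E `` {x}" using NX(1) by auto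
    then show ?thesis using False by simp
  qed
qed

lemma degY: "card (E\<inverse> `` {y}) = card (E\<inverse> `` {y} \<inter> X) + card (E\<inverse> `` {y} - X)"
proof -
  have "E\<inverse> `` {y} = (E\<inverse> `` {y} \<inter> X) \<union> (E\<inverse> `` {y} - X)" by blast
  then show ?thesis using card_Un_disjoint[of "E\<inverse> `` {y} \<inter> X" "E\<inverse> `` {y} - X"] by fastforce
qed

text \<open>By \<open>unique_entry\<close>, each tail in F belongs to exactly one vertex of
  Y.\<close>

lemma sum_F: "(\<Sum>y\<in>Y. card (E\<inverse> `` {y} - X)) = card F"
proof -
  have "F = (\<Union>y\<in>Y. E\<inverse> `` {y} - X)" unfolding F_def by blast
  then show ?thesis
    using card_UN_disjoint[OF NX(4), of "\<lambda>y. E\<inverse> `` {y} - X"] unique_entry by fastforce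
qed

text \<open>Otherwise N(A - X) would lie in B - Y, a set of the same size.\<close>

lemma F_ne: "F \<noteq> {}"
proof -
  have "A - X \<subset> A" "A - X \<noteq> {}" using basics(1,2) by blast+
  then have "card (A - X) < card (E `` (A - X))" using hall by blast
  moreover have "card (A - X) = card (B - Y)" using card_parts by linarith
  moreover have "E `` (A - X) \<subseteq> B - Y \<Longrightarrow> card (E `` (A - X)) \<le> card (B - Y)"
    using finB by (simp add: card_mono)
  ultimately have "\<not> E `` (A - X) \<subseteq> B - Y" by linarith
  then show ?thesis using image_sub unfolding F_def by blast
qed

text \<open>Double counting of the edges between X and Y: if Y had only degrees two, they would
  number 2|X| - |F|. From the side of X there are at least 2|X|, because the degree of
  \<open>a\<close> exceeds two and makes up for the edge (a, b) leaving the part.\<close>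

lemma hubsB_ne: "hubsB \<noteq> {}"
proof
  assume n: "hubsB = {}"
  have dc: "(\<Sum>x\<in>X. card (E `` {x} \<inter> Y)) = (\<Sum>y\<in>Y. card (E\<inverse> `` {y} \<inter> X))"
  proof -
    have "(\<Sum>x\<in>X. card {y \<in> Y. (x, y) \<in> E}) = (\<Sum>y\<in>Y. card (E\<inverse> `` {y} \<inter> X))"
      by (rule sum_multicount_gen[OF finX NX(4)]) (auto intro!: arg_cong[where f = card])
    moreover have "\<And>x. {y \<in> Y. (x, y) \<in> E} = E `` {x} \<inter> Y" by blast
    ultimately show ?thesis by simp
  qed
  have "(\<Sum>y\<in>Y. card (E\<inverse> `` {y})) = (\<Sum>y\<in>Y. 2)" using not_hubB n by (intro sum.cong) auto
  then have 1: "(\<Sum>y\<in>Y. card (E\<inverse> `` {y} \<inter> X)) + card F = 2 * card X"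
    using cardY by (simp add: degY sum.distrib sum_F)
  have "(\<Sum>x\<in>X - {a}. 2) \<le> (\<Sum>x\<in>X - {a}. card (E `` {x}))"
    using degA basics(1) by (intro sum_mono) auto
  moreover have "(\<Sum>x\<in>X. card (E `` {x})) = card (E `` {a}) + (\<Sum>x\<in>X - {a}. card (E `` {x}))"
    using finX basics(2) by (simp add: sum.remove)
  ultimately have 2: "2 * card (X - {a}) + 3 \<le> (\<Sum>x\<in>X. card (E `` {x}))" using hub by simp
  have "(\<Sum>x\<in>X. card (E `` {x})) = (\<Sum>x\<in>X. card (E `` {x} \<inter> Y) + (if x = a then 1 else 0))"
    using degX by (intro sum.cong) auto
  also have "\<dots> = (\<Sum>x\<in>X. card (E `` {x} \<inter> Y)) + 1"
    using finX basics(2) by (simp add: sum.distrib)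
  finally have "(\<Sum>x\<in>X. card (E `` {x})) = (\<Sum>y\<in>Y. card (E\<inverse> `` {y} \<inter> X)) + 1" using dc by simp
  moreover have "Suc (card (X - {a})) = card X" using finX basics(2) by (rule card_Suc_Diff1)
  moreover have "card F \<noteq> 0" using F_ne Fsub by simp
  ultimately show False using 1 2 by linarith
qed

text \<open>By \<open>inner\<close>, a neighbour in Y of a vertex of \<open>hubsA\<close> has degree
  two. Two vertices of \<open>hubsA\<close> never share such a neighbour, since by
  \<open>pairB\<close> one of its two neighbours has degree two. So the neighbourhoods are disjoint
  subsets of Y - \<open>hubsB\<close>.\<close>

lemma hubs_into_B: "(\<Sum>x\<in>hubsA. card (E `` {x} \<inter> Y)) \<le> card (Y - hubsB)"
proof -
  have dj: "x = x'" if h: "x \<in> hubsA" "x' \<in> hubsA" "(x, y) \<in> E" "(x', y) \<in> E" "y \<in> Y" for x x' y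
  proof (rule ccontr)
    assume ne: "x \<noteq> x'"
    have d: "card (E\<inverse> `` {y}) = 2" using inner[of x y] h unfolding hubsA_def by fastforce
    have "{x, x'} \<subseteq> E\<inverse> `` {y}" "card {x, x'} = 2" using h ne by auto
    then have "E\<inverse> `` {y} = {x, x'}" using d by (metis card_subset_eq finite_converse_image)
    moreover obtain u where "(u, y) \<in> E" "card (E `` {u}) = 2" using pairB d h NX(3) by blast
    moreover from this have "u \<in> E\<inverse> `` {y}" by blast
    ultimately have "card (E `` {x}) = 2 \<or> card (E `` {x'}) = 2" by auto
    then show False using h unfolding hubsA_def by auto
  qed
  have "(\<Sum>x\<in>hubsA. card (E `` {x} \<inter> Y)) = card (\<Union>x\<in>hubsA. E `` {x} \<inter> Y)"
    using hubs_sub dj by (intro card_UN_disjoint[symmetric]) auto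
  also have "(\<Union>x\<in>hubsA. E `` {x} \<inter> Y) \<subseteq> Y - hubsB"
    using inner unfolding hubsA_def hubsB_def by fastforce
  then have "card (\<Union>x\<in>hubsA. E `` {x} \<inter> Y) \<le> card (Y - hubsB)" using NX(4) by (intro card_mono) auto
  finally show ?thesis .
qed

text \<open>The mirror image of \<open>hubs_into_B\<close>, with \<open>pairA\<close> in place of
  \<open>pairB\<close>.\<close>

lemma hubs_into_A:
  shows "(\<Sum>y\<in>hubsB. card (E\<inverse> `` {y} \<inter> X)) \<le> card (X - hubsA)"
proof -
  have dj: "x = x'" if h: "x \<in> hubsB" "x' \<in> hubsB" "(y, x) \<in> E" "(y, x') \<in> E" "y \<in> X" for x x' y
  proof (rule ccontr)
    assume ne: "x \<noteq> x'"
    have d: "card (E `` {y}) = 2" using inner[of y x] h unfolding hubsB_def by fastforce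
    have "{x, x'} \<subseteq> E `` {y}" "card {x, x'} = 2" using h ne by auto
    then have "E `` {y} = {x, x'}" using d by (metis card_subset_eq finite_image)
    moreover obtain u where "(y, u) \<in> E" "card (E\<inverse> `` {u}) = 2" using pairA d h basics(1) by blast
    moreover from this have "u \<in> E `` {y}" by blast
    ultimately have "card (E\<inverse> `` {x}) = 2 \<or> card (E\<inverse> `` {x'}) = 2" by auto
    then show False using h unfolding hubsB_def by auto
  qed
  have "(\<Sum>y\<in>hubsB. card (E\<inverse> `` {y} \<inter> X)) = card (\<Union>y\<in>hubsB. E\<inverse> `` {y} \<inter> X)"
    using hubs_sub dj by (intro card_UN_disjoint[symmetric]) auto
  also have "(\<Union>y\<in>hubsB. E\<inverse> `` {y} \<inter> X) \<subseteq> X - hubsA"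
    using inner unfolding hubsA_def hubsB_def by fastforce
  then have "card (\<Union>y\<in>hubsB. E\<inverse> `` {y} \<inter> X) \<le> card (X - hubsA)" using finX by (intro card_mono) auto
  finally show ?thesis .
qed

text \<open>The final -1 is the edge (a, b), the only one at X that does not end in Y.\<close>

lemma weight_X: "(\<Sum>x\<in>X. vertex_weight (card (E `` {x})))
   = int (card (X - hubsA)) + 2 * int (card hubsA) - int (\<Sum>x\<in>hubsA. card (E `` {x} \<inter> Y)) - 1"
proof -
  have "(\<Sum>x\<in>X. vertex_weight (card (E `` {x})))
     = (\<Sum>x\<in>X - hubsA. vertex_weight (card (E `` {x}))) + (\<Sum>x\<in>hubsA. vertex_weight (card (E `` {x})))"
    using finX hubs_sub by (intro sum.subset_diff) auto
  also have "(\<Sum>x\<in>X - hubsA. vertex_weight (card (E `` {x}))) = (\<Sum>x\<in>X - hubsA. 1)"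
    using not_hubA by (intro sum.cong) (auto simp: vertex_weight_def)
  also have "(\<Sum>x\<in>hubsA. vertex_weight (card (E `` {x})))
     = (\<Sum>x\<in>hubsA. 2 - int (card (E `` {x} \<inter> Y)) - (if x = a then 1 else 0))"
  proof (rule sum.cong[OF refl])
    fix x assume x: "x \<in> hubsA"
    then have "3 \<le> card (E `` {x})" "x \<in> X" unfolding hubsA_def by auto
    then show "vertex_weight (card (E `` {x})) = 2 - int (card (E `` {x} \<inter> Y)) - (if x = a then 1 else 0)"
      using degX[of x] by (simp add: vertex_weight_def)
  qed
  also have "\<dots> = 2 * int (card hubsA) - int (\<Sum>x\<in>hubsA. card (E `` {x} \<inter> Y)) - 1"
    using aH hubs_sub(3) by (simp add: sum_subtractf)
  finally show ?thesis by simp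
qed

lemma weight_Y: "(\<Sum>y\<in>Y. vertex_weight (card (E\<inverse> `` {y})))
   = int (card (Y - hubsB)) + 2 * int (card hubsB) - int (\<Sum>y\<in>hubsB. card (E\<inverse> `` {y} \<inter> X))
     - int (\<Sum>y\<in>hubsB. card (E\<inverse> `` {y} - X))"
proof -
  have "(\<Sum>y\<in>Y. vertex_weight (card (E\<inverse> `` {y})))
     = (\<Sum>y\<in>Y - hubsB. vertex_weight (card (E\<inverse> `` {y}))) + (\<Sum>y\<in>hubsB. vertex_weight (card (E\<inverse> `` {y})))"
    using NX(4) hubs_sub by (intro sum.subset_diff) auto
  also have "(\<Sum>y\<in>Y - hubsB. vertex_weight (card (E\<inverse> `` {y}))) = (\<Sum>y\<in>Y - hubsB. 1)"
    using not_hubB by (intro sum.cong) (auto simp: vertex_weight_def)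
  also have "(\<Sum>y\<in>hubsB. vertex_weight (card (E\<inverse> `` {y})))
     = (\<Sum>y\<in>hubsB. 2 - int (card (E\<inverse> `` {y} \<inter> X)) - int (card (E\<inverse> `` {y} - X)))"
  proof (rule sum.cong[OF refl])
    fix y assume y: "y \<in> hubsB"
    then have "3 \<le> card (E\<inverse> `` {y})" unfolding hubsB_def by auto
    then show "vertex_weight (card (E\<inverse> `` {y})) = 2 - int (card (E\<inverse> `` {y} \<inter> X)) - int (card (E\<inverse> `` {y} - X))"
      using degY[of y] by (simp add: vertex_weight_def)
  qed
  also have "\<dots> = 2 * int (card hubsB) - int (\<Sum>y\<in>hubsB. card (E\<inverse> `` {y} \<inter> X))
     - int (\<Sum>y\<in>hubsB. card (E\<inverse> `` {y} - X))"
    by (simp add: sum_subtractf)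
  finally show ?thesis by simp
qed

text \<open>The added 1 is the weight of \<open>a\<close>, whose neighbours are now b and w; the
  degree of w is |F| + 1, from F and \<open>a\<close>.\<close>

lemma weight_contraction:
  assumes w: "w \<in> Y"
  shows "weight (insert a (A - X)) (insert w (B - Y)) (contraction w)
    = weight A B E - (\<Sum>x\<in>X. vertex_weight (card (E `` {x}))) - (\<Sum>y\<in>Y. vertex_weight (card (E\<inverse> `` {y})))
      + 1 + vertex_weight (Suc (card F))"
proof -
  have "contraction w `` {a} = {b, w}" using contraction_image(2)[OF w, of "{}"] by simp
  moreover have "b \<noteq> w" using w NX(2) by blast
  ultimately have a: "vertex_weight (card (contraction w `` {a})) = 1" by (simp add: vertex_weight_def)
  have "a \<notin> F" using basics(2) F_iff by blast
  then have ww: "card ((contraction w)\<inverse> `` {w}) = Suc (card F)"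
    using contraction_degree_w[OF w] Fsub by simp
  have "(\<Sum>x\<in>insert a (A - X). vertex_weight (card (contraction w `` {x})))
     = 1 + (\<Sum>x\<in>A - X. vertex_weight (card (contraction w `` {x})))"
    using a basics(2) finA by simp
  also have "(\<Sum>x\<in>A - X. vertex_weight (card (contraction w `` {x}))) = (\<Sum>x\<in>A - X. vertex_weight (card (E `` {x})))"
    using contraction_degreeA[OF w] by (intro sum.cong) auto
  also have "\<dots> = (\<Sum>x\<in>A. vertex_weight (card (E `` {x}))) - (\<Sum>x\<in>X. vertex_weight (card (E `` {x})))"
    using finA basics(1) by (intro sum_diff) auto
  finally have 1: "(\<Sum>x\<in>insert a (A - X). vertex_weight (card (contraction w `` {x})))
     = 1 + ((\<Sum>x\<in>A. vertex_weight (card (E `` {x}))) - (\<Sum>x\<in>X. vertex_weight (card (E `` {x}))))" .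
  have "(\<Sum>y\<in>insert w (B - Y). vertex_weight (card ((contraction w)\<inverse> `` {y})))
     = vertex_weight (Suc (card F)) + (\<Sum>y\<in>B - Y. vertex_weight (card ((contraction w)\<inverse> `` {y})))"
    using ww w finB by simp
  also have "(\<Sum>y\<in>B - Y. vertex_weight (card ((contraction w)\<inverse> `` {y}))) = (\<Sum>y\<in>B - Y. vertex_weight (card (E\<inverse> `` {y})))"
    using contraction_degreeB[OF w] by (intro sum.cong) auto
  also have "\<dots> = (\<Sum>y\<in>B. vertex_weight (card (E\<inverse> `` {y}))) - (\<Sum>y\<in>Y. vertex_weight (card (E\<inverse> `` {y})))"
    using finB NX(3) by (intro sum_diff) auto
  finally show ?thesis using 1 unfolding weight_def by simp
qed

text \<open>By the two counting lemmas the vertices of degree two pay for the edges inside the part,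
  so X and Y together weigh at least 2|\<open>hubsA\<close>| + 2|\<open>hubsB\<close>| - 1 - |F| >=
  3 - |F|. The edge replacing them weighs 2 if |F| = 1 and 2 - |F| otherwise. Hence the weight never
  grows, and equality makes every estimate sharp, with |F| = 1.\<close>

lemma weight_bound:
  assumes w: "w \<in> Y"
  shows "weight (insert a (A - X)) (insert w (B - Y)) (contraction w) \<le> weight A B E"
    and "weight (insert a (A - X)) (insert w (B - Y)) (contraction w) = weight A B E \<Longrightarrow>
      card hubsA = 1 \<and> card hubsB = 1 \<and> card F = 1 \<and>
      card (Y - hubsB) = (\<Sum>x\<in>hubsA. card (E `` {x} \<inter> Y)) \<and>
      card (X - hubsA) = (\<Sum>y\<in>hubsB. card (E\<inverse> `` {y} \<inter> X)) \<and>
      (\<Sum>y\<in>hubsB. card (E\<inverse> `` {y} - X)) = 1"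
proof -
  have "(\<Sum>y\<in>hubsB. card (E\<inverse> `` {y} - X)) \<le> (\<Sum>y\<in>Y. card (E\<inverse> `` {y} - X))"
    using hubs_sub NX(4) by (intro sum_mono2) auto
  then have f: "(\<Sum>y\<in>hubsB. card (E\<inverse> `` {y} - X)) \<le> card F" using sum_F by simp
  have "card hubsA \<noteq> 0" "card hubsB \<noteq> 0" "card F \<noteq> 0"
    using aH hubsB_ne F_ne hubs_sub Fsub by auto
  then have p: "1 \<le> card hubsA" "1 \<le> card hubsB" "1 \<le> card F" by simp_all
  have le: "int (\<Sum>y\<in>hubsB. card (E\<inverse> `` {y} \<inter> X)) \<le> int (card (X - hubsA))"
    "int (\<Sum>x\<in>hubsA. card (E `` {x} \<inter> Y)) \<le> int (card (Y - hubsB))"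
    "int (\<Sum>y\<in>hubsB. card (E\<inverse> `` {y} - X)) \<le> int (card F)"
    using hubs_into_A hubs_into_B f by (simp_all only: of_nat_le_iff)
  have le1: "1 \<le> int (card hubsA)" "1 \<le> int (card hubsB)" "1 \<le> int (card F)" using p by linarith+
  have v: "vertex_weight (Suc (card F)) = (if card F = 1 then 1 else 1 - int (card F))"
    by (simp add: vertex_weight_def)
  note m = weight_contraction[OF w] weight_X weight_Y
  show "weight (insert a (A - X)) (insert w (B - Y)) (contraction w) \<le> weight A B E"
  proof (cases "card F = 1")
    case True
    then have "vertex_weight (Suc (card F)) = 1" "int (card F) = 1" using v by simp_all
    then show ?thesis using m le le1 by linarith
  next
    case False
    then have "vertex_weight (Suc (card F)) = 1 - int (card F)" using v by simp
    moreover have "2 \<le> int (card F)" using False le1 by linarith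
    ultimately show ?thesis using m le le1 by linarith
  qed
  assume eq: "weight (insert a (A - X)) (insert w (B - Y)) (contraction w) = weight A B E"
  have F1: "card F = 1"
  proof (rule ccontr)
    assume "card F \<noteq> 1"
    then have "vertex_weight (Suc (card F)) = 1 - int (card F)" using v by simp
    then show False using eq m le le1 by linarith
  qed
  then have "vertex_weight (Suc (card F)) = 1" "int (card F) = 1" using v by simp_all
  then have "int (card hubsA) = 1 \<and> int (card hubsB) = 1 \<and>
      int (card (Y - hubsB)) = int (\<Sum>x\<in>hubsA. card (E `` {x} \<inter> Y)) \<and>
      int (card (X - hubsA)) = int (\<Sum>y\<in>hubsB. card (E\<inverse> `` {y} \<inter> X)) \<and>
      int (\<Sum>y\<in>hubsB. card (E\<inverse> `` {y} - X)) = 1"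
    using eq m le le1 by linarith
  then show "card hubsA = 1 \<and> card hubsB = 1 \<and> card F = 1 \<and>
      card (Y - hubsB) = (\<Sum>x\<in>hubsA. card (E `` {x} \<inter> Y)) \<and>
      card (X - hubsA) = (\<Sum>y\<in>hubsB. card (E\<inverse> `` {y} \<inter> X)) \<and>
      (\<Sum>y\<in>hubsB. card (E\<inverse> `` {y} - X)) = 1"
    using F1 by (simp only: of_nat_eq_iff of_nat_eq_1_iff)
qed

text \<open>In the equality case \<open>a\<close> and w are the only vertices of degree at least
  three in the part. They are centres of stars with leaves Y - {w} and X - {a}, and \<mu> matches
  the leaves. The displayed equation for E undoes the contraction: the edge (a, w) is replaced by
  these stars and the matching.\<close>

lemma reduction:
  obtains w where "w \<in> Y"
    "weight (insert a (A - X)) (insert w (B - Y)) (contraction w) \<le> weight A B E"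
    "weight (insert a (A - X)) (insert w (B - Y)) (contraction w) = weight A B E \<longrightarrow>
      (\<exists>\<mu>. bij_betw \<mu> (X - {a}) (Y - {w}) \<and> card F = 1 \<and>
        E = (contraction w - {(a, w)}) \<union> {a} \<times> (Y - {w}) \<union> (X - {a}) \<times> {w} \<union> (\<lambda>x. (x, \<mu> x)) ` (X - {a}))"
proof -
  obtain w where wH: "w \<in> hubsB" using hubsB_ne by blast
  then have w: "w \<in> Y" using hubs_sub by blast
  have "\<exists>\<mu>. bij_betw \<mu> (X - {a}) (Y - {w}) \<and> card F = 1 \<and>
        E = (contraction w - {(a, w)}) \<union> {a} \<times> (Y - {w}) \<union> (X - {a}) \<times> {w} \<union> (\<lambda>x. (x, \<mu> x)) ` (X - {a})"
    if eq: "weight (insert a (A - X)) (insert w (B - Y)) (contraction w) = weight A B E"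
  proof -
    note e = weight_bound(2)[OF w eq]
    have hA: "hubsA = {a}" using e aH by (metis card_1_singletonE singletonD)
    have hB: "hubsB = {w}" using e wH by (metis card_1_singletonE singletonD)
    have "3 \<le> card (E\<inverse> `` {w})" using wH unfolding hubsB_def by blast
    then have aw: "(a, w) \<notin> E" using inner[of a w] hub basics(2) w by auto
    have "card (Y - {w}) = card (E `` {a} \<inter> Y)" "E `` {a} \<inter> Y \<subseteq> Y - {w}"
      using e hA hB aw by auto
    then have na: "E `` {a} \<inter> Y = Y - {w}" using NX(4) by (simp add: card_subset_eq)
    have "card (X - {a}) = card (E\<inverse> `` {w} \<inter> X)" "E\<inverse> `` {w} \<inter> X \<subseteq> X - {a}"
      using e hA hB aw by auto
    then have nw: "E\<inverse> `` {w} \<inter> X = X - {a}" using finX by (simp add: card_subset_eq)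
    \<comment> \<open>The single edge entering Y ends at w, so redirecting it to w changes
      nothing.\<close>
    have "card (E\<inverse> `` {w} - X) = 1" using e hB by simp
    moreover have "E\<inverse> `` {w} - X \<subseteq> F" using w unfolding F_def by blast
    ultimately have nF: "E\<inverse> `` {w} - X = F" using e Fsub by (simp add: card_subset_eq)
    have dX: "\<exists>y. y \<in> Y - {w} \<and> E `` {x} = {w, y}" if x: "x \<in> X - {a}" for x
    proof -
      have "card (E `` {x}) = 2" using not_hubA hA x by blast
      moreover have "w \<in> E `` {x}" using nw x by blast
      ultimately obtain y where y: "E `` {x} = {w, y}" "y \<noteq> w"
        by (metis card_2_iff doubleton_eq_iff insertE singletonD)
      then have "y \<noteq> b" using unique_b x by blast
      then have "y \<in> Y" using y x NX(1) by blast
      then show ?thesis using y by blast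
    qed
    define \<mu> where "\<mu> x = (SOME y. y \<in> Y - {w} \<and> E `` {x} = {w, y})" for x
    have mu: "\<mu> x \<in> Y - {w}" "E `` {x} = {w, \<mu> x}" if "x \<in> X - {a}" for x
      using someI_ex[OF dX[OF that]] unfolding \<mu>_def by auto
    \<comment> \<open>A vertex of Y - {w} has degree two and is already adjacent to
      \<open>a\<close>, so it is the image of at most one x.\<close>
    have "inj_on \<mu> (X - {a})"
    proof (rule inj_onI)
      fix x x' assume xx: "x \<in> X - {a}" "x' \<in> X - {a}" "\<mu> x = \<mu> x'"
      show "x = x'"
      proof (rule ccontr)
        assume "x \<noteq> x'"
        then have "card {a, x, x'} = 3" using xx by auto
        moreover have "{a, x, x'} \<subseteq> E\<inverse> `` {\<mu> x}" using mu xx na by blast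
        ultimately have "3 \<le> card (E\<inverse> `` {\<mu> x})" by (metis card_mono finite_converse_image)
        then show False using not_hubB[of "\<mu> x"] mu(1)[OF xx(1)] hB by auto
      qed
    qed
    moreover have "card (X - {a}) = card (Y - {w})" using cardY basics(2) w by simp
    moreover have "\<mu> ` (X - {a}) \<subseteq> Y - {w}" using mu by blast
    ultimately have bij: "bij_betw \<mu> (X - {a}) (Y - {w})"
      unfolding bij_betw_def using NX(4) by (metis card_image card_subset_eq finite_Diff)
    have "E = (contraction w - {(a, w)}) \<union> {a} \<times> (Y - {w}) \<union> (X - {a}) \<times> {w} \<union> (\<lambda>x. (x, \<mu> x)) ` (X - {a})"
      (is "E = ?R")
    proof (rule set_eqI, clarify)
      fix x y
      show "(x, y) \<in> E \<longleftrightarrow> (x, y) \<in> ?R"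
      proof
        assume xy: "(x, y) \<in> E"
        consider "x = a" | "x \<in> X - {a}" | "x \<notin> X" "y \<notin> Y" | "x \<notin> X" "y \<in> Y" by blast
        then show "(x, y) \<in> ?R"
        proof cases
          case 1
          then have "y = b \<or> y \<in> Y - {w}" using xy NX(1) basics(2) na by blast
          then show ?thesis using 1 xy aw by (auto simp: contraction_iff[OF w])
        next
          case 2
          then have "y = w \<or> y = \<mu> x" using mu(2)[OF 2] xy by blast
          then show ?thesis using 2 by blast
        next
          case 3
          then show ?thesis using xy basics(2) by (auto simp: contraction_iff[OF w])
        next
          case 4
          then have "x \<in> F" using xy F_iff by blast
          then have "(x, w) \<in> E" using nF by blast
          then have "y = w" using unique_entry[OF 4(1,2) w xy] by simp
          then show ?thesis using 4 \<open>x \<in> F\<close> basics(2) by (auto simp: contraction_iff[OF w])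
        qed
      next
        assume "(x, y) \<in> ?R"
        then consider "(x, y) \<in> contraction w" "(x, y) \<noteq> (a, w)" | "x = a" "y \<in> Y - {w}"
          | "x \<in> X - {a}" "y = w" | "x \<in> X - {a}" "y = \<mu> x" by blast
        then show "(x, y) \<in> E"
        proof cases
          case 1
          then consider "(x, y) \<in> E" | "x = a" "y = b" | "x \<in> F" "y = w"
            by (auto simp: contraction_iff[OF w])
          then show ?thesis using basics(3) nF by cases blast+
        next
          case 2
          then show ?thesis using na by blast
        next
          case 3
          then show ?thesis using nw by blast
        next
          case 4
          then show ?thesis using mu(2)[of x] by blast
        qed
      qed
    qed
    then show ?thesis using bij e by blast
  qed
  then show ?thesis using that[OF w weight_bound(1)[OF w]] by blast
qed

end

section \<open>Growing trees and doubling them\<close>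

text \<open>Trees as repeated addition of a leaf, which gives the induction used for all tree facts.
  The incidence map is a parameter so that the same lemmas serve two-element sets as edges and the
  named edges of a multigraph.\<close>

inductive grown :: "('e \<Rightarrow> 'v set) \<Rightarrow> 'v set \<Rightarrow> 'e set \<Rightarrow> bool" for inc where
  single: "grown inc {v} {}"
| leaf: "grown inc W D \<Longrightarrow> x \<in> W \<Longrightarrow> y \<notin> W \<Longrightarrow> inc e = {x, y} \<Longrightarrow> grown inc (insert y W) (insert e D)"

lemma grown_finite: "grown inc W D \<Longrightarrow> finite W \<and> finite D"
  by (induction rule: grown.induct) auto

lemma grown_incidence: "grown inc W D \<Longrightarrow> e \<in> D \<Longrightarrow> inc e \<subseteq> W \<and> card (inc e) = 2"
proof (induction rule: grown.induct)
  case (leaf W D x y e')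
  then have "x \<noteq> y" by blast
  then show ?case using leaf by auto
qed simp

text \<open>Connectedness of the tree, stated for vertex sets closed under edges so that no walks
  are needed.\<close>

lemma grown_closed:
  "grown inc W D \<Longrightarrow> Z \<inter> W \<noteq> {} \<Longrightarrow> (\<And>e. e \<in> D \<Longrightarrow> inc e \<inter> Z \<noteq> {} \<Longrightarrow> inc e \<subseteq> Z) \<Longrightarrow> W \<subseteq> Z"
proof (induction rule: grown.induct)
  case (leaf W D x y e)
  have "Z \<inter> W \<noteq> {}" using leaf.prems(1) leaf.prems(2)[of e] leaf.hyps by auto
  then have "W \<subseteq> Z" using leaf.IH leaf.prems(2) by blast
  then show ?case using leaf.prems(2)[of e] leaf.hyps by auto
qed auto

lemma grown_card: "grown inc W D \<Longrightarrow> card W = Suc (card D)"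
proof (induction rule: grown.induct)
  case (leaf W D x y e)
  have "e \<notin> D" using grown_incidence[OF leaf.hyps(1), of e] leaf.hyps by auto
  then show ?case using leaf grown_finite[OF leaf.hyps(1)] by simp
qed simp

definition tree_degree :: "'v set set \<Rightarrow> 'v \<Rightarrow> nat" where
  "tree_degree D v = card {e \<in> D. v \<in> e}"

text \<open>Edges are two-element sets here, and \<open>f\<close> maps the tree \<open>(W, D)\<close> to its disjoint copy.\<close>

definition doubling :: "'v set \<Rightarrow> 'v set set \<Rightarrow> ('v \<Rightarrow> 'v) \<Rightarrow> 'v set \<Rightarrow> 'v set set \<Rightarrow> bool" where
  "doubling W D f V U \<longleftrightarrow> grown (\<lambda>e. e) W D \<and> 2 \<le> card W \<and> (\<forall>v\<in>W. tree_degree D v \<noteq> 2) \<and>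
     inj_on f W \<and> W \<inter> f ` W = {} \<and> V = W \<union> f ` W \<and>
     U = D \<union> (`) f ` D \<union> (\<lambda>l. {l, f l}) ` {l \<in> W. tree_degree D l = 1}"

lemma grown_star:
  assumes "grown (\<lambda>e. e) W D" "l \<in> W" "finite L" "L \<inter> W = {}"
  shows "grown (\<lambda>e. e) (W \<union> L) (D \<union> (\<lambda>x. {l, x}) ` L)"
  using assms(3,4)
proof (induction L rule: finite_induct)
  case (insert x L)
  have "grown (\<lambda>e. e) (insert x (W \<union> L)) (insert {l, x} (D \<union> (\<lambda>x. {l, x}) ` L))"
    by (rule grown.leaf[where x = l]) (use insert assms in auto)
  then show ?case by simp
qed (simp add: assms)

text \<open>The inverse of the contraction in the equality case: the leaf l receives the children L,
  its copy the children L', and the matching edge at l is replaced by matching edges at the new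
  leaves. At least two children are required, as otherwise l would get degree two.\<close>

lemma doubling_extend:
  assumes d: "doubling W D f V U" and l: "l \<in> W" "tree_degree D l = 1"
    and L: "finite L" "2 \<le> card L" "L \<inter> V = {}" and h: "bij_betw h L L'" and L': "L' \<inter> V = {}" "L \<inter> L' = {}"
  shows "\<exists>W' D' f'. doubling W' D' f' (V \<union> L \<union> L')
    (U - {{l, f l}} \<union> (\<lambda>x. {l, x}) ` L \<union> (\<lambda>x. {f l, h x}) ` L \<union> (\<lambda>x. {x, h x}) ` L)"
proof -
  from d have g: "grown (\<lambda>e. e) W D" and cW: "2 \<le> card W" and n2: "\<forall>v\<in>W. tree_degree D v \<noteq> 2"
    and inj: "inj_on f W" and dj: "W \<inter> f ` W = {}" and V: "V = W \<union> f ` W"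
    and U: "U = D \<union> (`) f ` D \<union> (\<lambda>l. {l, f l}) ` {l \<in> W. tree_degree D l = 1}"
    unfolding doubling_def by blast+
  let ?W = "W \<union> L"
  define S where "S = (\<lambda>x. {l, x}) ` L"
  let ?D = "D \<union> S"
  let ?f = "\<lambda>x. if x \<in> L then h x else f x"
  have LW: "L \<inter> W = {}" using L V by blast
  have DW: "e \<subseteq> W" if "e \<in> D" for e using grown_incidence[OF g that] by simp
  have finD: "finite D" "finite W" using grown_finite[OF g] by blast+
  have g': "grown (\<lambda>e. e) ?W ?D" unfolding S_def by (rule grown_star[OF g l(1) L(1) LW])
  have tL: "tree_degree ?D x = 1" if x: "x \<in> L" for x
  proof -
    have "{e \<in> ?D. x \<in> e} = {{l, x}}" using x LW DW l unfolding S_def by blast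
    then show ?thesis by (simp add: tree_degree_def)
  qed
  have tl: "tree_degree ?D l \<ge> 3"
  proof -
    have "{e \<in> ?D. l \<in> e} = {e \<in> D. l \<in> e} \<union> S" unfolding S_def by blast
    moreover have "{e \<in> D. l \<in> e} \<inter> S = {}" using DW LW unfolding S_def by blast
    moreover have "inj_on (\<lambda>x. {l, x}) L" using LW l by (auto simp: inj_on_def doubleton_eq_iff)
    then have "card S = card L" unfolding S_def by (rule card_image)
    moreover have "finite S" using L unfolding S_def by simp
    ultimately have "tree_degree ?D l = tree_degree D l + card L"
      using finD unfolding tree_degree_def by (simp add: card_Un_disjoint)
    then show ?thesis using l L by simp
  qed
  have tW: "tree_degree ?D v = tree_degree D v" if "v \<in> W" "v \<noteq> l" for v
  proof -
    have "{e \<in> ?D. v \<in> e} = {e \<in> D. v \<in> e}" using that LW unfolding S_def by blast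
    then show ?thesis by (simp add: tree_degree_def)
  qed
  have leaves: "{v \<in> ?W. tree_degree ?D v = 1} = ({v \<in> W. tree_degree D v = 1} - {l}) \<union> L"
  proof (rule set_eqI)
    fix v
    consider "v \<in> L" | "v = l" | "v \<in> W" "v \<noteq> l" | "v \<notin> ?W" by blast
    then show "v \<in> {v \<in> ?W. tree_degree ?D v = 1} \<longleftrightarrow> v \<in> ({v \<in> W. tree_degree D v = 1} - {l}) \<union> L"
    proof cases
      case 2
      then show ?thesis using tl LW l by auto
    next
      case 3
      then show ?thesis using tW LW by auto
    qed (use tL in auto)
  qed
  have hL: "h ` L = L'" using h by (simp add: bij_betw_def)
  have fW: "?f ` W = f ` W" using LW by (intro image_cong) auto
  have fim: "?f ` ?W = f ` W \<union> L'" using fW hL by (auto simp: image_Un)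
  have "inj_on ?f ?W"
  proof (rule inj_onI)
    fix x y assume xy: "x \<in> ?W" "y \<in> ?W" "?f x = ?f y"
    have a: "h z \<in> L'" if "z \<in> L" for z using that hL by blast
    have b: "f z \<notin> L'" if "z \<in> W" for z using that L' V by blast
    show "x = y"
    proof (cases "x \<in> L"; cases "y \<in> L")
      assume "x \<in> L" "y \<in> L"
      then show ?thesis using xy h by (auto simp: bij_betw_def inj_on_def)
    next
      assume "x \<in> L" "y \<notin> L"
      then show ?thesis using xy a[of x] b[of y] by auto
    next
      assume "x \<notin> L" "y \<in> L"
      then show ?thesis using xy a[of y] b[of x] by auto
    next
      assume "x \<notin> L" "y \<notin> L"
      then show ?thesis using xy inj by (auto simp: inj_on_def)
    qed
  qed
  moreover have "?W \<inter> ?f ` ?W = {}"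
  proof -
    have "W \<inter> L' = {}" "L \<inter> f ` W = {}" using L(3) L'(1) by (simp_all add: V Int_Un_distrib Int_Un_distrib2 Int_commute)
    then show ?thesis unfolding fim using dj L'(2) by (simp add: Int_Un_distrib Int_Un_distrib2)
  qed
  moreover have "V \<union> L \<union> L' = ?W \<union> ?f ` ?W" unfolding fim V by (simp add: Un_ac)
  moreover have "card W \<le> card ?W" using finD L by (intro card_mono) auto
  then have "2 \<le> card ?W" using cW by simp
  moreover have "\<forall>v\<in>?W. tree_degree ?D v \<noteq> 2"
  proof
    fix v assume "v \<in> ?W"
    then consider "v \<in> L" | "v = l" | "v \<in> W" "v \<noteq> l" by blast
    then show "tree_degree ?D v \<noteq> 2" using tL tl tW n2 by cases auto
  qed
  moreover have "U - {{l, f l}} \<union> (\<lambda>x. {l, x}) ` L \<union> (\<lambda>x. {f l, h x}) ` L \<union> (\<lambda>x. {x, h x}) ` L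
     = ?D \<union> (`) ?f ` ?D \<union> (\<lambda>l. {l, ?f l}) ` {v \<in> ?W. tree_degree ?D v = 1}"
  proof -
    have 1: "(`) ?f ` D = (`) f ` D"
    proof (rule image_cong[OF refl])
      fix e assume "e \<in> D"
      then show "?f ` e = f ` e" using DW LW by (intro image_cong) auto
    qed
    have lL: "l \<notin> L" using l LW by blast
    have 2: "(`) ?f ` S = (\<lambda>x. {f l, h x}) ` L"
      unfolding S_def image_image using lL by (intro image_cong) auto
    have 3: "(\<lambda>l. {l, ?f l}) ` {v \<in> ?W. tree_degree ?D v = 1}
       = (\<lambda>l. {l, f l}) ` ({v \<in> W. tree_degree D v = 1} - {l}) \<union> (\<lambda>x. {x, h x}) ` L"
      unfolding leaves image_Un using LW by (intro arg_cong2[of _ _ _ _ "(\<union>)"] image_cong) auto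
    have fl: "f l \<in> f ` W" "f l \<notin> W" using l dj by blast+
    have "{l, f l} \<notin> D" using DW fl by blast
    moreover have "l \<notin> f ` W" using l dj by blast
    then have "{l, f l} \<notin> (`) f ` D" using DW by blast
    moreover have "(\<lambda>l. {l, f l}) ` ({v \<in> W. tree_degree D v = 1} - {l})
       = (\<lambda>l. {l, f l}) ` {v \<in> W. tree_degree D v = 1} - {{l, f l}}"
    proof -
      have "{v, f v} \<noteq> {l, f l}" if "v \<in> W" "v \<noteq> l" for v
        using that fl l dj by (auto simp: doubleton_eq_iff)
      then show ?thesis by blast
    qed
    ultimately have 4: "U - {{l, f l}} = D \<union> (`) f ` D \<union> (\<lambda>l. {l, f l}) ` ({v \<in> W. tree_degree D v = 1} - {l})"
      unfolding U by blast
    show ?thesis unfolding 4 3 image_Un 1 2 unfolding S_def by (simp add: Un_ac)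
  qed
  ultimately have "doubling ?W ?D ?f (V \<union> L \<union> L')
    (U - {{l, f l}} \<union> (\<lambda>x. {l, x}) ` L \<union> (\<lambda>x. {f l, h x}) ` L \<union> (\<lambda>x. {x, h x}) ` L)"
    using g' unfolding doubling_def by blast
  then show ?thesis by blast
qed

text \<open>Both ends of a tree edge of this kind would have tree degree at most two and not two,
  hence be leaves, and the tree would be \<open>K2\<close>. The bound 5 excludes just this case,
  where the doubling is a four-cycle.\<close>

lemma doubling_leaf_edge:
  assumes d: "doubling W D f V U" and V: "5 \<le> card V" and pq: "{p, q} \<in> U"
    and deg: "card {e \<in> U. p \<in> e} = 2" "card {e \<in> U. q \<in> e} = 2"
  shows "\<exists>l\<in>W. tree_degree D l = 1 \<and> {p, q} = {l, f l}"
proof -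
  from d have g: "grown (\<lambda>e. e) W D" and n2: "\<forall>v\<in>W. tree_degree D v \<noteq> 2"
    and inj: "inj_on f W" and Veq: "V = W \<union> f ` W"
    and U: "U = D \<union> (`) f ` D \<union> (\<lambda>l. {l, f l}) ` {l \<in> W. tree_degree D l = 1}"
    unfolding doubling_def by blast+
  have finD: "finite D" "finite W" using grown_finite[OF g] by blast+
  have finU: "finite U" using finD unfolding U by simp
  have DW: "e \<subseteq> W" if "e \<in> D" for e using grown_incidence[OF g that] by simp
  have injD: "inj_on ((`) f) D" using inj DW by (meson inj_on_image_eq_iff inj_onI)
  have no: False if xy: "{x, y} \<in> D" and dx: "tree_degree D x \<le> 2" and dy: "tree_degree D y \<le> 2" for x y
  proof -
    have in_W: "x \<in> W" "y \<in> W" using DW[OF xy] by blast+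
    have one: "{e \<in> D. z \<in> e} = {{x, y}}" if z: "z \<in> {x, y}" for z
    proof -
      have m: "{x, y} \<in> {e \<in> D. z \<in> e}" using xy z by blast
      have "tree_degree D z \<le> 2" "tree_degree D z \<noteq> 2" using z dx dy n2 in_W by auto
      moreover have "tree_degree D z \<noteq> 0" using m finD unfolding tree_degree_def by auto
      ultimately have "card {e \<in> D. z \<in> e} = 1" unfolding tree_degree_def by linarith
      then show ?thesis using m by (metis card_1_singletonE singletonD)
    qed
    have "W \<subseteq> {x, y}"
    proof (rule grown_closed[OF g])
      show "{x, y} \<inter> W \<noteq> {}" using in_W by blast
      fix e assume e: "e \<in> D" "e \<inter> {x, y} \<noteq> {}"
      then obtain z where "z \<in> e" "z \<in> {x, y}" by auto
      then have "e = {x, y}" using one e by blast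
      then show "e \<subseteq> {x, y}" by simp
    qed
    then have "card W \<le> card {x, y}" by (intro card_mono) auto
    also have "\<dots> \<le> 2" by (simp add: card_insert_if)
    finally have "card W \<le> 2" .
    moreover have "card V \<le> card W + card W"
      unfolding Veq using card_Un_le[of W "f ` W"] card_image_le[OF finD(2), of f] by linarith
    ultimately show False using V by linarith
  qed
  from pq U consider "{p, q} \<in> D" | "{p, q} \<in> (`) f ` D" | "\<exists>l\<in>W. tree_degree D l = 1 \<and> {p, q} = {l, f l}" by blast
  then show ?thesis
  proof cases
    case 1
    have "tree_degree D z \<le> card {e \<in> U. z \<in> e}" for z
      unfolding tree_degree_def using finU U by (intro card_mono) auto
    then show ?thesis using no[OF 1] deg by (metis order_refl)
  next
    case 2
    then obtain e where e: "e \<in> D" "f ` e = {p, q}" by blast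
    obtain x y where xy: "e = {x, y}" using grown_incidence[OF g e(1)] by (metis card_2_iff)
    have le: "tree_degree D z \<le> card {e \<in> U. f z \<in> e}" for z
    proof -
      have "tree_degree D z = card ((`) f ` {e \<in> D. z \<in> e})"
        unfolding tree_degree_def using injD by (intro card_image[symmetric] inj_on_subset[OF injD]) auto
      also have "\<dots> \<le> card {e \<in> U. f z \<in> e}" using finU U by (intro card_mono) auto
      finally show ?thesis .
    qed
    have "{f x, f y} = {p, q}" using e xy by simp
    then have "tree_degree D x \<le> 2" "tree_degree D y \<le> 2"
      using deg le[of x] le[of y] by (auto simp: doubleton_eq_iff)
    then show ?thesis using no e xy by blast
  next
    case 3
    then show ?thesis .
  qed
qed

text \<open>In a four-cycle any edge can be chosen as a matching edge; this replaces
  \<open>doubling_leaf_edge\<close>, which fails there.\<close>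

lemma doubling_four_cycle:
  assumes "a \<noteq> c" "b \<noteq> w" "{a, c} \<inter> {b, w} = {}"
  shows "\<exists>W D f. doubling W D f {a, c, b, w} {{a, b}, {a, w}, {c, b}, {c, w}} \<and>
    a \<in> W \<and> tree_degree D a = 1 \<and> f a = w"
proof -
  let ?f = "\<lambda>x. if x = a then w else c"
  have ab: "a \<noteq> b" "a \<noteq> w" "c \<noteq> b" "c \<noteq> w" using assms by auto
  have "grown (\<lambda>e. e) (insert b {a}) (insert {a, b} {})"
    using ab by (intro grown.leaf[where x = a] grown.single) auto
  then have "grown (\<lambda>e. e) {a, b} {{a, b}}" by (simp add: insert_commute)
  moreover have "{e \<in> {{a, b}}. a \<in> e} = {{a, b}}" "{e \<in> {{a, b}}. b \<in> e} = {{a, b}}" by auto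
  then have td: "tree_degree {{a, b}} a = 1" "tree_degree {{a, b}} b = 1"
    by (simp_all only: tree_degree_def) simp_all
  moreover have "{l \<in> {a, b}. tree_degree {{a, b}} l = 1} = {a, b}" using td by auto
  moreover have "{{a, b}, {a, w}, {c, b}, {c, w}} = {{a, b}} \<union> (`) ?f ` {{a, b}} \<union> (\<lambda>l. {l, ?f l}) ` {a, b}"
    using ab by auto
  moreover have "{a, c, b, w} = {a, b} \<union> ?f ` {a, b}" using ab by auto
  moreover have "inj_on ?f {a, b}" "{a, b} \<inter> ?f ` {a, b} = {}" "2 \<le> card {a, b}" using ab assms by auto
  moreover have "\<forall>v\<in>{a, b}. tree_degree {{a, b}} v \<noteq> 2" using td by auto
  ultimately have "doubling {a, b} {{a, b}} ?f {a, c, b, w} {{a, b}, {a, w}, {c, b}, {c, w}}"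
    unfolding doubling_def by (simp only: simp_thms)
  moreover have "a \<in> {a, b}" "?f a = w" by simp_all
  ultimately show ?thesis using td(1) by blast
qed

section \<open>From relations to undirected edges, and the smallest case\<close>

definition undirected :: "('a \<times> 'a) set \<Rightarrow> 'a set set" where
  "undirected E = (\<lambda>(x, y). {x, y}) ` E"

lemma undirected_converse: "undirected (E\<inverse>) = undirected E"
  by (force simp: undirected_def insert_commute)

lemma (in elementary) undirected_degree:
  assumes "a \<in> A"
  shows "card {e \<in> undirected E. a \<in> e} = card (E `` {a})"
proof -
  have "{e \<in> undirected E. a \<in> e} = (\<lambda>b. {a, b}) ` (E `` {a})"
    using assms sub disj by (auto simp: undirected_def)
  moreover have "inj_on (\<lambda>b. {a, b}) (E `` {a})" by (auto simp: inj_on_def doubleton_eq_iff)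
  ultimately show ?thesis by (simp add: card_image)
qed

text \<open>Minimum degree two forces the complete bipartite graph, a four-cycle. The doubling is
  given with a prescribed matching edge from \<open>a\<close> to w because the contraction may be
  this graph.\<close>

lemma (in elementary) four_vertices:
  assumes two: "card A = 2" and "a \<in> A" "w \<in> B"
  shows "weight A B E = 4 \<and> (\<exists>W D f. doubling W D f (A \<union> B) (undirected E) \<and>
    a \<in> W \<and> tree_degree D a = 1 \<and> f a = w)"
proof -
  obtain c where c: "A = {a, c}" "a \<noteq> c" using assms by (metis card_2_iff doubleton_eq_iff insertE singletonD)
  have "card B = 2" using two cardAB by simp
  then obtain b where b: "B = {b, w}" "b \<noteq> w" using assms by (metis card_2_iff doubleton_eq_iff insertE singletonD)
  have full': "E `` {x} = B" if "x \<in> A" for x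
    using degA[OF that] image_sub[of "{x}"] finB \<open>card B = 2\<close> by (metis card_seteq)
  then have E: "E = A \<times> B" using sub by blast
  have "(A \<times> B)\<inverse> `` {y} = A" if "y \<in> B" for y using that by blast
  moreover have "(A \<times> B) `` {y} = B" if "y \<in> A" for y using that by blast
  ultimately have "weight A B E = (\<Sum>a\<in>A. 1) + (\<Sum>b\<in>B. 1)"
    unfolding weight_def E using two \<open>card B = 2\<close>
    by (intro arg_cong2[of _ _ _ _ "(+)"] sum.cong) (auto simp: vertex_weight_def)
  then have "weight A B E = 4" using two \<open>card B = 2\<close> by simp
  moreover have "undirected E = {{a, b}, {a, w}, {c, b}, {c, w}}"
    unfolding E undirected_def c(1) b(1) by auto
  moreover have "A \<union> B = {a, c, b, w}" using c b by auto
  ultimately show ?thesis using doubling_four_cycle[of a c b w] c b disj by auto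
qed

section \<open>The bound by induction\<close>

definition doubled :: "'a set \<Rightarrow> 'a set \<Rightarrow> ('a \<times> 'a) set \<Rightarrow> bool" where
  "doubled A B E \<longleftrightarrow> (\<exists>W D f. doubling W D f (A \<union> B) (undirected E))"

lemma doubled_swap: "doubled B A (E\<inverse>) = doubled A B E"
  by (simp add: doubled_def undirected_converse Un_commute)

definition extremal_bound :: "'a set \<Rightarrow> 'a set \<Rightarrow> ('a \<times> 'a) set \<Rightarrow> bool" where
  "extremal_bound A B E \<longleftrightarrow> 4 \<le> weight A B E \<and> (weight A B E = 4 \<longrightarrow> doubled A B E)"

lemma extremal_bound_swap: "extremal_bound B A (E\<inverse>) = extremal_bound A B E"
  by (simp add: extremal_bound_def weight_swap doubled_swap)

text \<open>The bound passes through the contraction directly. In the equality case the contraction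
  has weight 4 as well, so it is a doubled tree by induction, and putting the two stars back at the
  edge (a, w) extends that tree at a leaf.\<close>

lemma (in hub_tight) extremal_bound_step:
  assumes IH: "\<And>A' B' E'. minimal_elementary A' B' (E' :: ('a \<times> 'a) set) \<Longrightarrow> card A' < card A \<Longrightarrow> extremal_bound A' B' E'"
  shows "extremal_bound A B E"
proof -
  obtain w where w: "w \<in> Y"
    and le: "weight (insert a (A - X)) (insert w (B - Y)) (contraction w) \<le> weight A B E"
    and st: "weight (insert a (A - X)) (insert w (B - Y)) (contraction w) = weight A B E \<longrightarrow>
      (\<exists>\<mu>. bij_betw \<mu> (X - {a}) (Y - {w}) \<and> card F = 1 \<and>
        E = (contraction w - {(a, w)}) \<union> {a} \<times> (Y - {w}) \<union> (X - {a}) \<times> {w} \<union> (\<lambda>x. (x, \<mu> x)) ` (X - {a}))"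
    by (rule reduction)
  let ?A = "insert a (A - X)" and ?B = "insert w (B - Y)" and ?C = "contraction w"
  interpret C: minimal_elementary ?A ?B ?C by (rule contraction_minimal[OF w])
  interpret S: elementary ?B ?A "?C\<inverse>" by (rule C.swap)
  have "card ?A = Suc (card (A - X))" using basics(2) finA by simp
  then have "card ?A < card A" using card_parts(1) card_X by linarith
  then have ih: "extremal_bound ?A ?B ?C" using IH C.minimal_elementary_axioms by blast
  show ?thesis
  proof (cases "weight A B E = 4")
    case False
    then show ?thesis using ih le unfolding extremal_bound_def by linarith
  next
    case True
    then have w4: "weight ?A ?B ?C = 4" using ih le unfolding extremal_bound_def by linarith
    with True st obtain \<mu> where mu: "bij_betw \<mu> (X - {a}) (Y - {w})" and F1: "card F = 1"
      and E: "E = (?C - {(a, w)}) \<union> {a} \<times> (Y - {w}) \<union> (X - {a}) \<times> {w} \<union> (\<lambda>x. (x, \<mu> x)) ` (X - {a})"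
      by auto
    have aw: "(a, w) \<in> ?C" by (simp add: contraction_iff[OF w])
    \<comment> \<open>Both ends of (a, w) have degree two in the contraction: \<open>a\<close> sees
      b and w, while w sees \<open>a\<close> and the single element of F. So the edge must be a
      matching edge, or can be chosen as one in a four-cycle.\<close>
    obtain W D f l where d: "doubling W D f (?A \<union> ?B) (undirected ?C)"
      and l: "l \<in> W" "tree_degree D l = 1" "{a, w} = {l, f l}"
    proof (cases "card ?A = 2")
      case True
      then show ?thesis using C.four_vertices[of a w] that by blast
    next
      case False
      obtain W D f where d: "doubling W D f (?A \<union> ?B) (undirected ?C)"
        using ih w4 unfolding extremal_bound_def doubled_def by blast
      have "card (?A \<union> ?B) = card ?A + card ?B" using C.finA C.finB C.disj by (rule card_Un_disjoint)
      then have "5 \<le> card (?A \<union> ?B)" using False C.two C.cardAB by linarith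
      moreover have "{a, w} \<in> undirected ?C" using aw by (force simp: undirected_def)
      moreover have "card {e \<in> undirected ?C. a \<in> e} = 2"
      proof -
        have "?C `` {a} = {b, w}" using contraction_image(2)[OF w, of "{}"] by simp
        moreover have "b \<noteq> w" using w NX(2) by blast
        ultimately show ?thesis using C.undirected_degree[of a] by simp
      qed
      moreover have "card {e \<in> undirected ?C. w \<in> e} = 2"
      proof -
        have "a \<notin> F" using basics(2) F_iff by blast
        then have "card (?C\<inverse> `` {w}) = 2" using contraction_degree_w[OF w] Fsub F1 by simp
        then show ?thesis using S.undirected_degree[of w] by (simp add: undirected_converse)
      qed
      ultimately show ?thesis using doubling_leaf_edge[OF d] that d by blast
    qed
    have AX: "A = (A - X) \<union> X" and BY: "B = (B - Y) \<union> Y" using basics(1) NX(3) by blast+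
    have "(?A \<union> ?B) \<union> (X - {a}) \<union> (Y - {w}) = A \<union> B" using basics(2) w AX BY by blast
    then have V: "(?A \<union> ?B) \<union> (X - {a}) \<union> (Y - {w}) = A \<union> B" "(?A \<union> ?B) \<union> (Y - {w}) \<union> (X - {a}) = A \<union> B"
      by auto
    have dj: "(X - {a}) \<inter> (?A \<union> ?B) = {}" "(Y - {w}) \<inter> (?A \<union> ?B) = {}" "(X - {a}) \<inter> (Y - {w}) = {}"
    proof -
      have "X \<inter> B = {}" "Y \<inter> A = {}" using disj basics(1) NX(3) by blast+
      then show "(X - {a}) \<inter> (?A \<union> ?B) = {}" "(Y - {w}) \<inter> (?A \<union> ?B) = {}" "(X - {a}) \<inter> (Y - {w}) = {}"
        using w basics(2,5) NX(3) by auto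
    qed
    have cX: "2 \<le> card (X - {a})" "2 \<le> card (Y - {w})"
    proof -
      have "(a, w) \<notin> E" using basics(2) by (subst E) auto
      moreover have "E `` {a} \<subseteq> insert b Y" using basics(2) NX(1) by blast
      ultimately have "E `` {a} \<subseteq> insert b (Y - {w})" by blast
      then have "card (E `` {a}) \<le> card (insert b (Y - {w}))" using NX(4) by (intro card_mono) auto
      then show "2 \<le> card (Y - {w})" using hub NX(2,4) by simp
      then show "2 \<le> card (X - {a})" using cardY w basics(2) by simp
    qed
    have und: "undirected E = (undirected ?C - {{a, w}}) \<union> (\<lambda>y. {a, y}) ` (Y - {w}) \<union> (\<lambda>x. {x, w}) ` (X - {a})
       \<union> (\<lambda>x. {x, \<mu> x}) ` (X - {a})"
    proof -
      have inj: "(x, y) = (a, w)" if "(x, y) \<in> ?C" "{x, y} = {a, w}" for x y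
        using that C.sub C.disj by (auto simp: doubleton_eq_iff)
      have "undirected (?C - {(a, w)}) = undirected ?C - {{a, w}}"
        using inj unfolding undirected_def by fastforce
      moreover have "undirected ({a} \<times> (Y - {w})) = (\<lambda>y. {a, y}) ` (Y - {w})"
        "undirected ((X - {a}) \<times> {w}) = (\<lambda>x. {x, w}) ` (X - {a})"
        "undirected ((\<lambda>x. (x, \<mu> x)) ` (X - {a})) = (\<lambda>x. {x, \<mu> x}) ` (X - {a})"
        unfolding undirected_def by force+
      moreover have "undirected (P \<union> Q) = undirected P \<union> undirected Q" for P Q :: "('a \<times> 'a) set"
        unfolding undirected_def by (rule image_Un)
      ultimately show ?thesis by (subst E) simp
    qed
    have "doubled A B E"
    \<comment> \<open>Either \<open>a\<close> or w may lie in the tree, the other one in its copy.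
      If \<open>a\<close> does, its new children are Y - {w}, and \<mu> has to be inverted to lead
      from the tree to the copy.\<close>
    proof (cases "l = a")
      case True
      then have fl: "f l = w" using l(3) by (auto simp: doubleton_eq_iff)
      have inv: "bij_betw (the_inv_into (X - {a}) \<mu>) (Y - {w}) (X - {a})" by (rule bij_betw_the_inv_into[OF mu])
      let ?h = "the_inv_into (X - {a}) \<mu>"
      have hm: "?h (\<mu> x) = x" if "x \<in> X - {a}" for x
        using that mu by (simp add: bij_betw_def the_inv_into_f_f)
      have img: "\<mu> ` (X - {a}) = Y - {w}" using mu by (simp add: bij_betw_def)
      have i1: "(\<lambda>x. {f l, ?h x}) ` (Y - {w}) = (\<lambda>x. {x, w}) ` (X - {a})"
        unfolding img[symmetric] image_image fl using hm by (intro image_cong) auto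
      have i2: "(\<lambda>x. {x, ?h x}) ` (Y - {w}) = (\<lambda>x. {x, \<mu> x}) ` (X - {a})"
        unfolding img[symmetric] image_image using hm by (intro image_cong) auto
      have "\<exists>W' D' f'. doubling W' D' f' (?A \<union> ?B \<union> (Y - {w}) \<union> (X - {a}))
        (undirected ?C - {{l, f l}} \<union> (\<lambda>x. {l, x}) ` (Y - {w}) \<union> (\<lambda>x. {f l, ?h x}) ` (Y - {w})
          \<union> (\<lambda>x. {x, ?h x}) ` (Y - {w}))"
        using doubling_extend[OF d l(1,2) _ cX(2) dj(2) inv dj(1)] NX(4) dj(3) by (simp add: Int_commute)
      then show ?thesis unfolding doubled_def und V i1 i2 l(3)[symmetric] using True by simp
    next
      case False
      then have la: "l = w" "f l = a" using l(3) by (auto simp: doubleton_eq_iff)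
      have img: "\<mu> ` (X - {a}) = Y - {w}" using mu by (simp add: bij_betw_def)
      have i1: "(\<lambda>x. {f l, \<mu> x}) ` (X - {a}) = (\<lambda>y. {a, y}) ` (Y - {w})"
        unfolding img[symmetric] image_image la(2) ..
      have i2: "(\<lambda>x. {l, x}) ` (X - {a}) = (\<lambda>x. {x, w}) ` (X - {a})"
        unfolding la by (simp add: insert_commute)
      have "\<exists>W' D' f'. doubling W' D' f' (?A \<union> ?B \<union> (X - {a}) \<union> (Y - {w}))
        (undirected ?C - {{l, f l}} \<union> (\<lambda>x. {l, x}) ` (X - {a}) \<union> (\<lambda>x. {f l, \<mu> x}) ` (X - {a})
          \<union> (\<lambda>x. {x, \<mu> x}) ` (X - {a}))"
        using doubling_extend[OF d l(1,2) _ cX(1) dj(1) mu dj(2) dj(3)] finX by simp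
      then show ?thesis unfolding doubled_def und V i1 i2 l(3)[symmetric] by (simp add: Un_ac)
    qed
    then show ?thesis using True unfolding extremal_bound_def by simp
  qed
qed

text \<open>Bicontraction costs exactly one unit of weight, so the weight here is at least 5 and the
  equality case does not arise.\<close>

lemma (in minimal_elementary) lonely_step:
  assumes b: "b \<in> B" "card (E\<inverse> `` {b}) = 2" and lonely: "\<And>u. (u, b) \<in> E \<Longrightarrow> card (E `` {u}) \<noteq> 2"
    and IH: "\<And>A' B' E'. minimal_elementary A' B' (E' :: ('a \<times> 'a) set) \<Longrightarrow> card A' < card A \<Longrightarrow> extremal_bound A' B' E'"
  shows "extremal_bound A B E"
proof -
  obtain a a' where aa: "E\<inverse> `` {b} = {a, a'}" "a \<noteq> a'" using b(2) by (meson card_2_iff)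
  then have ab: "(a, b) \<in> E" "(a', b) \<in> E" by blast+
  then have "a \<in> A" "a' \<in> A" using sub by blast+
  then have "3 \<le> card (E `` {a})" "3 \<le> card (E `` {a'})"
    using degA[of a] degA[of a'] lonely[OF ab(1)] lonely[OF ab(2)] by linarith+
  note r = bicontraction[OF b(1) aa this]
  have "card (A - {a'}) < card A" using \<open>a' \<in> A\<close> finA by (intro psubset_card_mono) auto
  then show ?thesis using IH[OF r(1)] r(2) unfolding extremal_bound_def by linarith
qed

theorem minimal_elementary_bound:
  fixes E :: "('a \<times> 'a) set"
  shows "minimal_elementary A B E \<Longrightarrow> extremal_bound A B E"
proof (induction "card A" arbitrary: A B E rule: less_induct)
  case less
  interpret minimal_elementary A B E by (rule less.prems)
  interpret S: minimal_elementary B A "E\<inverse>" by (rule minimal_swap)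
  have IH: "\<And>A' B' E'. minimal_elementary A' B' (E' :: ('a \<times> 'a) set) \<Longrightarrow> card A' < card A \<Longrightarrow> extremal_bound A' B' E'"
    using less.hyps by blast
  have IHS: "\<And>A' B' E'. minimal_elementary A' B' (E' :: ('a \<times> 'a) set) \<Longrightarrow> card A' < card B \<Longrightarrow> extremal_bound A' B' E'"
    using IH cardAB by simp
  \<comment> \<open>The sizes of tight sets at vertices of degree at least three, recorded for each
    class so that the least one can be taken over both.\<close>
  define TA where "TA n \<longleftrightarrow> (\<exists>X a b. tight_at A E X a b \<and> 3 \<le> card (E `` {a}) \<and> card X = n)" for n
  define TB where "TB n \<longleftrightarrow> (\<exists>Y b a. tight_at B (E\<inverse>) Y b a \<and> 3 \<le> card (E\<inverse> `` {b}) \<and> card Y = n)" for n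
  consider "card A = 2"
    | v where "v \<in> B" "card (E\<inverse> `` {v}) = 2" "\<And>u. (u, v) \<in> E \<Longrightarrow> card (E `` {u}) \<noteq> 2"
    | u where "u \<in> A" "card (E `` {u}) = 2" "\<And>v. (u, v) \<in> E \<Longrightarrow> card (E\<inverse> `` {v}) \<noteq> 2"
    | "card A \<noteq> 2" "\<And>n. \<not> TA n" "\<And>n. \<not> TB n"
    | n where "TA n \<or> TB n"
        "\<And>v. v \<in> B \<Longrightarrow> card (E\<inverse> `` {v}) = 2 \<Longrightarrow> \<exists>u. (u, v) \<in> E \<and> card (E `` {u}) = 2"
        "\<And>u. u \<in> A \<Longrightarrow> card (E `` {u}) = 2 \<Longrightarrow> \<exists>v. (u, v) \<in> E \<and> card (E\<inverse> `` {v}) = 2"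
    by metis
  then show ?case
  proof cases
    case 1
    obtain a w where "a \<in> A" "w \<in> B" using two cardAB by fastforce
    then have "weight A B E = 4" "doubled A B E"
      using four_vertices[OF 1] unfolding doubled_def by blast+
    then show ?thesis unfolding extremal_bound_def by simp
  next
    case 2
    then show ?thesis using lonely_step IH by blast
  next
    case 3
    then have "extremal_bound B A (E\<inverse>)" using S.lonely_step[of u] IHS by simp
    then show ?thesis by (simp add: extremal_bound_swap)
  next
    case 4
    \<comment> \<open>Every edge has a tight set, so the absence of tight sets at vertices of degree
      at least three means that all degrees are two. The weight is then 2|A|, more than 4 as |A| is
      at least three.\<close>
    have "card (E `` {a}) = 2" if a: "a \<in> A" for a
    proof (rule ccontr)
      assume "card (E `` {a}) \<noteq> 2"
      then have d: "3 \<le> card (E `` {a})" using degA[OF a] by linarith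
      then have "E `` {a} \<noteq> {}" by auto
      then obtain b where "(a, b) \<in> E" by blast
      then show False using tight 4(2) d unfolding TA_def by blast
    qed
    moreover have "card (E\<inverse> `` {b}) = 2" if b: "b \<in> B" for b
    proof (rule ccontr)
      assume "card (E\<inverse> `` {b}) \<noteq> 2"
      then have d: "3 \<le> card (E\<inverse> `` {b})" using degB[OF b] by linarith
      then have "E\<inverse> `` {b} \<noteq> {}" by auto
      then obtain a where "(b, a) \<in> E\<inverse>" by blast
      then show False using S.tight 4(3) d unfolding TB_def by blast
    qed
    ultimately have "weight A B E = (\<Sum>a\<in>A. 1) + (\<Sum>b\<in>B. 1)"
      unfolding weight_def by (simp add: vertex_weight_def)
    then show ?thesis using 4(1) two cardAB unfolding extremal_bound_def by simp
  next
    case 5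
    define m where "m = (LEAST n. TA n \<or> TB n)"
    have m: "TA m \<or> TB m" unfolding m_def using 5(1) by (rule LeastI)
    have le: "m \<le> k" if "TA k \<or> TB k" for k unfolding m_def using that by (rule Least_le)
    from m show ?thesis
    proof
      assume "TA m"
      then obtain X a b where X: "tight_at A E X a b" "3 \<le> card (E `` {a})" "card X = m"
        unfolding TA_def by blast
      interpret H: hub_tight A B E X a b
      proof
        show "tight_at A E X' a' b' \<Longrightarrow> 3 \<le> card (E `` {a'}) \<Longrightarrow> card X \<le> card X'" for X' a' b'
          using le[of "card X'"] X(3) unfolding TA_def by blast
        show "tight_at B (E\<inverse>) Y' b' a' \<Longrightarrow> 3 \<le> card (E\<inverse> `` {b'}) \<Longrightarrow> card X \<le> card Y'" for Y' b' a'
          using le[of "card Y'"] X(3) unfolding TB_def by blast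
      qed (use X 5(2,3) in auto)
      show ?thesis using H.extremal_bound_step IH by blast
    next
      assume "TB m"
      then obtain Y b a where Y: "tight_at B (E\<inverse>) Y b a" "3 \<le> card (E\<inverse> `` {b})" "card Y = m"
        unfolding TB_def by blast
      interpret H: hub_tight B A "E\<inverse>" Y b a
      proof
        show "tight_at B (E\<inverse>) Y' b' a' \<Longrightarrow> 3 \<le> card (E\<inverse> `` {b'}) \<Longrightarrow> card Y \<le> card Y'" for Y' b' a'
          using le[of "card Y'"] Y(3) unfolding TB_def by blast
        show "tight_at A ((E\<inverse>)\<inverse>) X' a' b' \<Longrightarrow> 3 \<le> card ((E\<inverse>)\<inverse> `` {a'}) \<Longrightarrow> card Y \<le> card X'" for X' a' b'
          using le[of "card X'"] Y(3) unfolding TA_def by auto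
      qed (use Y 5(2,3) in auto)
      have "extremal_bound B A (E\<inverse>)" using H.extremal_bound_step IHS by blast
      then show ?thesis by (simp add: extremal_bound_swap)
    qed
  qed
qed

section \<open>Walks, cycles and trees\<close>

lemma walk_singleton: "v \<in> verts G \<Longrightarrow> walk G [v] []"
  by (simp add: walk_def)

lemma walk_snoc:
  assumes "walk G vs es" "last vs = z" "e \<in> edges G" "ends G e = {z, y}" "y \<in> verts G"
  shows "walk G (vs @ [y]) (es @ [e])"
proof -
  have len: "length vs = Suc (length es)" using assms(1) by (simp add: walk_def)
  then have "vs \<noteq> []" by auto
  then have z: "vs ! length es = z" using assms(2) len by (simp add: last_conv_nth)
  have "(es @ [e]) ! i \<in> edges G \<and> ends G ((es @ [e]) ! i) = {(vs @ [y]) ! i, (vs @ [y]) ! Suc i}"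
    if "i < length (es @ [e])" for i
  proof (cases "i < length es")
    case True
    then show ?thesis using assms(1) len by (simp add: walk_def nth_append)
  next
    case False
    then have "i = length es" using that by simp
    then show ?thesis using assms z len by (simp add: nth_append)
  qed
  then show ?thesis using assms(1,5) len by (simp add: walk_def)
qed

lemma walk_Cons:
  assumes "walk G vs es" "hd vs = z" "e \<in> edges G" "ends G e = {y, z}" "y \<in> verts G"
  shows "walk G (y # vs) (e # es)"
proof -
  have len: "length vs = Suc (length es)" using assms(1) by (simp add: walk_def)
  then have "vs \<noteq> []" by auto
  then have z: "vs ! 0 = z" using assms(2) by (simp add: hd_conv_nth)
  have "(e # es) ! i \<in> edges G \<and> ends G ((e # es) ! i) = {(y # vs) ! i, (y # vs) ! Suc i}"
    if "i < length (e # es)" for i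
  proof (cases i)
    case 0
    then show ?thesis using assms z by simp
  next
    case (Suc j)
    then show ?thesis using assms(1) that by (simp add: walk_def)
  qed
  then show ?thesis using assms(1,5) len by (simp add: walk_def)
qed

text \<open>All later arguments about connectedness use closed vertex sets in place of walks.
  Conversely, the vertices reachable from u form such a set.\<close>

lemma connected_graph_iff:
  assumes m: "multigraph G"
  shows "connected_graph G \<longleftrightarrow> verts G \<noteq> {} \<and>
    (\<forall>Z. Z \<inter> verts G \<noteq> {} \<longrightarrow> (\<forall>e\<in>edges G. ends G e \<inter> Z \<noteq> {} \<longrightarrow> ends G e \<subseteq> Z) \<longrightarrow> verts G \<subseteq> Z)"
    (is "_ \<longleftrightarrow> _ \<and> ?closed")
proof
  assume c: "connected_graph G"
  have "v \<in> Z" if Z: "Z \<inter> verts G \<noteq> {}" "\<forall>e\<in>edges G. ends G e \<inter> Z \<noteq> {} \<longrightarrow> ends G e \<subseteq> Z" "v \<in> verts G" for Z v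
  proof -
    obtain u where u: "u \<in> Z" "u \<in> verts G" using Z by blast
    then obtain vs es where w: "walk G vs es" "hd vs = u" "last vs = v"
      using c Z(3) unfolding connected_graph_def by blast
    have len: "length vs = Suc (length es)" using w(1) by (simp add: walk_def)
    then have ne: "vs \<noteq> []" by auto
    have all: "vs ! i \<in> Z" if "i \<le> length es" for i
      using that
    proof (induction i)
      case 0
      then show ?case using u w ne by (simp add: hd_conv_nth)
    next
      case (Suc i)
      then have "es ! i \<in> edges G" "ends G (es ! i) = {vs ! i, vs ! Suc i}"
        using w(1) by (simp_all add: walk_def)
      then show ?case using Suc Z(2) by fastforce
    qed
    have "v = vs ! length es" using w(3) ne len by (simp add: last_conv_nth)
    then show ?thesis using all[of "length es"] by simp
  qed
  then show "verts G \<noteq> {} \<and> ?closed" using c unfolding connected_graph_def by blast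
next
  assume c: "verts G \<noteq> {} \<and> ?closed"
  have "\<exists>vs es. walk G vs es \<and> hd vs = u \<and> last vs = v" if uv: "u \<in> verts G" "v \<in> verts G" for u v
  proof -
    define Z where "Z = {v. \<exists>vs es. walk G vs es \<and> hd vs = u \<and> last vs = v}"
    have "u \<in> Z" using walk_singleton[OF uv(1)] unfolding Z_def by fastforce
    moreover have "ends G e \<subseteq> Z" if e: "e \<in> edges G" "ends G e \<inter> Z \<noteq> {}" for e
    proof -
      obtain z where z: "z \<in> Z" "z \<in> ends G e" using e by blast
      obtain y where y: "ends G e = {z, y}"
        using m e z unfolding multigraph_def by (metis card_2_iff doubleton_eq_iff insertE singletonD)
      obtain vs es where w: "walk G vs es" "hd vs = u" "last vs = z" using z(1) unfolding Z_def by blast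
      have "y \<in> verts G" using m e y unfolding multigraph_def by blast
      then have "walk G (vs @ [y]) (es @ [e])" by (rule walk_snoc[OF w(1,3) e(1) y])
      moreover have "vs \<noteq> []" using w(1) by (auto simp: walk_def)
      then have "hd (vs @ [y]) = u" "last (vs @ [y]) = y" using w by simp_all
      ultimately have "y \<in> Z" unfolding Z_def by blast
      then show ?thesis using y z by simp
    qed
    ultimately have "verts G \<subseteq> Z" using c uv(1) by blast
    then show ?thesis using uv(2) unfolding Z_def by blast
  qed
  moreover have "verts G \<noteq> {}" using c by (rule conjunct1)
  ultimately show "connected_graph G" unfolding connected_graph_def by simp
qed

text \<open>A cycle is remembered only as a nonempty edge set in which each end of an edge meets
  another edge of the set; this is all that is needed to refute it in a grown tree.\<close>

lemma cycle_no_pendant: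
  assumes m: "multigraph G" and c: "cycle G vs es"
  shows "\<forall>e\<in>set es. \<forall>v\<in>ends G e. \<exists>e'\<in>set es. e' \<noteq> e \<and> v \<in> ends G e'"
proof (intro ballI)
  fix e v assume e: "e \<in> set es" and v: "v \<in> ends G e"
  from c have w: "walk G vs es" and ne: "es \<noteq> []" and cl: "hd vs = last vs" and d: "distinct es"
    unfolding cycle_def by blast+
  have len: "length vs = Suc (length es)" using w by (simp add: walk_def)
  have en: "es ! i \<in> edges G" "ends G (es ! i) = {vs ! i, vs ! Suc i}" if "i < length es" for i
    using w that by (simp_all add: walk_def)
  have "vs \<noteq> []" using len by auto
  then have cl': "vs ! 0 = vs ! length es" using cl len by (simp add: hd_conv_nth last_conv_nth)
  \<comment> \<open>A closed walk of length one would be a loop. With length at least two, the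
    cyclic predecessor and successor of an edge differ from it.\<close>
  have k: "1 < length es"
  proof (rule ccontr)
    assume "\<not> 1 < length es"
    then have l1: "length es = 1" using ne by (cases es) auto
    then have "ends G (es ! 0) = {vs ! 0}" using en(2)[of 0] cl' by simp
    moreover have "card (ends G (es ! 0)) = 2" using m en(1)[of 0] l1 unfolding multigraph_def by simp
    ultimately show False by simp
  qed
  obtain i where i: "i < length es" "es ! i = e" using e by (metis in_set_conv_nth)
  have wit: "\<exists>e'\<in>set es. e' \<noteq> e \<and> v \<in> ends G e'" if "j < length es" "j \<noteq> i" "v \<in> ends G (es ! j)" for j
    using that i d nth_eq_iff_index_eq[OF d] by (intro bexI[of _ "es ! j"]) auto
  have "v = vs ! i \<or> v = vs ! Suc i" using v en(2)[OF i(1)] i(2) by auto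
  then show "\<exists>e'\<in>set es. e' \<noteq> e \<and> v \<in> ends G e'"
  proof
    assume vi: "v = vs ! i"
    show ?thesis
    proof (cases i)
      case 0
      have "Suc (length es - 1) = length es" "length es - 1 < length es" using k by simp_all
      then show ?thesis using wit[of "length es - 1"] en(2)[of "length es - 1"] vi cl' k 0 by auto
    next
      case (Suc j)
      then show ?thesis using wit[of j] en(2)[of j] vi i by simp
    qed
  next
    assume vi: "v = vs ! Suc i"
    show ?thesis
    proof (cases "Suc i < length es")
      case True
      then show ?thesis using wit[of "Suc i"] en(2)[of "Suc i"] vi by simp
    next
      case False
      then have "Suc i = length es" using i by simp
      then show ?thesis using wit[of 0] en(2)[of 0] vi cl' k ne by auto
    qed
  qed
qed

text \<open>The edge added last has an end that no other edge meets, so it is not in C; induction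
  removes the rest.\<close>

lemma grown_acyclic:
  "grown inc W D \<Longrightarrow> C \<subseteq> D \<Longrightarrow> \<forall>e\<in>C. \<forall>v\<in>inc e. \<exists>e'\<in>C. e' \<noteq> e \<and> v \<in> inc e' \<Longrightarrow> C = {}"
proof (induction rule: grown.induct)
  case (leaf W D x y e)
  have "e \<notin> C"
  proof
    assume "e \<in> C"
    then obtain e' where "e' \<in> C" "e' \<noteq> e" "y \<in> inc e'" using leaf.prems leaf.hyps(4) by blast
    then show False using grown_incidence[OF leaf.hyps(1), of e'] leaf.prems leaf.hyps by blast
  qed
  then show ?case using leaf.IH leaf.prems by blast
qed simp

text \<open>Repetition-free paths are needed so that a further edge between their ends closes a
  cycle in the sense of \<open>cycle\<close>.\<close>

lemma grown_path:
  "grown inc W D \<Longrightarrow> x \<in> W \<Longrightarrow> y \<in> W \<Longrightarrow>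
    \<exists>vs es. walk \<lparr>verts = W, edges = D, ends = inc\<rparr> vs es \<and> hd vs = x \<and> last vs = y \<and> distinct vs \<and> distinct es"
proof (induction arbitrary: x y rule: grown.induct)
  case (single v)
  then show ?case using walk_singleton[of v "\<lparr>verts = {v}, edges = {}, ends = inc\<rparr>"] by fastforce
next
  case (leaf W D z l e)
  let ?G = "\<lparr>verts = W, edges = D, ends = inc\<rparr>"
  let ?H = "\<lparr>verts = insert l W, edges = insert e D, ends = inc\<rparr>"
  have e: "e \<notin> D" using grown_incidence[OF leaf.hyps(1), of e] leaf.hyps by auto
  have mono: "walk ?H vs es" if "walk ?G vs es" for vs es using that by (auto simp: walk_def)
  have sub: "set vs \<subseteq> W" "set es \<subseteq> D" "vs \<noteq> []" if "walk ?G vs es" for vs es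
    using that by (auto simp: walk_def in_set_conv_nth)
  consider "x \<in> W" "y \<in> W" | "x = l" "y = l" | "x = l" "y \<in> W" | "x \<in> W" "y = l"
    using leaf.prems by blast
  then show ?case
  proof cases
    case 1
    then show ?thesis using leaf.IH mono by blast
  next
    case 2
    then show ?thesis using walk_singleton[of l ?H] by fastforce
  next
    case 3
    obtain vs es where w: "walk ?G vs es" "hd vs = z" "last vs = y" "distinct vs" "distinct es"
      using leaf.IH[OF leaf.hyps(2) 3(2)] by blast
    have "walk ?H (l # vs) (e # es)"
      using walk_Cons[OF mono[OF w(1)] w(2)] leaf.hyps by (simp add: insert_commute)
    moreover have "distinct (l # vs)" "distinct (e # es)" using sub[OF w(1)] w leaf.hyps(3) e by auto
    ultimately show ?thesis using 3 w sub(3)[OF w(1)] by (intro exI[of _ "l # vs"] exI[of _ "e # es"]) auto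
  next
    case 4
    obtain vs es where w: "walk ?G vs es" "hd vs = x" "last vs = z" "distinct vs" "distinct es"
      using leaf.IH[OF 4(1) leaf.hyps(2)] by blast
    have "walk ?H (vs @ [l]) (es @ [e])"
      using walk_snoc[OF mono[OF w(1)] w(3)] leaf.hyps by simp
    moreover have "distinct (vs @ [l])" "distinct (es @ [e])" using sub[OF w(1)] w leaf.hyps(3) e by auto
    ultimately show ?thesis using 4 w sub(3)[OF w(1)] by (intro exI[of _ "vs @ [l]"] exI[of _ "es @ [e]"]) auto
  qed
qed

text \<open>In a tree, take a grown subtree with as many vertices as possible. Connectedness makes
  it spanning, since an edge leaving it would enlarge it; an edge of T missing from it would close a
  cycle with a path.\<close>

lemma tree_iff_grown:
  assumes m: "multigraph T"
  shows "tree T \<longleftrightarrow> grown (ends T) (verts T) (edges T)"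
proof
  assume g: "grown (ends T) (verts T) (edges T)"
  have "verts T \<noteq> {}" using grown_card[OF g] by auto
  then have "connected_graph T"
    unfolding connected_graph_iff[OF m] using grown_closed[OF g] by blast
  moreover have "\<not> cycle T vs es" for vs es
  proof
    assume c: "cycle T vs es"
    then have "set es \<subseteq> edges T" "es \<noteq> []" by (auto simp: cycle_def walk_def in_set_conv_nth)
    then show False using grown_acyclic[OF g] cycle_no_pendant[OF m c] by (metis set_empty)
  qed
  ultimately show "tree T" using m unfolding tree_def by blast
next
  assume t: "tree T"
  have fin: "finite (verts T)" using m unfolding multigraph_def by blast
  define P where "P W \<longleftrightarrow> (\<exists>D. grown (ends T) W D \<and> W \<subseteq> verts T \<and> D \<subseteq> edges T)" for W
  have conn: "verts T \<noteq> {}" "\<And>Z. Z \<inter> verts T \<noteq> {} \<Longrightarrow> \<forall>e\<in>edges T. ends T e \<inter> Z \<noteq> {} \<longrightarrow> ends T e \<subseteq> Z \<Longrightarrow> verts T \<subseteq> Z"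
    using t unfolding tree_def connected_graph_iff[OF m] by blast+
  obtain v where v: "v \<in> verts T" using conn by blast
  then have Pv: "P {v}" unfolding P_def using grown.single[of "ends T" v] by auto
  have "\<forall>W. P W \<longrightarrow> card W < Suc (card (verts T))"
    unfolding P_def less_Suc_eq_le using card_mono[OF fin] by blast
  from ex_has_greatest_nat[OF Pv this] obtain W where W: "P W" "\<And>W'. P W' \<Longrightarrow> card W' \<le> card W" by blast
  then obtain D where D: "grown (ends T) W D" "W \<subseteq> verts T" "D \<subseteq> edges T" unfolding P_def by blast
  have finW: "finite W" using D fin finite_subset by blast
  have "W \<noteq> {}" using grown_card[OF D(1)] by auto
  have "verts T \<subseteq> W"
  proof (rule conn(2))
    show "W \<inter> verts T \<noteq> {}" using \<open>W \<noteq> {}\<close> D by blast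
    show "\<forall>e\<in>edges T. ends T e \<inter> W \<noteq> {} \<longrightarrow> ends T e \<subseteq> W"
    proof (intro ballI impI, rule ccontr)
      fix e assume e: "e \<in> edges T" "ends T e \<inter> W \<noteq> {}" "\<not> ends T e \<subseteq> W"
      obtain x where x: "x \<in> W" "x \<in> ends T e" using e by blast
      obtain y where y: "y \<notin> W" "y \<in> ends T e" using e by blast
      have "card (ends T e) = 2" "ends T e \<subseteq> verts T" using m e unfolding multigraph_def by blast+
      moreover have "x \<noteq> y" using x y by blast
      ultimately have "ends T e = {x, y}" using x y by (metis card_2_iff doubleton_eq_iff insertE singletonD)
      then have "grown (ends T) (insert y W) (insert e D)" using grown.leaf D(1) x y by metis
      then have "P (insert y W)" unfolding P_def using D e y \<open>ends T e \<subseteq> verts T\<close> by blast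
      then have "card (insert y W) \<le> card W" by (rule W(2))
      then show False using finW y by simp
    qed
  qed
  then have WV: "W = verts T" using D by blast
  have "edges T \<subseteq> D"
  proof (rule ccontr)
    assume "\<not> edges T \<subseteq> D"
    then obtain e where e: "e \<in> edges T" "e \<notin> D" by blast
    have "card (ends T e) = 2" "ends T e \<subseteq> verts T" using m e unfolding multigraph_def by blast+
    then obtain x y where xy: "ends T e = {x, y}" "x \<noteq> y" "x \<in> W" "y \<in> W" using WV by (metis card_2_iff insert_subset)
    obtain vs es where w: "walk \<lparr>verts = W, edges = D, ends = ends T\<rparr> vs es"
      "hd vs = x" "last vs = y" "distinct vs" "distinct es"
      using grown_path[OF D(1) xy(3,4)] by blast
    have sub: "set vs \<subseteq> W" "set es \<subseteq> D" "vs \<noteq> []"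
      using w(1) by (auto simp: walk_def in_set_conv_nth)
    have "walk T vs es" using w(1) D by (auto simp: walk_def)
    then have wc: "walk T (vs @ [x]) (es @ [e])"
      using walk_snoc[of T vs es y e x] w(3) e xy WV by (simp add: insert_commute)
    have hx: "vs = x # tl vs" using w(2) sub(3) by (cases vs) auto
    then have "distinct (tl vs @ [x])" using w(4) by (metis distinct.simps(2) distinct_append distinct_singleton disjoint_insert(1) inf_bot_right list.set(1) list.set(2))
    then have "distinct (tl (vs @ [x]))" using sub(3) by simp
    moreover have "hd (vs @ [x]) = last (vs @ [x])" using w(2) sub(3) by simp
    moreover have "distinct (es @ [e])" using w(5) sub e by auto
    ultimately have "cycle T (vs @ [x]) (es @ [e])" using wc unfolding cycle_def by simp
    then show False using t unfolding tree_def by blast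
  qed
  then show "grown (ends T) (verts T) (edges T)" using D WV by (metis subset_antisym)
qed

section \<open>Matchings and edge cuts in trees\<close>

definition covers :: "('e \<Rightarrow> 'v set) \<Rightarrow> 'e set \<Rightarrow> 'v \<Rightarrow> bool" where
  "covers inc N v \<longleftrightarrow> (\<exists>e\<in>N. v \<in> inc e)"

definition partial_matching :: "('e \<Rightarrow> 'v set) \<Rightarrow> 'e set \<Rightarrow> bool" where
  "partial_matching inc N \<longleftrightarrow> (\<forall>e\<in>N. \<forall>e'\<in>N. inc e \<inter> inc e' \<noteq> {} \<longrightarrow> e = e')"

lemma grown_isolated:
  assumes g: "grown inc W D" and x: "x \<in> W" "\<forall>e\<in>D. x \<notin> inc e"
  shows "W = {x}"
proof -
  have "W \<subseteq> {x}" by (rule grown_closed[OF g]) (use x in auto)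
  then show ?thesis using x by blast
qed

text \<open>The two claims need each other in the induction. To avoid the new leaf l, its neighbour
  x must be matched by an old edge at x; to use the new edge, x must be avoided by the old matching.
  Leaves may stay uncovered, since they are matched to their copies later.\<close>

lemma grown_matchings:
  assumes "grown inc W D"
  shows "(\<forall>v\<in>W. \<exists>N\<subseteq>D. partial_matching inc N \<and> \<not> covers inc N v \<and>
        (\<forall>u\<in>W. u \<noteq> v \<longrightarrow> 2 \<le> card {e \<in> D. u \<in> inc e} \<longrightarrow> covers inc N u)) \<and>
    (\<forall>d\<in>D. \<exists>N\<subseteq>D. partial_matching inc N \<and> d \<in> N \<and>
        (\<forall>u\<in>W. 2 \<le> card {e \<in> D. u \<in> inc e} \<longrightarrow> covers inc N u))"
  using assms
proof (induction rule: grown.induct)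
  case (single v)
  then show ?case by (auto simp: partial_matching_def covers_def)
next
  case (leaf W D x l e)
  let ?D = "insert e D" and ?W = "insert l W"
  note g = leaf.hyps(1)
  have inW: "inc d \<subseteq> W" if "d \<in> D" for d using grown_incidence[OF g that] by blast
  have deg: "card {d \<in> ?D. u \<in> inc d} = card {d \<in> D. u \<in> inc d}" if "u \<in> W" "u \<noteq> x" for u
  proof -
    have "{d \<in> ?D. u \<in> inc d} = {d \<in> D. u \<in> inc d}" using that leaf.hyps by auto
    then show ?thesis by simp
  qed
  have degl: "\<not> 2 \<le> card {d \<in> ?D. l \<in> inc d}"
  proof -
    have "{d \<in> ?D. l \<in> inc d} = {e}" using inW leaf.hyps by auto
    then show ?thesis by simp
  qed
  have ext: "partial_matching inc (insert e N)" if "N \<subseteq> D" "partial_matching inc N" "\<not> covers inc N x" for N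
  proof -
    have "inc d \<inter> inc e = {}" if "d \<in> N" for d
      using that \<open>N \<subseteq> D\<close> \<open>\<not> covers inc N x\<close> inW leaf.hyps unfolding covers_def by auto
    then show ?thesis using \<open>partial_matching inc N\<close> unfolding partial_matching_def by blast
  qed
  have mono: "covers inc (insert e N) u" if "covers inc N u" for N u using that unfolding covers_def by blast
  have cx: "covers inc (insert e N) x" for N using leaf.hyps unfolding covers_def by auto
  have Q: "\<exists>N\<subseteq>D. partial_matching inc N \<and> \<not> covers inc N v \<and>
        (\<forall>u\<in>W. u \<noteq> v \<longrightarrow> 2 \<le> card {e \<in> D. u \<in> inc e} \<longrightarrow> covers inc N u)" if "v \<in> W" for v
    using leaf.IH that by blast
  have R: "\<exists>N\<subseteq>D. partial_matching inc N \<and> d \<in> N \<and>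
        (\<forall>u\<in>W. 2 \<le> card {e \<in> D. u \<in> inc e} \<longrightarrow> covers inc N u)" if "d \<in> D" for d
    using leaf.IH that by blast
  have 1: "\<exists>N\<subseteq>?D. partial_matching inc N \<and> \<not> covers inc N v \<and>
        (\<forall>u\<in>?W. u \<noteq> v \<longrightarrow> 2 \<le> card {e \<in> ?D. u \<in> inc e} \<longrightarrow> covers inc N u)" if v: "v \<in> ?W" for v
  proof (cases "v = l")
    case False
    then have vW: "v \<in> W" using v by blast
    obtain N where N: "N \<subseteq> D" "partial_matching inc N" "\<not> covers inc N v"
      "\<forall>u\<in>W. u \<noteq> v \<longrightarrow> 2 \<le> card {e \<in> D. u \<in> inc e} \<longrightarrow> covers inc N u"
      using Q[OF vW] by blast
    show ?thesis
    proof (cases "v = x \<or> covers inc N x")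
      case True
      have "covers inc N u" if "u \<in> ?W" "u \<noteq> v" "2 \<le> card {e \<in> ?D. u \<in> inc e}" for u
        using that True N(4) deg[of u] degl by (cases "u = x") auto
      then show ?thesis using N(1-3) by blast
    next
      case xv: False
      have "covers inc (insert e N) u" if "u \<in> ?W" "u \<noteq> v" "2 \<le> card {e \<in> ?D. u \<in> inc e}" for u
        using that N(4) deg[of u] degl mono cx by (cases "u = x") auto
      moreover have "\<not> covers inc (insert e N) v" using N(3) xv False leaf.hyps unfolding covers_def by auto
      moreover have "insert e N \<subseteq> ?D" using N(1) by blast
      ultimately show ?thesis using ext[OF N(1,2)] xv by blast
    qed
  next
    case True
    show ?thesis
    proof (cases "\<exists>d\<in>D. x \<in> inc d")
      \<comment> \<open>The new tree is a single edge, so no vertex needs to be covered and the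
        empty matching suffices.\<close>
      case False
      then have "W = {x}" using grown_isolated[OF g leaf.hyps(2)] by blast
      then have "inc d \<subseteq> {x}" if "d \<in> D" for d using inW[OF that] by simp
      moreover have "inc d \<noteq> {}" if "d \<in> D" for d using grown_incidence[OF g that] by auto
      ultimately have "D = {}" using False by blast
      then have "{d \<in> ?D. u \<in> inc d} \<subseteq> {e}" for u by blast
      then have "card {d \<in> ?D. u \<in> inc d} \<le> card {e}" for u by (intro card_mono) auto
      then have "card {d \<in> ?D. u \<in> inc d} \<le> 1" for u by simp
      then have "\<not> 2 \<le> card {d \<in> ?D. u \<in> inc d}" for u by (meson not_one_le_zero numeral_le_one_iff order_trans semiring_norm(69))
      then show ?thesis by (intro exI[of _ "{}"]) (auto simp: partial_matching_def covers_def)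
    next
      case 2: True
      then obtain d where d: "d \<in> D" "x \<in> inc d" by blast
      obtain N where N: "N \<subseteq> D" "partial_matching inc N" "d \<in> N"
        "\<forall>u\<in>W. 2 \<le> card {e \<in> D. u \<in> inc e} \<longrightarrow> covers inc N u" using R[OF d(1)] by blast
      have "covers inc N x" using d N(3) unfolding covers_def by blast
      then have "covers inc N u" if "u \<in> ?W" "u \<noteq> v" "2 \<le> card {e \<in> ?D. u \<in> inc e}" for u
        using that N(4) deg[of u] True by (cases "u = x") auto
      moreover have "\<not> covers inc N v" using True inW N(1) leaf.hyps unfolding covers_def by blast
      moreover have "N \<subseteq> ?D" using N(1) by blast
      ultimately show ?thesis using N(2) by blast
    qed
  qed
  have 2: "\<exists>N\<subseteq>?D. partial_matching inc N \<and> d \<in> N \<and>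
        (\<forall>u\<in>?W. 2 \<le> card {e \<in> ?D. u \<in> inc e} \<longrightarrow> covers inc N u)" if d: "d \<in> ?D" for d
  proof (cases "d \<in> D")
    case True
    obtain N where N: "N \<subseteq> D" "partial_matching inc N" "d \<in> N"
        "\<forall>u\<in>W. 2 \<le> card {e \<in> D. u \<in> inc e} \<longrightarrow> covers inc N u" using R[OF True] by blast
    show ?thesis
    proof (cases "covers inc N x")
      case True
      have "covers inc N u" if "u \<in> ?W" "2 \<le> card {e \<in> ?D. u \<in> inc e}" for u
        using that True N(4) deg[of u] degl by (cases "u = x") auto
      then show ?thesis using N by blast
    next
      case False
      have "covers inc (insert e N) u" if "u \<in> ?W" "2 \<le> card {e \<in> ?D. u \<in> inc e}" for u
        using that N(4) deg[of u] degl mono cx by (cases "u = x") auto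
      moreover have "insert e N \<subseteq> ?D" "d \<in> insert e N" using N(1,3) by blast+
      ultimately show ?thesis using ext[OF N(1,2) False] by blast
    qed
  next
    case False
    then have de: "d = e" using d by blast
    obtain N where N: "N \<subseteq> D" "partial_matching inc N" "\<not> covers inc N x"
      "\<forall>u\<in>W. u \<noteq> x \<longrightarrow> 2 \<le> card {e \<in> D. u \<in> inc e} \<longrightarrow> covers inc N u"
      using Q[OF leaf.hyps(2)] by blast
    have "covers inc (insert e N) u" if "u \<in> ?W" "2 \<le> card {e \<in> ?D. u \<in> inc e}" for u
      using that N(4) deg[of u] degl mono cx by (cases "u = x") auto
    moreover have "insert e N \<subseteq> ?D" "d \<in> insert e N" using N(1) de by blast+
    ultimately show ?thesis using ext[OF N(1-3)] by blast
  qed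
  show ?case using 1 2 by blast
qed

text \<open>Z is one of the two components left after removing d. It starts as the new leaf when d
  is added, and a later leaf joins the side of its neighbour.\<close>

lemma grown_split:
  "grown inc W D \<Longrightarrow> d \<in> D \<Longrightarrow>
    \<exists>Z\<subseteq>W. card (inc d \<inter> Z) = 1 \<and> (\<forall>e\<in>D - {d}. inc e \<subseteq> Z \<or> inc e \<inter> Z = {})"
proof (induction rule: grown.induct)
  case (leaf W D x l e)
  have inW: "inc c \<subseteq> W" if "c \<in> D" for c using grown_incidence[OF leaf.hyps(1) that] by blast
  show ?case
  proof (cases "d \<in> D")
    case False
    then have "inc d = {x, l}" using leaf by blast
    moreover have "x \<noteq> l" using leaf by blast
    ultimately have "inc d \<inter> {l} = {l}" by auto
    moreover have "\<forall>c\<in>insert e D - {d}. inc c \<subseteq> {l} \<or> inc c \<inter> {l} = {}"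
      using inW False leaf.hyps(3) leaf.prems by blast
    ultimately show ?thesis by (intro exI[of _ "{l}"]) simp
  next
    case True
    then obtain Z where Z: "Z \<subseteq> W" "card (inc d \<inter> Z) = 1" "\<forall>c\<in>D - {d}. inc c \<subseteq> Z \<or> inc c \<inter> Z = {}"
      using leaf.IH by blast
    define Z' where "Z' = (if x \<in> Z then insert l Z else Z)"
    have eq: "inc c \<inter> Z' = inc c \<inter> Z" if "c \<in> D" for c
      using inW[OF that] leaf.hyps(3) unfolding Z'_def by auto
    have "card (inc d \<inter> Z') = 1" using eq[OF True] Z(2) by simp
    moreover have "inc c \<subseteq> Z' \<or> inc c \<inter> Z' = {}" if "c \<in> insert e D - {d}" for c
    proof (cases "c = e")
      case True
      then show ?thesis using leaf.hyps Z(1) unfolding Z'_def by auto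
    next
      case False
      then show ?thesis using that eq[of c] Z(3) by blast
    qed
    moreover have "Z' \<subseteq> insert l W" using Z(1) unfolding Z'_def by auto
    ultimately show ?thesis by blast
  qed
qed simp

lemma grown_coloring:
  "grown inc W D \<Longrightarrow> \<exists>c :: 'v \<Rightarrow> bool. \<forall>e\<in>D. \<exists>x y. inc e = {x, y} \<and> c x \<and> \<not> c y"
proof (induction rule: grown.induct)
  case (leaf W D x l e)
  then obtain c :: "'v \<Rightarrow> bool" where c: "\<forall>e\<in>D. \<exists>x y. inc e = {x, y} \<and> c x \<and> \<not> c y" by blast
  let ?c = "c(l := \<not> c x)"
  have xl: "x \<noteq> l" using leaf.hyps by blast
  have "\<exists>x y. inc d = {x, y} \<and> ?c x \<and> \<not> ?c y" if "d \<in> insert e D" for d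
  proof (cases "d = e")
    case True
    show ?thesis
    proof (cases "c x")
      case True
      then show ?thesis using \<open>d = e\<close> leaf.hyps(4) xl by (intro exI[of _ x] exI[of _ l]) auto
    next
      case False
      then show ?thesis using \<open>d = e\<close> leaf.hyps(4) xl by (intro exI[of _ l] exI[of _ x]) auto
    qed
  next
    case False
    then have dD: "d \<in> D" using that by blast
    then obtain p q where pq: "inc d = {p, q}" "c p" "\<not> c q" using c by blast
    have "l \<notin> inc d" using grown_incidence[OF leaf.hyps(1) dD] leaf.hyps(3) by blast
    then have "p \<noteq> l" "q \<noteq> l" using pq(1) by auto
    then have "inc d = {p, q} \<and> ?c p \<and> \<not> ?c q" using pq by simp
    then show ?thesis by blast
  qed
  then show ?case by (intro exI[of _ ?c] ballI)
qed simp

lemma grown_degree_sum: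
  assumes g: "grown inc W D"
  shows "(\<Sum>v\<in>W. card {e \<in> D. v \<in> inc e}) = 2 * card D"
proof -
  have fin: "finite W" "finite D" using grown_finite[OF g] by blast+
  have "(\<Sum>v\<in>W. card {e \<in> D. v \<in> inc e}) = (\<Sum>e\<in>D. 2)"
  proof (rule sum_multicount_gen[OF fin], rule ballI)
    fix e assume e: "e \<in> D"
    have "{v \<in> W. v \<in> inc e} = inc e" using grown_incidence[OF g e] by blast
    then show "card {v \<in> W. v \<in> inc e} = 2" using grown_incidence[OF g e] by simp
  qed
  then show ?thesis by simp
qed

text \<open>The matching edges other than d meet S in 0 or 2 vertices, and d meets it in
  one.\<close>

lemma perfect_matching_odd_cut:
  assumes m: "multigraph G" and M: "perfect_matching G M" and S: "S \<subseteq> verts G"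
    and d: "d \<in> M" "card (ends G d \<inter> S) = 1"
    and others: "\<And>e. e \<in> edges G \<Longrightarrow> e \<noteq> d \<Longrightarrow> ends G e \<subseteq> S \<or> ends G e \<inter> S = {}"
  shows "odd (card S)"
proof -
  have ME: "M \<subseteq> edges G" and u: "\<forall>v\<in>verts G. \<exists>!e. e \<in> M \<and> v \<in> ends G e"
    using M unfolding perfect_matching_def by blast+
  have finM: "finite M" using ME m finite_subset unfolding multigraph_def by blast
  have fin: "finite (ends G e \<inter> S)" for e using S m finite_subset unfolding multigraph_def by blast
  have ex: "\<exists>e\<in>M. v \<in> ends G e" if "v \<in> S" for v using u S that by (meson subsetD)
  have un: "e = e'" if "e \<in> M" "e' \<in> M" "v \<in> S" "v \<in> ends G e" "v \<in> ends G e'" for e e' v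
  proof -
    have "\<exists>!e. e \<in> M \<and> v \<in> ends G e" using u S that(3) by blast
    then show ?thesis using that by (elim ex1E) metis
  qed
  have "S = (\<Union>e\<in>M. ends G e \<inter> S)" using ex by blast
  moreover have "card (\<Union>e\<in>M. ends G e \<inter> S) = (\<Sum>e\<in>M. card (ends G e \<inter> S))"
    using finM fin un by (intro card_UN_disjoint) blast+
  ultimately have "card S = (\<Sum>e\<in>M. card (ends G e \<inter> S))" by simp
  also have "\<dots> = 1 + (\<Sum>e\<in>M - {d}. card (ends G e \<inter> S))"
    using finM d by (simp add: sum.remove)
  finally have "card S = 1 + (\<Sum>e\<in>M - {d}. card (ends G e \<inter> S))" .
  moreover have "even (\<Sum>e\<in>M - {d}. card (ends G e \<inter> S))"
  proof (rule dvd_sum)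
    fix e assume e: "e \<in> M - {d}"
    then have "ends G e \<inter> S = ends G e \<or> ends G e \<inter> S = {}" using others ME by blast
    moreover have "card (ends G e) = 2" using e ME m unfolding multigraph_def by blast
    ultimately show "even (card (ends G e \<inter> S))" by auto
  qed
  ultimately show ?thesis by simp
qed

section \<open>Doubled cubic Halin trees are extremal\<close>

locale doubled_tree =
  fixes T T' H :: "('v, 'e) mgraph" and f :: "'v \<Rightarrow> 'v" and g :: "'e \<Rightarrow> 'e" and m :: "'v \<Rightarrow> 'e"
  assumes multH: "multigraph H" and cubic: "cubic_halin_tree T" and iso: "isomorphism T T' f g"
    and disjV: "verts T \<inter> verts T' = {}" and disjE: "edges T \<inter> edges T' = {}"
    and inj_m: "inj_on m (leaves T)" and disjM: "m ` leaves T \<inter> (edges T \<union> edges T') = {}"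
    and vH: "verts H = verts T \<union> verts T'"
    and eH: "edges H = edges T \<union> edges T' \<union> m ` leaves T"
    and endsT: "\<forall>e\<in>edges T. ends H e = ends T e"
    and endsT': "\<forall>e\<in>edges T'. ends H e = ends T' e"
    and endsM: "\<forall>l\<in>leaves T. ends H (m l) = {l, f l}"
begin

section \<open>Incidences, degrees and leaves in the doubled tree\<close>

lemma multT: "multigraph T"
  using cubic unfolding cubic_halin_tree_def tree_def by blast

lemma grownT: "grown (ends T) (verts T) (edges T)"
  using cubic tree_iff_grown[OF multT] unfolding cubic_halin_tree_def by blast

lemma card_T: "2 \<le> card (verts T)"
  using cubic unfolding cubic_halin_tree_def by blast

lemma finT: "finite (verts T)" "finite (edges T)"
  using multT unfolding multigraph_def by blast+

lemma leaf_sub: "leaves T \<subseteq> verts T"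
  unfolding leaves_def by blast

lemma f: "inj_on f (verts T)" "verts T' = f ` verts T"
  and g: "inj_on g (edges T)" "edges T' = g ` edges T"
  and ends_g: "e \<in> edges T \<Longrightarrow> ends H (g e) = f ` ends T e"
proof -
  show 1: "inj_on f (verts T)" "verts T' = f ` verts T" "inj_on g (edges T)" "edges T' = g ` edges T"
    using iso unfolding isomorphism_def bij_betw_def by auto
  show "e \<in> edges T \<Longrightarrow> ends H (g e) = f ` ends T e"
    using iso endsT' 1(4) unfolding isomorphism_def by auto
qed

lemma edge_cases:
  assumes "e \<in> edges H"
  obtains "e \<in> edges T" | d where "d \<in> edges T" "e = g d" | l where "l \<in> leaves T" "e = m l"
proof -
  have "e \<in> edges T \<or> (\<exists>d\<in>edges T. e = g d) \<or> (\<exists>l\<in>leaves T. e = m l)"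
    using assms unfolding eH g(2) by auto
  then show ?thesis using that by auto
qed

lemma ends_sub: "e \<in> edges T \<Longrightarrow> ends T e \<subseteq> verts T"
  using multT unfolding multigraph_def by blast

lemma fV: "v \<in> verts T \<Longrightarrow> f v \<notin> verts T"
  using disjV f(2) by blast

lemma f_iff: "v \<in> verts T \<Longrightarrow> e \<in> edges T \<Longrightarrow> f v \<in> f ` ends T e \<longleftrightarrow> v \<in> ends T e"
  by (rule inj_on_image_mem_iff[OF f(1) _ ends_sub])

lemma incident:
  assumes v: "v \<in> verts T"
  shows "{e \<in> edges H. v \<in> ends H e} = {e \<in> edges T. v \<in> ends T e} \<union> (if v \<in> leaves T then {m v} else {})"
proof -
  have "v \<notin> ends H e" if eT': "e \<in> edges T'" for e
  proof
    assume ve: "v \<in> ends H e"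
    obtain d where "d \<in> edges T" "e = g d" using eT' g(2) by auto
    then obtain u where "u \<in> verts T" "v = f u" using ve ends_g[of d] ends_sub[of d] by auto
    then show False using fV v by blast
  qed
  moreover have "v \<in> ends H (m l) \<longleftrightarrow> v = l" if "l \<in> leaves T" for l
  proof -
    have "l \<in> verts T" "ends H (m l) = {l, f l}" using that leaf_sub endsM by blast+
    then show ?thesis using fV v by auto
  qed
  moreover have "v \<in> ends H e \<longleftrightarrow> v \<in> ends T e" if "e \<in> edges T" for e using that endsT by simp
  ultimately show ?thesis unfolding eH by auto
qed

lemma incident':
  assumes v: "v \<in> verts T"
  shows "{e \<in> edges H. f v \<in> ends H e} = g ` {e \<in> edges T. v \<in> ends T e} \<union> (if v \<in> leaves T then {m v} else {})"
proof -
  have "f v \<notin> ends H e" if "e \<in> edges T" for e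
    using that endsT ends_sub fV v by blast
  moreover have "f v \<in> ends H (g e) \<longleftrightarrow> v \<in> ends T e" if "e \<in> edges T" for e
    using that ends_g f_iff v by simp
  moreover have "f v \<in> ends H (m l) \<longleftrightarrow> v = l" if "l \<in> leaves T" for l
  proof -
    have "l \<in> verts T" "ends H (m l) = {l, f l}" using that leaf_sub endsM by blast+
    moreover from this have "f v \<noteq> l" using fV v by blast
    ultimately show ?thesis using f(1) v by (auto dest: inj_onD)
  qed
  ultimately show ?thesis unfolding eH g(2) by auto
qed

lemma deg_eq: "degree T v = card {e \<in> edges T. v \<in> ends T e}"
  by (simp add: degree_def)

lemma degT: "v \<in> verts T \<Longrightarrow> degree T v = (if v \<in> leaves T then 1 else 3)"
proof (cases "v \<in> leaves T")
  case True
  then show ?thesis unfolding leaves_def by simp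
next
  case False
  moreover assume "v \<in> verts T"
  ultimately show ?thesis using cubic unfolding cubic_halin_tree_def by simp
qed

lemma degH:
  assumes v: "v \<in> verts T"
  shows "degree H v = (if v \<in> leaves T then 2 else 3)" "degree H (f v) = (if v \<in> leaves T then 2 else 3)"
proof -
  let ?I = "{e \<in> edges T. v \<in> ends T e}"
  have fin: "finite ?I" using finT by simp
  have c: "card ?I = (if v \<in> leaves T then 1 else 3)" using degT[OF v] by (simp add: deg_eq)
  have cg: "card (g ` ?I) = card ?I" using g(1) by (intro card_image) (auto simp: inj_on_def)
  have n: "m v \<notin> ?I" "m v \<notin> g ` ?I" if "v \<in> leaves T" using that disjM g(2) by blast+
  show "degree H v = (if v \<in> leaves T then 2 else 3)"
    unfolding degree_def incident[OF v] using c n fin by auto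
  show "degree H (f v) = (if v \<in> leaves T then 2 else 3)"
    unfolding degree_def incident'[OF v] using c cg n fin by auto
qed

text \<open>With k vertices and L leaves, the degree sum is 3(k - L) + L = 2(k - 1). As H has 2k
  vertices and 2L of degree two, this is exactly the extremal count.\<close>

lemma leaf_count: "card (verts T) + 2 = 2 * card (leaves T)"
proof -
  have finL: "finite (leaves T)" using leaf_sub finT finite_subset by blast
  have "(\<Sum>v\<in>verts T. degree T v) = 2 * card (edges T)"
    unfolding degree_def by (rule grown_degree_sum[OF grownT])
  also have "(\<Sum>v\<in>verts T. degree T v) = (\<Sum>v\<in>verts T - leaves T. degree T v) + (\<Sum>v\<in>leaves T. degree T v)"
    using leaf_sub finT by (intro sum.subset_diff) auto
  also have "(\<Sum>v\<in>verts T - leaves T. degree T v) = (\<Sum>v\<in>verts T - leaves T. 3)"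
    using degT by (intro sum.cong) auto
  also have "(\<Sum>v\<in>leaves T. degree T v) = (\<Sum>v\<in>leaves T. 1)"
    using degT leaf_sub by (intro sum.cong) auto
  finally have "3 * card (verts T - leaves T) + card (leaves T) = 2 * card (edges T)" by simp
  moreover have "card (verts T - leaves T) + card (leaves T) = card (verts T)"
    using card_Diff_subset[OF finL leaf_sub] card_mono[OF finT(1) leaf_sub] by linarith
  moreover have "card (verts T) = Suc (card (edges T))" by (rule grown_card[OF grownT])
  ultimately show ?thesis by linarith
qed

lemma V2_count: "real (card (V2 H)) = real (card (verts H)) / 2 + 2"
proof -
  have finL: "finite (leaves T)" using leaf_sub finT finite_subset by blast
  have "V2 H = leaves T \<union> f ` leaves T"
    unfolding V2_def vH f(2) using degH leaf_sub by (auto split: if_splits)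
  moreover have "leaves T \<inter> f ` leaves T = {}" using fV leaf_sub by blast
  moreover have "card (f ` leaves T) = card (leaves T)"
    using f(1) leaf_sub by (intro card_image) (auto intro: inj_on_subset)
  ultimately have "card (V2 H) = 2 * card (leaves T)" using finL by (simp add: card_Un_disjoint)
  moreover have "card (verts H) = 2 * card (verts T)"
    unfolding vH using disjV f finT by (simp add: card_Un_disjoint card_image)
  ultimately have "card (V2 H) * 2 = card (verts H) + 4" using leaf_count by linarith
  then have "real (card (V2 H) * 2) = real (card (verts H) + 4)" by (rule arg_cong)
  then show ?thesis by simp
qed

lemma obtain_leaf: obtains l where "l \<in> leaves T"
proof -
  have "card (leaves T) \<noteq> 0" using leaf_count card_T by linarith
  then show ?thesis using that by (metis card.empty ex_in_conv)
qed

lemma connected: "connected_graph H"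
  unfolding connected_graph_iff[OF multH]
proof (intro conjI allI impI)
  show "verts H \<noteq> {}" using card_T vH by auto
next
  fix Z assume Z: "Z \<inter> verts H \<noteq> {}" "\<forall>e\<in>edges H. ends H e \<inter> Z \<noteq> {} \<longrightarrow> ends H e \<subseteq> Z"
  have cT: "verts T \<subseteq> Z" if "Z \<inter> verts T \<noteq> {}"
  proof (rule grown_closed[OF grownT that])
    fix e assume "e \<in> edges T" "ends T e \<inter> Z \<noteq> {}"
    then show "ends T e \<subseteq> Z" using Z(2) endsT eH by auto
  qed
  have cT': "verts T' \<subseteq> Z" if "Z \<inter> verts T' \<noteq> {}"
  proof -
    let ?Y = "{v \<in> verts T. f v \<in> Z}"
    have "verts T \<subseteq> ?Y"
    proof (rule grown_closed[OF grownT])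
      show "?Y \<inter> verts T \<noteq> {}" using that f(2) by auto
      fix e assume e: "e \<in> edges T" "ends T e \<inter> ?Y \<noteq> {}"
      then have "ends H (g e) \<inter> Z \<noteq> {}" using ends_g by auto
      then have "ends H (g e) \<subseteq> Z" using Z(2) e(1) eH g(2) by blast
      then show "ends T e \<subseteq> ?Y" using ends_g[OF e(1)] ends_sub[OF e(1)] by auto
    qed
    then show ?thesis using f(2) by auto
  qed
  obtain l where l: "l \<in> leaves T" by (rule obtain_leaf)
  then have lW: "l \<in> verts T" "f l \<in> verts T'" using leaf_sub f(2) by blast+
  have e: "ends H (m l) = {l, f l}" "m l \<in> edges H" using l endsM eH by auto
  have "l \<in> Z \<or> f l \<in> Z" using Z(1) cT cT' lW unfolding vH by blast
  then have "ends H (m l) \<subseteq> Z" using Z(2) e by auto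
  then have "l \<in> Z" "f l \<in> Z" using e by auto
  then show "verts H \<subseteq> Z" using cT cT' lW unfolding vH by blast
qed

lemma bipartite: "bipartite H"
proof -
  obtain c :: "'v \<Rightarrow> bool" where c: "\<forall>e\<in>edges T. \<exists>x y. ends T e = {x, y} \<and> c x \<and> \<not> c y"
    using grown_coloring[OF grownT] by blast
  \<comment> \<open>The copy carries the opposite colours, because the matching edges join a vertex
    to its own copy.\<close>
  define A where "A = {v \<in> verts T. c v} \<union> f ` {v \<in> verts T. \<not> c v}"
  define B where "B = {v \<in> verts T. \<not> c v} \<union> f ` {v \<in> verts T. c v}"
  have "A \<union> B = verts H" unfolding A_def B_def vH f(2) by auto
  moreover have "A \<inter> B = {}"
  proof -
    have "f u \<noteq> f v" if "u \<in> verts T" "v \<in> verts T" "c u" "\<not> c v" for u v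
      using that f(1) by (auto dest: inj_onD)
    moreover have "f u \<noteq> v" if "u \<in> verts T" "v \<in> verts T" for u v using that fV by blast
    ultimately show ?thesis unfolding A_def B_def by fastforce
  qed
  moreover have "\<exists>a\<in>A. \<exists>b\<in>B. ends H e = {a, b}" if eE: "e \<in> edges H" for e
  proof -
    consider "e \<in> edges T" | d where "d \<in> edges T" "e = g d" | l where "l \<in> leaves T" "e = m l"
      using eE by (rule edge_cases)
    then show ?thesis
    proof cases
      case 1
      then obtain x y where xy: "ends T e = {x, y}" "c x" "\<not> c y" using c by blast
      then have "x \<in> verts T" "y \<in> verts T" using ends_sub[OF 1] by auto
      then have "x \<in> A" "y \<in> B" using xy unfolding A_def B_def by blast+
      then show ?thesis using xy(1) 1 endsT by auto
    next
      case 2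
      then obtain x y where xy: "ends T d = {x, y}" "c x" "\<not> c y" using c by blast
      then have "x \<in> verts T" "y \<in> verts T" using ends_sub[OF 2(1)] by auto
      then have "f y \<in> A" "f x \<in> B" using xy unfolding A_def B_def by blast+
      moreover have "ends H e = {f y, f x}" using xy(1) 2 ends_g by auto
      ultimately show ?thesis by blast
    next
      case 3
      then have l: "l \<in> verts T" and e: "ends H e = {l, f l}" using leaf_sub endsM by blast+
      show ?thesis
      proof (cases "c l")
        case True
        then have "l \<in> A" "f l \<in> B" using l unfolding A_def B_def by blast+
        then show ?thesis using e by blast
      next
        case False
        then have "f l \<in> A" "l \<in> B" using l unfolding A_def B_def by blast+
        then show ?thesis using e by (metis insert_commute)
      qed
    qed
  qed
  then have "\<forall>e\<in>edges H. \<exists>a\<in>A. \<exists>b\<in>B. ends H e = {a, b}" by (rule ballI)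
  ultimately show ?thesis unfolding bipartite_def by (intro exI[of _ A] exI[of _ B] conjI)
qed

text \<open>The same partial matching is used in both copies, so a leaf and its copy are uncovered
  together and can be joined by their matching edge.\<close>

lemma matching_extends:
  assumes N: "N \<subseteq> edges T" "partial_matching (ends T) N"
    and cov: "\<And>v. v \<in> verts T \<Longrightarrow> v \<notin> leaves T \<Longrightarrow> covers (ends T) N v"
  shows "perfect_matching H (N \<union> g ` N \<union> m ` {l \<in> leaves T. \<not> covers (ends T) N l})"
proof -
  define M where "M = N \<union> g ` N \<union> m ` {l \<in> leaves T. \<not> covers (ends T) N l}"
  have MI: "e \<in> N \<Longrightarrow> e \<in> M" "e \<in> N \<Longrightarrow> g e \<in> M"
    "l \<in> leaves T \<Longrightarrow> \<not> covers (ends T) N l \<Longrightarrow> m l \<in> M" for e l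
    unfolding M_def by blast+
  have MH: "M \<subseteq> edges H" using N(1) eH g(2) unfolding M_def by blast
  have inD: "e \<in> N" if "e \<in> M" "e \<in> edges T" for e
    using that disjE disjM N(1) g(2) unfolding M_def by blast
  have ing: "e \<in> N" if "g e \<in> M" "e \<in> edges T" for e
  proof -
    have "g e \<in> edges T'" using that(2) g(2) by blast
    then have "g e \<in> g ` N" using that(1) disjE disjM N(1) unfolding M_def by blast
    then show ?thesis using that(2) g(1) N(1) by (simp add: inj_on_image_mem_iff)
  qed
  have inm: "\<not> covers (ends T) N l" if "m l \<in> M" "l \<in> leaves T" for l
  proof -
    have "m l \<notin> edges T \<union> edges T'" using that(2) disjM by blast
    then have "m l \<in> m ` {l \<in> leaves T. \<not> covers (ends T) N l}" using that(1) N(1) g(2) unfolding M_def by blast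
    then show ?thesis using that(2) inj_m by (auto dest: inj_onD)
  qed
  have uniq: "e = e'" if "e \<in> N" "e' \<in> N" "v \<in> ends T e" "v \<in> ends T e'" for e e' v
    using N(2) that unfolding partial_matching_def by blast
  have 1: "\<exists>!e. e \<in> M \<and> v \<in> ends H e" if v: "v \<in> verts T" for v
  proof -
    have cases: "e \<in> N \<and> v \<in> ends T e \<or> e = m v \<and> v \<in> leaves T \<and> \<not> covers (ends T) N v"
      if e: "e \<in> M" "v \<in> ends H e" for e
    proof -
      have "e \<in> {e \<in> edges H. v \<in> ends H e}" using e MH by blast
      then have "e \<in> edges T \<and> v \<in> ends T e \<or> v \<in> leaves T \<and> e = m v"
        unfolding incident[OF v] by (simp split: if_splits)
      then show ?thesis using inD[OF e(1)] inm[of v] e(1) by metis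
    qed
    show ?thesis
    proof (cases "covers (ends T) N v")
      case True
      then obtain e where e: "e \<in> N" "v \<in> ends T e" unfolding covers_def by blast
      have "v \<in> ends H e" using e N(1) endsT by auto
      moreover have "e' = e" if "e' \<in> M \<and> v \<in> ends H e'" for e'
        using cases[of e'] that uniq e True by metis
      ultimately show ?thesis using MI(1)[OF e(1)] by (intro ex1I[of _ e] conjI)
    next
      case False
      then have l: "v \<in> leaves T" using cov v by blast
      have "v \<in> ends H (m v)" using l endsM by simp
      moreover have "e = m v" if "e \<in> M \<and> v \<in> ends H e" for e
        using cases[of e] that False unfolding covers_def by metis
      ultimately show ?thesis using MI(3)[OF l False] by (intro ex1I[of _ "m v"] conjI)
    qed
  qed
  have 2: "\<exists>!e. e \<in> M \<and> f v \<in> ends H e" if v: "v \<in> verts T" for v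
  proof -
    have cases: "(\<exists>d\<in>N. e = g d \<and> v \<in> ends T d) \<or> e = m v \<and> v \<in> leaves T \<and> \<not> covers (ends T) N v"
      if e: "e \<in> M" "f v \<in> ends H e" for e
    proof -
      have "e \<in> {e \<in> edges H. f v \<in> ends H e}" using e MH by blast
      then have "(\<exists>d\<in>edges T. e = g d \<and> v \<in> ends T d) \<or> v \<in> leaves T \<and> e = m v"
        unfolding incident'[OF v] by (simp split: if_splits) blast+
      then show ?thesis using ing inm[of v] e(1) by metis
    qed
    show ?thesis
    proof (cases "covers (ends T) N v")
      case True
      then obtain e where e: "e \<in> N" "v \<in> ends T e" unfolding covers_def by blast
      have "f v \<in> ends H (g e)" using e N(1) ends_g by auto
      moreover have "e' = g e" if "e' \<in> M \<and> f v \<in> ends H e'" for e'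
        using cases[of e'] that uniq e True by metis
      ultimately show ?thesis using MI(2)[OF e(1)] by (intro ex1I[of _ "g e"] conjI)
    next
      case False
      then have l: "v \<in> leaves T" using cov v by blast
      have "f v \<in> ends H (m v)" using l endsM by simp
      moreover have "e = m v" if "e \<in> M \<and> f v \<in> ends H e" for e
        using cases[of e] that False unfolding covers_def by metis
      ultimately show ?thesis using MI(3)[OF l False] by (intro ex1I[of _ "m v"] conjI)
    qed
  qed
  have "\<exists>!e. e \<in> M \<and> v \<in> ends H e" if v: "v \<in> verts H" for v
  proof (cases "v \<in> verts T")
    case True
    then show ?thesis by (rule 1)
  next
    case False
    then obtain u where "u \<in> verts T" "v = f u" using v vH f(2) by blast
    then show ?thesis using 2 by simp
  qed
  then show ?thesis using MH unfolding perfect_matching_def M_def by simp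
qed

lemma matching_covered: "matching_covered H"
proof -
  note gm = grown_matchings[OF grownT]
  have two: "2 \<le> card {e \<in> edges T. u \<in> ends T e}" if "u \<in> verts T" "u \<notin> leaves T" for u
  proof -
    have "degree T u = 3" using degT[OF that(1)] that(2) by simp
    then show ?thesis unfolding deg_eq by linarith
  qed
  have tree_edge: "\<exists>M. perfect_matching H M \<and> d \<in> M \<and> g d \<in> M" if d: "d \<in> edges T" for d
  proof -
    obtain N where N: "N \<subseteq> edges T" "partial_matching (ends T) N" "d \<in> N"
      "\<forall>u\<in>verts T. 2 \<le> card {e \<in> edges T. u \<in> ends T e} \<longrightarrow> covers (ends T) N u"
      using bspec[OF conjunct2[OF gm] d] by blast
    have "covers (ends T) N u" if "u \<in> verts T" "u \<notin> leaves T" for u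
      using N(4) two[OF that] that(1) by blast
    then have "perfect_matching H (N \<union> g ` N \<union> m ` {l \<in> leaves T. \<not> covers (ends T) N l})"
      using N(1,2) by (intro matching_extends)
    then show ?thesis using N(3) by blast
  qed
  have "\<exists>M. perfect_matching H M \<and> e \<in> M" if eE: "e \<in> edges H" for e
  proof -
    consider "e \<in> edges T" | d where "d \<in> edges T" "e = g d" | l where "l \<in> leaves T" "e = m l"
      using eE by (rule edge_cases)
    then show ?thesis
    proof cases
      case 3
      then have lT: "l \<in> verts T" using leaf_sub by blast
      obtain N where N: "N \<subseteq> edges T" "partial_matching (ends T) N" "\<not> covers (ends T) N l"
        "\<forall>u\<in>verts T. u \<noteq> l \<longrightarrow> 2 \<le> card {e \<in> edges T. u \<in> ends T e} \<longrightarrow> covers (ends T) N u"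
        using bspec[OF conjunct1[OF gm] lT] by blast
      have "covers (ends T) N u" if "u \<in> verts T" "u \<notin> leaves T" for u
        using N(4) two[OF that] that 3(1) by metis
      then have "perfect_matching H (N \<union> g ` N \<union> m ` {l \<in> leaves T. \<not> covers (ends T) N l})"
        using N(1,2) by (intro matching_extends)
      then show ?thesis using N(3) 3 by blast
    qed (use tree_edge in blast)+
  qed
  moreover have "card (verts H) = 2 * card (verts T)"
    unfolding vH using disjV f finT by (simp add: card_Un_disjoint card_image)
  then have "4 \<le> card (verts H)" using card_T by linarith
  ultimately show ?thesis unfolding matching_covered_def using multH connected by blast
qed

text \<open>S consists of one side of the tree edge together with its copy, so no matching edge
  crosses it and |S| is even. If p is deleted, q is the only crossing edge left, and a perfect
  matching through q would make |S| odd.\<close>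

lemma tree_edge_essential:
  assumes d: "d \<in> edges T" and pq: "(p = d \<and> q = g d) \<or> (p = g d \<and> q = d)"
  shows "\<not> matching_covered (delete_edge H p)"
proof
  assume mc: "matching_covered (delete_edge H p)"
  obtain Z where Z: "Z \<subseteq> verts T" "card (ends T d \<inter> Z) = 1"
    "\<forall>e\<in>edges T - {d}. ends T e \<subseteq> Z \<or> ends T e \<inter> Z = {}"
    using grown_split[OF grownT d] by blast
  let ?S = "Z \<union> f ` Z"
  have "g d \<in> edges T'" using d g(2) by simp
  then have "g d \<noteq> d" "g d \<in> edges H" "d \<in> edges H" using d disjE eH by auto
  then have "q \<noteq> p" "q \<in> edges H" using pq by auto
  then have "q \<in> edges (delete_edge H p)" by (simp add: delete_edge_def)
  then obtain M where M: "perfect_matching (delete_edge H p) M" "q \<in> M"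
    using mc unfolding matching_covered_def by blast
  have T_S: "ends T e \<inter> ?S = ends T e \<inter> Z" if "e \<in> edges T" for e
    using ends_sub[OF that] fV Z(1) by blast
  have T'_S: "f ` ends T e \<inter> ?S = f ` (ends T e \<inter> Z)" if "e \<in> edges T" for e
  proof -
    have "f ` ends T e \<inter> f ` Z = f ` (ends T e \<inter> Z)"
      using ends_sub[OF that] Z(1) f(1) by (metis inj_on_image_Int)
    moreover have "f ` ends T e \<inter> Z = {}" using ends_sub[OF that] fV Z(1) by blast
    ultimately show ?thesis by blast
  qed
  have "card (f ` (ends T d \<inter> Z)) = card (ends T d \<inter> Z)"
    using f(1) ends_sub[OF d] by (intro card_image) (auto intro: inj_on_subset)
  then have "card (ends H q \<inter> ?S) = 1"
    using pq T_S[OF d] T'_S[OF d] ends_g[OF d] endsT d Z(2) by auto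
  then have c1: "card (ends (delete_edge H p) q \<inter> ?S) = 1" by (simp add: delete_edge_def)
  have "ends H e \<subseteq> ?S \<or> ends H e \<inter> ?S = {}" if e: "e \<in> edges H" "e \<noteq> p" "e \<noteq> q" for e
  proof -
    consider "e \<in> edges T" | c where "c \<in> edges T" "e = g c" | l where "l \<in> leaves T" "e = m l"
      using e(1) by (rule edge_cases)
    then show ?thesis
    proof cases
      case 1
      then have "ends T e \<subseteq> Z \<or> ends T e \<inter> Z = {}" using Z(3) e pq by blast
      then show ?thesis using T_S[OF 1] endsT 1 by auto
    next
      case 2
      then have "ends T c \<subseteq> Z \<or> ends T c \<inter> Z = {}" using Z(3) e pq by blast
      then show ?thesis using T'_S[OF 2(1)] ends_g[OF 2(1)] 2 by auto
    next
      case 3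
      then have l: "l \<in> verts T" "ends H e = {l, f l}" using leaf_sub endsM by blast+
      have "f l \<in> f ` Z \<longleftrightarrow> l \<in> Z" using l f(1) Z(1) by (simp add: inj_on_image_mem_iff)
      moreover have "l \<notin> f ` Z" "f l \<notin> Z" using l fV Z(1) by blast+
      ultimately show ?thesis using l(2) by auto
    qed
  qed
  then have others: "\<And>e. e \<in> edges (delete_edge H p) \<Longrightarrow> e \<noteq> q \<Longrightarrow>
      ends (delete_edge H p) e \<subseteq> ?S \<or> ends (delete_edge H p) e \<inter> ?S = {}"
    by (simp add: delete_edge_def)
  have "?S \<subseteq> verts (delete_edge H p)" using Z(1) vH f(2) by (auto simp: delete_edge_def)
  then have "odd (card ?S)"
    using perfect_matching_odd_cut[OF _ M(1) _ M(2) c1 others] mc unfolding matching_covered_def by blast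
  moreover have "card ?S = 2 * card Z"
  proof -
    have "finite Z" using Z(1) finT finite_subset by blast
    moreover have "card (f ` Z) = card Z" using f(1) Z(1) by (intro card_image) (auto intro: inj_on_subset)
    moreover have "Z \<inter> f ` Z = {}" using Z(1) fV by blast
    ultimately show ?thesis by (simp add: card_Un_disjoint)
  qed
  ultimately show False by simp
qed

text \<open>Without its matching edge the leaf l has a single edge d, to x say. Every perfect
  matching then uses d, so any other edge at x lies in none; such an edge is the matching edge of x
  if x is a leaf, or a further tree edge.\<close>

lemma leaf_edge_essential:
  assumes l: "l \<in> leaves T"
  shows "\<not> matching_covered (delete_edge H (m l))"
proof
  let ?G = "delete_edge H (m l)"
  assume mc: "matching_covered ?G"
  have lT: "l \<in> verts T" using l leaf_sub by blast
  have "card {e \<in> edges T. l \<in> ends T e} = 1" using degT[OF lT] l by (simp add: deg_eq)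
  then obtain d where d: "{e \<in> edges T. l \<in> ends T e} = {d}" by (metis card_1_singletonE)
  then have dT: "d \<in> edges T" "l \<in> ends T d" by blast+
  obtain x where x: "ends T d = {l, x}" "x \<noteq> l"
    using multT dT unfolding multigraph_def by (metis card_2_iff doubleton_eq_iff insertE singletonD)
  have xT: "x \<in> verts T" using ends_sub[OF dT(1)] x by blast
  have only: "e = d" if "e \<in> edges ?G" "l \<in> ends ?G e" for e
  proof -
    have "e \<in> {e \<in> edges H. l \<in> ends H e}" "e \<noteq> m l" using that by (auto simp: delete_edge_def)
    then show ?thesis unfolding incident[OF lT] using d l by auto
  qed
  obtain e where e: "e \<in> edges ?G" "x \<in> ends ?G e" "e \<noteq> d"
  proof (cases "x \<in> leaves T")
    case True
    then have "m x \<noteq> m l" using l x(2) inj_m by (auto dest: inj_onD)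
    moreover have "m x \<in> edges H" "x \<in> ends H (m x)" "m x \<noteq> d" using True eH endsM dT disjM by auto
    ultimately show ?thesis using that[of "m x"] by (simp add: delete_edge_def)
  next
    case False
    then have "card {e \<in> edges T. x \<in> ends T e} = 3" using degT[OF xT] by (simp add: deg_eq)
    then have "\<not> {e \<in> edges T. x \<in> ends T e} \<subseteq> {d}"
      using card_mono[of "{d}" "{e \<in> edges T. x \<in> ends T e}"] by auto
    then obtain e where "e \<in> edges T" "x \<in> ends T e" "e \<noteq> d" by blast
    moreover have "e \<noteq> m l" using \<open>e \<in> edges T\<close> disjM l by blast
    ultimately show ?thesis using that[of e] eH endsT by (simp add: delete_edge_def)
  qed
  then obtain M where M: "perfect_matching ?G M" "e \<in> M" using mc unfolding matching_covered_def by blast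
  have lx: "l \<in> verts ?G" "x \<in> verts ?G" using lT xT vH by (auto simp: delete_edge_def)
  then obtain c where c: "c \<in> M" "l \<in> ends ?G c" using M(1) unfolding perfect_matching_def by blast
  have "c \<in> edges ?G" using c M(1) unfolding perfect_matching_def by blast
  then have "c = d" using only c by blast
  have "x \<in> ends ?G d" using x dT endsT by (simp add: delete_edge_def)
  then have "d = e" using M c(1) \<open>c = d\<close> e(2) lx(2) unfolding perfect_matching_def by blast
  then show False using e(3) by simp
qed

lemma two_vertex_n_extremal: "two_vertex_n_extremal H"
proof -
  have "\<not> matching_covered (delete_edge H e)" if eE: "e \<in> edges H" for e
    using eE
  proof (cases rule: edge_cases)
    case 1
    then show ?thesis using tree_edge_essential[OF 1, of e "g e"] by simp
  next
    case (2 d)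
    then show ?thesis using tree_edge_essential[OF 2(1), of "g d" d] 2(2) by simp
  next
    case (3 l)
    then show ?thesis using leaf_edge_essential[OF 3(1)] 3(2) by simp
  qed
  then show ?thesis
    unfolding two_vertex_n_extremal_def minimal_matching_covered_def
    using matching_covered bipartite V2_count by blast
qed

end

section \<open>Hall's theorem and the passage from multigraphs to relations\<close>

text \<open>The classical induction: if some nonempty proper X has exactly |X| neighbours, X and its
  complement are matched separately. Otherwise every such set has a neighbour to spare, and an
  arbitrary edge may be fixed first.\<close>

lemma hall_matching:
  fixes E :: "('a \<times> 'b) set"
  assumes "finite A" "finite E" "\<And>X. X \<subseteq> A \<Longrightarrow> card X \<le> card (E `` X)"
  shows "\<exists>\<mu>. inj_on \<mu> A \<and> (\<forall>a\<in>A. (a, \<mu> a) \<in> E)"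
  using assms
proof (induction "card A" arbitrary: A E rule: less_induct)
  case less
  note finA = less.prems(1) and finE = less.prems(2) and hall = less.prems(3)
  have fin: "finite (E `` X)" for X using finE by (rule finite_Image)
  show ?case
  proof (cases "A = {}")
    case True
    then show ?thesis by simp
  next
    case ne: False
    show ?thesis
    proof (cases "\<exists>X. X \<subset> A \<and> X \<noteq> {} \<and> card (E `` X) = card X")
      case True
      then obtain X where X: "X \<subset> A" "X \<noteq> {}" "card (E `` X) = card X" by blast
      have finX: "finite X" using X(1) finA finite_subset by blast
      have "card X < card A" using X(1) finA by (simp add: psubset_card_mono)
      moreover have "card S \<le> card (E `` S)" if "S \<subseteq> X" for S using hall[of S] that X(1) by blast
      ultimately obtain \<mu> where \<mu>: "inj_on \<mu> X" "\<forall>a\<in>X. (a, \<mu> a) \<in> E"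
        using less.hyps[of X E] finX finE by blast
      let ?E = "E \<inter> UNIV \<times> (- (E `` X))"
      have "card (A - X) < card A" using X(1,2) finA by (intro psubset_card_mono) blast+
      moreover have "card S \<le> card (?E `` S)" if S: "S \<subseteq> A - X" for S
      proof -
        have finS: "finite S" using S finA finite_subset by blast
        have "card (S \<union> X) \<le> card (E `` (S \<union> X))" using S X(1) by (intro hall) blast
        also have "E `` (S \<union> X) = ?E `` S \<union> E `` X" by blast
        also have "card \<dots> \<le> card (?E `` S) + card (E `` X)" by (rule card_Un_le)
        finally have "card (S \<union> X) \<le> card (?E `` S) + card X" using X(3) by simp
        moreover have "card (S \<union> X) = card S + card X" using finS finX S by (intro card_Un_disjoint) blast+
        ultimately show ?thesis by simp
      qed
      ultimately obtain \<nu> where \<nu>: "inj_on \<nu> (A - X)" "\<forall>a\<in>A - X. (a, \<nu> a) \<in> ?E"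
        using less.hyps[of "A - X" ?E] finA finE by blast
      let ?m = "\<lambda>a. if a \<in> X then \<mu> a else \<nu> a"
      have "inj_on ?m A"
      proof (rule inj_onI)
        fix x y assume xy: "x \<in> A" "y \<in> A" "?m x = ?m y"
        have 1: "\<mu> z \<in> E `` X" if "z \<in> X" for z using \<mu>(2) that by blast
        have 2: "\<nu> z \<notin> E `` X" if "z \<in> A - X" for z using \<nu>(2) that by blast
        consider "x \<in> X" "y \<in> X" | "x \<in> A - X" "y \<in> A - X" | "x \<in> X" "y \<in> A - X" | "x \<in> A - X" "y \<in> X"
          using xy by blast
        then show "x = y"
        proof cases
          case 1
          then show ?thesis using xy(3) \<mu>(1) by (simp add: inj_on_eq_iff)
        next
          case 2
          then show ?thesis using xy(3) \<nu>(1) by (simp add: inj_on_eq_iff)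
        next
          case 3
          then show ?thesis using xy(3) 1[of x] 2[of y] by simp
        next
          case 4
          then show ?thesis using xy(3) 1[of y] 2[of x] by simp
        qed
      qed
      moreover have "\<forall>a\<in>A. (a, ?m a) \<in> E" using \<mu>(2) \<nu>(2) by auto
      ultimately show ?thesis by blast
    next
      case False
      obtain a where a: "a \<in> A" using ne by blast
      have "card {a} \<le> card (E `` {a})" using a by (intro hall) blast
      then have "E `` {a} \<noteq> {}" by auto
      then obtain b where b: "(a, b) \<in> E" by blast
      let ?E = "E \<inter> UNIV \<times> (- {b})"
      have "card (A - {a}) < card A" using a finA by (intro psubset_card_mono) blast+
      moreover have "card S \<le> card (?E `` S)" if S: "S \<subseteq> A - {a}" for S
      proof (cases "S = {}")
        case False
        have "card S \<le> card (E `` S)" using S by (intro hall) blast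
        moreover have "S \<subset> A" using S a by blast
        then have "card (E `` S) \<noteq> card S" using False \<open>\<nexists>X. X \<subset> A \<and> X \<noteq> {} \<and> card (E `` X) = card X\<close> by blast
        moreover have "?E `` S = E `` S - {b}" by blast
        then have "card (E `` S) \<le> Suc (card (?E `` S))"
          using card_Suc_Diff1[of "E `` S" b] fin[of S] by (cases "b \<in> E `` S") auto
        ultimately show ?thesis by linarith
      qed simp
      ultimately obtain \<nu> where \<nu>: "inj_on \<nu> (A - {a})" "\<forall>x\<in>A - {a}. (x, \<nu> x) \<in> ?E"
        using less.hyps[of "A - {a}" ?E] finA finE by blast
      let ?m = "\<nu>(a := b)"
      have "inj_on ?m (insert a (A - {a}))" unfolding inj_on_insert
      proof
        have "inj_on ?m (A - {a}) = inj_on \<nu> (A - {a})" by (intro inj_on_cong) simp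
        then show "inj_on ?m (A - {a})" using \<nu>(1) by simp
        show "?m a \<notin> ?m ` (A - {a} - {a})" using \<nu>(2) by auto
      qed
      then have "inj_on ?m A" using a by (simp add: insert_absorb)
      moreover have "\<forall>x\<in>A. (x, ?m x) \<in> E" using \<nu>(2) b by auto
      ultimately show ?thesis by blast
    qed
  qed
qed

text \<open>Of two parallel edges, one can be deleted: in any perfect matching it may be exchanged
  for its twin, and connectedness is not affected.\<close>

lemma minimal_no_parallel:
  assumes H: "minimal_matching_covered H"
  shows "inj_on (ends H) (edges H)"
proof (rule inj_onI, rule ccontr)
  fix p q assume pq: "p \<in> edges H" "q \<in> edges H" "ends H p = ends H q" "p \<noteq> q"
  let ?G = "delete_edge H p"
  have mc: "matching_covered H" using H unfolding minimal_matching_covered_def by blast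
  then have mH: "multigraph H" unfolding matching_covered_def by blast
  have G: "verts ?G = verts H" "edges ?G = edges H - {p}" "ends ?G = ends H" by (simp_all add: delete_edge_def)
  have mG: "multigraph ?G" using mH unfolding multigraph_def G by auto
  have "connected_graph ?G"
    unfolding connected_graph_iff[OF mG] G
  proof (intro conjI allI impI)
    show "verts H \<noteq> {}" using mc unfolding matching_covered_def by auto
    fix Z assume Z: "Z \<inter> verts H \<noteq> {}" "\<forall>e\<in>edges H - {p}. ends H e \<inter> Z \<noteq> {} \<longrightarrow> ends H e \<subseteq> Z"
    have "\<forall>e\<in>edges H. ends H e \<inter> Z \<noteq> {} \<longrightarrow> ends H e \<subseteq> Z"
    proof (intro ballI impI)
      fix e assume e: "e \<in> edges H" "ends H e \<inter> Z \<noteq> {}"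
      show "ends H e \<subseteq> Z"
      proof (cases "e = p")
        case True
        then show ?thesis using Z(2) pq e(2) by auto
      next
        case False
        then show ?thesis using Z(2) e by blast
      qed
    qed
    moreover have "connected_graph H" using mc unfolding matching_covered_def by blast
    ultimately show "verts H \<subseteq> Z" using Z(1) unfolding connected_graph_iff[OF mH] by blast
  qed
  moreover have "\<exists>M. perfect_matching ?G M \<and> e \<in> M" if e: "e \<in> edges H" "e \<noteq> p" for e
  proof -
    obtain M where M: "perfect_matching H M" "e \<in> M" using mc e unfolding matching_covered_def by blast
    then have ME: "M \<subseteq> edges H" and u: "\<And>v. v \<in> verts H \<Longrightarrow> \<exists>!e. e \<in> M \<and> v \<in> ends H e"
      unfolding perfect_matching_def by blast+
    show ?thesis
    proof (cases "p \<in> M")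
      case False
      then have "perfect_matching ?G M" using ME u unfolding perfect_matching_def G by blast
      then show ?thesis using M(2) by blast
    next
      case True
      let ?M = "insert q (M - {p})"
      have "\<exists>!e. e \<in> ?M \<and> v \<in> ends H e" if v: "v \<in> verts H" for v
      proof -
        obtain c where c: "c \<in> M" "v \<in> ends H c" "\<And>c'. c' \<in> M \<Longrightarrow> v \<in> ends H c' \<Longrightarrow> c' = c"
          using u[OF v] by (elim ex1E) blast
        show ?thesis
        proof (cases "c = p")
          case True
          have "e = q" if "e \<in> ?M \<and> v \<in> ends H e" for e using that c(3)[of e] True by auto
          moreover have "q \<in> ?M \<and> v \<in> ends H q" using c(2) True pq(3) by simp
          ultimately show ?thesis by (intro ex1I[of _ q])
        next
          case False
          have "v \<notin> ends H q" using c(3)[OF \<open>p \<in> M\<close>] False pq(3) by auto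
          then have "e = c" if "e \<in> ?M \<and> v \<in> ends H e" for e using that c(3)[of e] by auto
          moreover have "c \<in> ?M \<and> v \<in> ends H c" using c(1,2) False by simp
          ultimately show ?thesis by (intro ex1I[of _ c])
        qed
      qed
      moreover have "?M \<subseteq> edges H - {p}" using ME pq by blast
      ultimately have "perfect_matching ?G ?M" unfolding perfect_matching_def G by blast
      moreover have "e \<in> ?M" using M(2) e(2) by blast
      ultimately show ?thesis by blast
    qed
  qed
  ultimately have "matching_covered ?G"
    using mG mc unfolding matching_covered_def G by auto
  then show False using H pq(1) unfolding minimal_matching_covered_def by blast
qed

section \<open>Matching covered bipartite multigraphs as elementary relations\<close>

locale bipartite_graph =
  fixes H :: "('v, 'e) mgraph" and A B :: "'v set"
  assumes multH: "multigraph H" and V: "verts H = A \<union> B" and disj: "A \<inter> B = {}"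
    and bip: "\<And>e. e \<in> edges H \<Longrightarrow> \<exists>a\<in>A. \<exists>b\<in>B. ends H e = {a, b}"
begin

text \<open>Edge names and multiplicities are forgotten. For minimal graphs nothing is lost, by
  \<open>minimal_no_parallel\<close>; for the equivalence with \<open>elementary\<close>
  multiplicities do not matter.\<close>

definition rel where "rel = {(a, b). a \<in> A \<and> b \<in> B \<and> (\<exists>e\<in>edges H. ends H e = {a, b})}"

lemma rel_iff: "(a, b) \<in> rel \<longleftrightarrow> a \<in> A \<and> b \<in> B \<and> (\<exists>e\<in>edges H. ends H e = {a, b})"
  by (simp add: rel_def)

lemma rel_sub: "rel \<subseteq> A \<times> B"
  unfolding rel_def by blast

lemma finAB: "finite A" "finite B"
  using multH V unfolding multigraph_def by simp_all

lemma fin_rel: "finite rel"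
  using finite_subset[OF rel_sub] finAB by simp

lemma closed_connected:
  assumes "connected_graph H" "Z \<inter> (A \<union> B) \<noteq> {}" "\<And>a b. (a, b) \<in> rel \<Longrightarrow> a \<in> Z \<longleftrightarrow> b \<in> Z"
  shows "A \<union> B \<subseteq> Z"
proof -
  have "ends H e \<subseteq> Z" if e: "e \<in> edges H" "ends H e \<inter> Z \<noteq> {}" for e
  proof -
    obtain a b where ab: "a \<in> A" "b \<in> B" "ends H e = {a, b}" using bip e(1) by blast
    then have "(a, b) \<in> rel" using e(1) rel_iff by blast
    then have "a \<in> Z \<longleftrightarrow> b \<in> Z" by (rule assms(3))
    then show ?thesis using ab(3) e(2) by auto
  qed
  then show ?thesis using assms(1,2) unfolding connected_graph_iff[OF multH] V by blast
qed

lemma matching_function: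
  assumes M: "perfect_matching H M"
  obtains \<mu> where "bij_betw \<mu> A B" "\<forall>a\<in>A. (a, \<mu> a) \<in> rel"
    "\<forall>e\<in>M. \<forall>a\<in>A. \<forall>b\<in>B. ends H e = {a, b} \<longrightarrow> b = \<mu> a"
proof -
  have ME: "M \<subseteq> edges H" and u: "\<And>v. v \<in> verts H \<Longrightarrow> \<exists>!e. e \<in> M \<and> v \<in> ends H e"
    using M unfolding perfect_matching_def by blast+
  have un: "e = e'" if "e \<in> M" "e' \<in> M" "v \<in> ends H e" "v \<in> ends H e'" for e e' v
  proof -
    have "v \<in> verts H" using that(1,3) ME multH unfolding multigraph_def by blast
    from u[OF this] show ?thesis using that by (elim ex1E) metis
  qed
  have ex: "\<exists>b e. e \<in> M \<and> b \<in> B \<and> ends H e = {a, b}" if a: "a \<in> A" for a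
  proof -
    have "a \<in> verts H" using a V by blast
    from u[OF this] obtain e where e: "e \<in> M" "a \<in> ends H e" by (elim ex1E) blast
    then obtain x b where "x \<in> A" "b \<in> B" "ends H e = {x, b}" using bip ME by blast
    moreover from this have "x = a" using e(2) a disj by auto
    ultimately show ?thesis using e(1) by blast
  qed
  define \<mu> where "\<mu> a = (SOME b. \<exists>e. e \<in> M \<and> b \<in> B \<and> ends H e = {a, b})" for a
  have mu: "\<exists>e. e \<in> M \<and> \<mu> a \<in> B \<and> ends H e = {a, \<mu> a}" if "a \<in> A" for a
    unfolding \<mu>_def by (rule someI_ex[OF ex[OF that]])
  have same: "b = \<mu> a" if e: "e \<in> M" "a \<in> A" "b \<in> B" "ends H e = {a, b}" for e a b
  proof -
    obtain e' where e': "e' \<in> M" "\<mu> a \<in> B" "ends H e' = {a, \<mu> a}" using mu[OF e(2)] by blast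
    then have "e' = e" using un[of e' e a] e by simp
    then have "{a, b} = {a, \<mu> a}" using e e' by simp
    then show ?thesis by (auto simp: doubleton_eq_iff)
  qed
  have "inj_on \<mu> A"
  proof (rule inj_onI)
    fix x y assume xy: "x \<in> A" "y \<in> A" "\<mu> x = \<mu> y"
    obtain e where e: "e \<in> M" "\<mu> x \<in> B" "ends H e = {x, \<mu> x}" using mu[OF xy(1)] by blast
    obtain e' where e': "e' \<in> M" "ends H e' = {y, \<mu> y}" using mu[OF xy(2)] by blast
    have "e = e'" using un[of e e' "\<mu> x"] e e' xy(3) by simp
    then have "x \<in> {y, \<mu> y}" using e e' by auto
    then show "x = y" using xy e(2) disj by auto
  qed
  moreover have "\<mu> ` A = B"
  proof
    show "\<mu> ` A \<subseteq> B" using mu by blast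
    show "B \<subseteq> \<mu> ` A"
    proof
      fix b assume b: "b \<in> B"
      then have "b \<in> verts H" using V by blast
      from u[OF this] obtain e where e: "e \<in> M" "b \<in> ends H e" by (elim ex1E) blast
      then obtain a y where ay: "a \<in> A" "y \<in> B" "ends H e = {a, y}" using bip ME by blast
      moreover from this have "y = b" using e(2) b disj by auto
      ultimately show "b \<in> \<mu> ` A" using same[OF e(1)] by blast
    qed
  qed
  ultimately have bij: "bij_betw \<mu> A B" unfolding bij_betw_def by blast
  have "(a, \<mu> a) \<in> rel" if "a \<in> A" for a using mu[OF that] that ME unfolding rel_iff by blast
  then show ?thesis using that[of \<mu>] bij same by blast
qed

text \<open>If |N(X)| did not exceed |X|, every perfect matching would map X onto N(X). Since each
  edge lies in some perfect matching, no edge could reach N(X) from outside X, and X with N(X) would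
  be a union of components.\<close>

lemma elementary_if_covered:
  assumes mc: "matching_covered H"
  shows "elementary A B rel"
proof -
  have conn: "connected_graph H" and four: "4 \<le> card (verts H)"
    and cov: "\<And>e. e \<in> edges H \<Longrightarrow> \<exists>M. perfect_matching H M \<and> e \<in> M"
    using mc unfolding matching_covered_def by blast+
  have "rel \<noteq> {}"
  proof
    assume "rel = {}"
    have "A \<union> B \<noteq> {}" using four V by auto
    then obtain v where v: "v \<in> A \<union> B" by blast
    have "A \<union> B \<subseteq> {v}" by (rule closed_connected[OF conn]) (use v \<open>rel = {}\<close> in auto)
    then have "card (A \<union> B) \<le> card {v}" by (intro card_mono) auto
    then show False using four V by simp
  qed
  then obtain M where "perfect_matching H M" using cov unfolding rel_def by blast
  then obtain \<mu> where \<mu>: "bij_betw \<mu> A B" "\<forall>a\<in>A. (a, \<mu> a) \<in> rel"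
    using matching_function by metis
  have cAB: "card A = card B" using \<mu>(1) by (rule bij_betw_same_card)
  show ?thesis
  proof
    show "finite A" "finite B" by (rule finAB)+
    show "rel \<subseteq> A \<times> B" by (rule rel_sub)
    show "A \<inter> B = {}" by (rule disj)
    show "card A = card B" by (rule cAB)
    have "card (A \<union> B) = card A + card B" using finAB disj by (rule card_Un_disjoint)
    then show "2 \<le> card A" using four V cAB by simp
    fix X assume X: "X \<subset> A" "X \<noteq> {}"
    have finX: "finite X" and finN: "finite (rel `` X)"
      using X(1) finAB finite_subset finite_Image[OF fin_rel] by blast+
    have into: "card X \<le> card (rel `` X)" "card (rel `` X) \<le> card X \<Longrightarrow> rel `` X = \<nu> ` X"
      if \<nu>: "inj_on \<nu> A" "\<forall>a\<in>A. (a, \<nu> a) \<in> rel" for \<nu>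
    proof -
      have sub: "\<nu> ` X \<subseteq> rel `` X" using \<nu>(2) X(1) by blast
      have c: "card (\<nu> ` X) = card X" using \<nu>(1) X(1) by (intro card_image inj_on_subset[OF \<nu>(1)]) blast
      show "card X \<le> card (rel `` X)" using card_mono[OF finN sub] c by simp
      assume "card (rel `` X) \<le> card X"
      then show "rel `` X = \<nu> ` X" using card_seteq[OF finN sub] c by simp
    qed
    show "card X < card (rel `` X)"
    proof (rule ccontr)
      assume n: "\<not> card X < card (rel `` X)"
      let ?Z = "X \<union> rel `` X"
      have "A \<union> B \<subseteq> ?Z"
      proof (rule closed_connected[OF conn])
        show "?Z \<inter> (A \<union> B) \<noteq> {}" using X by blast
        fix a b assume ab: "(a, b) \<in> rel"
        have AB: "a \<in> A" "b \<in> B" using ab rel_sub by blast+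
        have nZ: "a \<notin> rel `` X" "b \<notin> X" using AB rel_sub X(1) disj by blast+
        have "a \<in> X" if b: "b \<in> rel `` X"
        proof -
          obtain e where e: "e \<in> edges H" "ends H e = {a, b}" using ab rel_iff by blast
          then obtain M where M: "perfect_matching H M" "e \<in> M" using cov by blast
          then obtain \<nu> where \<nu>: "bij_betw \<nu> A B" "\<forall>a\<in>A. (a, \<nu> a) \<in> rel"
            "\<forall>e\<in>M. \<forall>a\<in>A. \<forall>b\<in>B. ends H e = {a, b} \<longrightarrow> b = \<nu> a"
            using matching_function by metis
          have inj: "inj_on \<nu> A" using \<nu>(1) by (simp add: bij_betw_def)
          have "rel `` X = \<nu> ` X" using into(2)[OF inj \<nu>(2)] n by simp
          then obtain x where "x \<in> X" "b = \<nu> x" using b by blast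
          moreover have "b = \<nu> a" using \<nu>(3) M(2) AB e(2) by blast
          ultimately show ?thesis using inj AB(1) X(1) by (metis inj_onD psubset_imp_subset subsetD)
        qed
        moreover have "b \<in> rel `` X" if "a \<in> X" using that ab by blast
        ultimately show "a \<in> ?Z \<longleftrightarrow> b \<in> ?Z" using nZ by blast
      qed
      moreover obtain a where "a \<in> A" "a \<notin> X" using X(1) by blast
      ultimately have "a \<in> rel `` X" by blast
      then show False using \<open>a \<in> A\<close> rel_sub disj by blast
    qed
  qed
qed

text \<open>For an edge from a to b, the surplus of one survives as Hall's condition after removing
  a and b, so the edge extends to a perfect matching. A closed proper vertex set would have fewer
  vertices in each class than in the other.\<close>

lemma covered_if_elementary:
  assumes el: "elementary A B rel"
  shows "matching_covered H"
proof -
  interpret E: elementary A B rel by (rule el)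
  interpret S: elementary B A "rel\<inverse>" by (rule E.swap)
  have "connected_graph H"
    unfolding connected_graph_iff[OF multH]
  proof (intro conjI allI impI)
    show "verts H \<noteq> {}" using V E.two by auto
    fix Z assume Z: "Z \<inter> verts H \<noteq> {}" "\<forall>e\<in>edges H. ends H e \<inter> Z \<noteq> {} \<longrightarrow> ends H e \<subseteq> Z"
    have iff: "a \<in> Z \<longleftrightarrow> b \<in> Z" if ab: "(a, b) \<in> rel" for a b
    proof -
      obtain e where "e \<in> edges H" "ends H e = {a, b}" using ab rel_iff by blast
      then have "{a, b} \<inter> Z \<noteq> {} \<longrightarrow> {a, b} \<subseteq> Z" using Z(2) by auto
      then show ?thesis by blast
    qed
    let ?X = "A \<inter> Z" and ?Y = "B \<inter> Z"
    have XY: "rel `` ?X \<subseteq> ?Y" "rel\<inverse> `` ?Y \<subseteq> ?X" using iff rel_sub by blast+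
    have finX: "finite ?X" "finite ?Y" using finAB by simp_all
    have ne: "?X \<noteq> {} \<or> ?Y \<noteq> {}" using Z(1) V by blast
    have XA: "A \<subseteq> Z"
    proof (rule ccontr)
      assume "\<not> A \<subseteq> Z"
      then have XA: "?X \<subset> A" by blast
      have YB: "?Y \<subset> B"
      proof (rule ccontr)
        assume "\<not> ?Y \<subset> B"
        then have "?Y = B" by blast
        then have "rel\<inverse> `` ?Y = A" using S.full by simp
        then show False using XY(2) XA by blast
      qed
      have x: "?X \<noteq> {} \<Longrightarrow> card ?X < card ?Y"
        using E.hall[OF XA] card_mono[OF finX(2) XY(1)] by linarith
      have y: "?Y \<noteq> {} \<Longrightarrow> card ?Y < card ?X"
        using S.hall[OF YB] card_mono[OF finX(1) XY(2)] by linarith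
      show False
      proof (cases "?X = {}")
        case True
        then have "card ?Y < card ?X" using y ne by blast
        then show False using True by simp
      next
        case False
        then have "card ?X < card ?Y" by (rule x)
        moreover from this have "?Y \<noteq> {}" by auto
        ultimately show False using y by linarith
      qed
    qed
    have "B \<subseteq> Z"
    proof
      fix b assume "b \<in> B"
      then obtain a where "(a, b) \<in> rel" using E.full by blast
      moreover from this have "a \<in> Z" using XA rel_sub by blast
      ultimately show "b \<in> Z" using iff by blast
    qed
    then show "verts H \<subseteq> Z" using XA V by blast
  qed
  moreover have "4 \<le> card (verts H)"
    using E.two E.cardAB card_Un_disjoint[OF finAB disj] V by simp
  moreover have "\<exists>M. perfect_matching H M \<and> e \<in> M" if e: "e \<in> edges H" for e
  proof -
    obtain a b where ab: "a \<in> A" "b \<in> B" "ends H e = {a, b}" using bip e by blast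
    let ?R = "rel \<inter> UNIV \<times> (- {b})"
    have "card X \<le> card (?R `` X)" if X: "X \<subseteq> A - {a}" for X
    proof (cases "X = {}")
      case False
      have "card X < card (rel `` X)" using X ab(1) False by (intro E.hall) blast+
      moreover have "?R `` X = rel `` X - {b}" by blast
      then have "card (rel `` X) \<le> Suc (card (?R `` X))"
        using card_Suc_Diff1[of "rel `` X" b] by (cases "b \<in> rel `` X") auto
      ultimately show ?thesis by linarith
    qed simp
    then obtain \<nu> where \<nu>: "inj_on \<nu> (A - {a})" "\<forall>x\<in>A - {a}. (x, \<nu> x) \<in> ?R"
      using hall_matching[of "A - {a}" ?R] finAB fin_rel by blast
    let ?m = "\<nu>(a := b)"
    have inj: "inj_on ?m A"
    proof -
      have "inj_on ?m (insert a (A - {a}))" unfolding inj_on_insert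
      proof
        have "inj_on ?m (A - {a}) = inj_on \<nu> (A - {a})" by (intro inj_on_cong) simp
        then show "inj_on ?m (A - {a})" using \<nu>(1) by simp
        show "?m a \<notin> ?m ` (A - {a} - {a})" using \<nu>(2) by auto
      qed
      then show ?thesis using ab(1) by (simp add: insert_absorb)
    qed
    have mB: "?m x \<in> B" if "x \<in> A" for x using that \<nu>(2) ab(2) rel_sub by auto
    have "card (?m ` A) = card B" using card_image[OF inj] E.cardAB by simp
    moreover have "?m ` A \<subseteq> B" using mB by blast
    ultimately have img: "?m ` A = B" using finAB by (simp add: card_subset_eq)
    have "\<exists>d\<in>edges H. ends H d = {x, ?m x} \<and> (x = a \<longrightarrow> d = e)" if x: "x \<in> A" for x
    proof (cases "x = a")
      case True
      then show ?thesis using e ab(3) by auto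
    next
      case False
      then have "(x, \<nu> x) \<in> rel" using \<nu>(2) x by blast
      then show ?thesis using False rel_iff by auto
    qed
    then obtain c where c: "\<And>x. x \<in> A \<Longrightarrow> c x \<in> edges H \<and> ends H (c x) = {x, ?m x} \<and> (x = a \<longrightarrow> c x = e)"
      by metis
    let ?M = "c ` A"
    have uni: "\<exists>!d. d \<in> ?M \<and> v \<in> ends H d" if v: "v \<in> A \<union> B" for v
    proof -
      obtain x where x: "x \<in> A" "v = x \<or> v = ?m x" using v img by blast
      have "d = c x" if d: "d \<in> ?M \<and> v \<in> ends H d" for d
      proof -
        obtain y where y: "y \<in> A" "d = c y" using d by blast
        then have "v = y \<or> v = ?m y" using d c[OF y(1)] by auto
        then have "x = y" using x y mB[OF x(1)] mB[OF y(1)] disj inj by (auto simp only: dest: inj_onD)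
        then show ?thesis using y by simp
      qed
      moreover have "c x \<in> ?M \<and> v \<in> ends H (c x)" using x c[OF x(1)] by auto
      ultimately show ?thesis by (intro ex1I[of _ "c x"])
    qed
    have "?M \<subseteq> edges H" using c by blast
    then have "perfect_matching H ?M" using uni unfolding perfect_matching_def V by simp
    moreover have "c a = e" using c[OF ab(1)] by simp
    then have "e \<in> ?M" using ab(1) by blast
    ultimately show ?thesis by blast
  qed
  ultimately show ?thesis using multH unfolding matching_covered_def by blast
qed

end

section \<open>Extremal graphs are doubled cubic Halin trees\<close>

text \<open>Deleting (a, b) affects only sets in which \<open>a\<close> is the sole neighbour of b.
  If none of these is tight, they have surplus at least two and can afford to lose b.\<close>

lemma (in elementary) elementary_delete:
  assumes ab: "(a, b) \<in> E" and nt: "\<nexists>X. tight_at A E X a b"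
  shows "elementary A B (E - {(a, b)})"
proof
  fix X assume X: "X \<subset> A" "X \<noteq> {}"
  let ?E = "E - {(a, b)}"
  show "card X < card (?E `` X)"
  proof (cases "a \<in> X \<and> (\<forall>x\<in>X. (x, b) \<in> E \<longrightarrow> x = a)")
    case True
    then have "\<not> card (E `` X) \<le> Suc (card X)" using nt tight_atI[OF X(1) _ ab] by blast
    moreover have "E `` X \<subseteq> insert b (?E `` X)" by blast
    then have "card (E `` X) \<le> card (insert b (?E `` X))" using finE by (intro card_mono) auto
    then have "card (E `` X) \<le> Suc (card (?E `` X))" using finE by (simp add: card_insert_if split: if_splits)
    ultimately show ?thesis by linarith
  next
    case False
    have "E `` X \<subseteq> ?E `` X"
    proof
      fix y assume "y \<in> E `` X"
      then obtain x where x: "x \<in> X" "(x, y) \<in> E" by blast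
      show "y \<in> ?E `` X"
      proof (cases "(x, y) = (a, b)")
        case True
        then obtain z where "z \<in> X" "(z, b) \<in> E" "z \<noteq> a" using False x(1) by auto
        then show ?thesis using True by blast
      next
        case False
        then show ?thesis using x by blast
      qed
    qed
    then have "card (E `` X) \<le> card (?E `` X)" using finE by (intro card_mono) auto
    then show ?thesis using hall[OF X] by linarith
  qed
qed (use finA finB sub disj cardAB two in auto)

text \<open>Carries a tree on two-element sets back to the named edges of the multigraph.\<close>

lemma grown_transfer:
  assumes "grown (\<lambda>e. e) W D" "inj_on inc P" "D \<subseteq> inc ` P"
  shows "grown inc W {e \<in> P. inc e \<in> D}"
  using assms(1,3)
proof (induction rule: grown.induct)
  case (single v)
  then show ?case by (simp add: grown.single)
next
  case (leaf W D x y d)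
  have "d \<in> inc ` P" "D \<subseteq> inc ` P" using leaf.prems by blast+
  then obtain p where p: "p \<in> P" "inc p = d" by blast
  have "{e \<in> P. inc e \<in> insert d D} = insert p {e \<in> P. inc e \<in> D}"
    using p assms(2) by (auto dest: inj_onD)
  moreover have "grown inc (insert y W) (insert p {e \<in> P. inc e \<in> D})"
    using leaf.IH[OF \<open>D \<subseteq> inc ` P\<close>] leaf.hyps p by (intro grown.leaf[where x = x]) auto
  ultimately show ?case by simp
qed

lemma doublingD:
  assumes "doubling W D f V U"
  shows "grown (\<lambda>e. e) W D" "2 \<le> card W" "\<forall>v\<in>W. tree_degree D v \<noteq> 2" "inj_on f W" "W \<inter> f ` W = {}"
    "V = W \<union> f ` W" "U = D \<union> (`) f ` D \<union> (\<lambda>l. {l, f l}) ` {l \<in> W. tree_degree D l = 1}"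
  using assms unfolding doubling_def by blast+

context bipartite_graph
begin

text \<open>Without parallel edges, deleting an edge of H deletes exactly one pair of
  \<open>rel\<close>, so an edge without a tight set would leave a matching covered graph.\<close>

lemma simple_minimal_elementary:
  assumes H: "minimal_matching_covered H"
  shows "minimal_elementary A B rel"
proof -
  note inj = minimal_no_parallel[OF H]
  have mc: "matching_covered H" using H unfolding minimal_matching_covered_def by blast
  interpret E: elementary A B rel by (rule elementary_if_covered[OF mc])
  show ?thesis
  proof
    fix a b assume ab: "(a, b) \<in> rel"
    then obtain e where e: "e \<in> edges H" "ends H e = {a, b}" using rel_iff by blast
    let ?G = "delete_edge H e"
    have G: "verts ?G = verts H" "edges ?G = edges H - {e}" "ends ?G = ends H" by (simp_all add: delete_edge_def)
    interpret D: bipartite_graph ?G A B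
    proof
      show "multigraph ?G" using multH unfolding multigraph_def G by auto
    qed (use V disj bip G in auto)
    have AB: "a \<in> A" "b \<in> B" using ab rel_sub by blast+
    have "D.rel = rel - {(a, b)}"
    proof (rule set_eqI, clarify)
      fix x y
      show "(x, y) \<in> D.rel \<longleftrightarrow> (x, y) \<in> rel - {(a, b)}"
      proof (cases "(x, y) = (a, b)")
        case True
        have "d = e" if "d \<in> edges H" "ends H d = {a, b}" for d
          using inj that e by (auto dest: inj_onD)
        then show ?thesis using True unfolding D.rel_iff G by auto
      next
        case False
        have "d \<noteq> e" if "x \<in> A" "y \<in> B" "ends H d = {x, y}" for d
          using that AB disj e(2) False by (auto simp: doubleton_eq_iff)
        then show ?thesis using False unfolding D.rel_iff G by (auto simp: rel_iff)
      qed
    qed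
    moreover have "\<not> matching_covered ?G" using H e(1) unfolding minimal_matching_covered_def by blast
    ultimately have "\<not> elementary A B (rel - {(a, b)})" using D.covered_if_elementary by auto
    then show "\<exists>X. tight_at A rel X a b" using E.elementary_delete[OF ab] by blast
  qed
qed

lemma undirected_rel: "undirected rel = ends H ` edges H"
proof
  show "undirected rel \<subseteq> ends H ` edges H" unfolding undirected_def rel_def by auto
  show "ends H ` edges H \<subseteq> undirected rel"
  proof
    fix u assume "u \<in> ends H ` edges H"
    then obtain e where e: "e \<in> edges H" "u = ends H e" by blast
    then obtain a b where "a \<in> A" "b \<in> B" "u = {a, b}" using bip by blast
    then have "(a, b) \<in> rel" "u = {a, b}" using e rel_iff by auto
    then show "u \<in> undirected rel" unfolding undirected_def by force
  qed
qed

lemma simple_degree: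
  assumes "inj_on (ends H) (edges H)"
  shows "degree H v = card {u \<in> undirected rel. v \<in> u}"
proof -
  have "{u \<in> undirected rel. v \<in> u} = ends H ` {e \<in> edges H. v \<in> ends H e}"
    unfolding undirected_rel by blast
  moreover have "inj_on (ends H) {e \<in> edges H. v \<in> ends H e}"
    by (rule inj_on_subset[OF assms]) blast
  ultimately show ?thesis by (simp add: degree_def card_image)
qed

lemma weight_degree:
  assumes inj: "inj_on (ends H) (edges H)" and el: "elementary A B rel"
  shows "(\<Sum>v\<in>verts H. vertex_weight (degree H v)) = weight A B rel"
proof -
  interpret E: elementary A B rel by (rule el)
  interpret S: elementary B A "rel\<inverse>" by (rule E.swap)
  have "(\<Sum>v\<in>verts H. vertex_weight (degree H v))
      = (\<Sum>v\<in>A. vertex_weight (degree H v)) + (\<Sum>v\<in>B. vertex_weight (degree H v))"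
    unfolding V using finAB disj by (rule sum.union_disjoint)
  moreover have "(\<Sum>v\<in>A. vertex_weight (degree H v)) = (\<Sum>v\<in>A. vertex_weight (card (rel `` {v})))"
    using E.undirected_degree simple_degree[OF inj] by (intro sum.cong) auto
  moreover have "(\<Sum>v\<in>B. vertex_weight (degree H v)) = (\<Sum>v\<in>B. vertex_weight (card (rel\<inverse> `` {v})))"
    using S.undirected_degree simple_degree[OF inj] by (intro sum.cong) (auto simp: undirected_converse)
  ultimately show ?thesis unfolding weight_def by simp
qed

lemma degree_ge_2:
  assumes inj: "inj_on (ends H) (edges H)" and el: "elementary A B rel" and v: "v \<in> verts H"
  shows "2 \<le> degree H v"
proof -
  interpret E: elementary A B rel by (rule el)
  interpret S: elementary B A "rel\<inverse>" by (rule E.swap)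
  show ?thesis
    using v E.degA[of v] S.degA[of v] E.undirected_degree[of v] S.undirected_degree[of v]
    unfolding simple_degree[OF inj] V undirected_converse by auto
qed

end

text \<open>A vertex of degree d >= 3 has the defect d - 3 = -1 - \<open>vertex_weight\<close> d,
  which is nonnegative. By the count hypothesis the weight is 4 minus the sum of defects, so the
  lower bound 4 makes all defects zero.\<close>

lemma extremal_degrees:
  assumes fin: "finite S" and two: "\<And>v. v \<in> S \<Longrightarrow> 2 \<le> d v"
    and w: "4 \<le> (\<Sum>v\<in>S. vertex_weight (d v))"
    and c: "2 * card {v \<in> S. d v = 2} = card S + 4"
  shows "(\<Sum>v\<in>S. vertex_weight (d v)) = 4" and "v \<in> S \<Longrightarrow> d v \<le> 3"
proof -
  let ?T = "{v \<in> S. d v = 2}" and ?U = "{v \<in> S. d v \<noteq> 2}"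
  have S: "S = ?T \<union> ?U" "?T \<inter> ?U = {}" by blast+
  have finTU: "finite ?T" "finite ?U" using fin by simp_all
  have cS: "card S = card ?T + card ?U" using card_Un_disjoint[OF finTU S(2)] S(1) by simp
  have "(\<Sum>v\<in>S. vertex_weight (d v)) = (\<Sum>v\<in>?T. vertex_weight (d v)) + (\<Sum>v\<in>?U. vertex_weight (d v))"
    using sum.union_disjoint[OF finTU S(2), of "\<lambda>v. vertex_weight (d v)"] S(1) by simp
  also have "(\<Sum>v\<in>?T. vertex_weight (d v)) = (\<Sum>v\<in>?T. 1)"
    by (intro sum.cong) (auto simp: vertex_weight_def)
  finally have sum: "(\<Sum>v\<in>S. vertex_weight (d v)) = int (card ?T) + (\<Sum>v\<in>?U. vertex_weight (d v))" by simp
  have neg: "0 \<le> - 1 - vertex_weight (d v)" if "v \<in> ?U" for v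
    using that two[of v] by (simp add: vertex_weight_def)
  have sf: "(\<Sum>v\<in>?U. - 1 - vertex_weight (d v)) = - int (card ?U) - (\<Sum>v\<in>?U. vertex_weight (d v))"
    by (simp add: sum_subtractf)
  then have le: "(\<Sum>v\<in>?U. - 1 - vertex_weight (d v)) \<le> 0" using sum w c cS by linarith
  moreover have ge: "0 \<le> (\<Sum>v\<in>?U. - 1 - vertex_weight (d v))" using neg by (rule sum_nonneg)
  ultimately have z: "(\<Sum>v\<in>?U. - 1 - vertex_weight (d v)) = 0" by simp
  then show "(\<Sum>v\<in>S. vertex_weight (d v)) = 4"
    using sf sum c cS by linarith
  show "d v \<le> 3" if "v \<in> S"
  proof (cases "d v = 2")
    case False
    then have "v \<in> ?U" using that by blast
    then have "- 1 - vertex_weight (d v) = 0"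
      using z sum_nonneg_eq_0_iff[OF finTU(2), of "\<lambda>v. - 1 - vertex_weight (d v)"] neg by blast
    then show ?thesis using False by (simp add: vertex_weight_def)
  qed simp
qed

text \<open>The doubling found on two-element sets is translated back to named edges. The tree and
  its copy are both taken with the ends of H; the edge maps come from inverting \<open>ends\<close>
  on the edges of H.\<close>

lemma extremal_imp_doubled_tree:
  fixes H :: "('v, 'e) mgraph"
  assumes mH: "multigraph H" and ext: "two_vertex_n_extremal H"
  shows "\<exists>T :: ('v, 'e) mgraph. cubic_halin_tree T \<and> isomorphic_leaf_matching T H"
proof -
  from ext have min: "minimal_matching_covered H" and bi: "bipartite H"
    and count: "real (card (V2 H)) = real (card (verts H)) / 2 + 2"
    unfolding two_vertex_n_extremal_def by blast+
  obtain A B where AB: "A \<union> B = verts H" "A \<inter> B = {}" "\<forall>e\<in>edges H. \<exists>a\<in>A. \<exists>b\<in>B. ends H e = {a, b}"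
    using bi unfolding bipartite_def by blast
  interpret G: bipartite_graph H A B
    using mH AB by unfold_locales auto
  note inj = minimal_no_parallel[OF min]
  interpret E: minimal_elementary A B G.rel by (rule G.simple_minimal_elementary[OF min])
  note el = E.elementary_axioms
  have bound: "extremal_bound A B G.rel" by (rule minimal_elementary_bound[OF E.minimal_elementary_axioms])
  have "real (2 * card (V2 H)) = real (card (verts H) + 4)" using count by simp
  then have n2': "2 * card {v \<in> verts H. degree H v = 2} = card (verts H) + 4"
    unfolding V2_def by (simp only: of_nat_eq_iff)
  have finV: "finite (verts H)" using mH unfolding multigraph_def by blast
  have w4: "4 \<le> (\<Sum>v\<in>verts H. vertex_weight (degree H v))"
    using bound G.weight_degree[OF inj el] unfolding extremal_bound_def by simp
  note ed = extremal_degrees[OF finV G.degree_ge_2[OF inj el] w4 n2']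
  have le3: "degree H v \<le> 3" if "v \<in> verts H" for v using ed(2) that by blast
  have "doubled A B G.rel"
    using bound ed(1) G.weight_degree[OF inj el] unfolding extremal_bound_def by simp
  then obtain W D f where dbl: "doubling W D f (verts H) (ends H ` edges H)"
    unfolding doubled_def G.undirected_rel AB(1) by blast
  note gr = doublingD(1)[OF dbl] and cW = doublingD(2)[OF dbl] and n2 = doublingD(3)[OF dbl]
    and injf = doublingD(4)[OF dbl] and dj = doublingD(5)[OF dbl] and VW = doublingD(6)[OF dbl]
    and U = doublingD(7)[OF dbl]
  have DW: "d \<subseteq> W" "card d = 2" if "d \<in> D" for d using grown_incidence[OF gr that] by blast+
  define T :: "('v, 'e) mgraph" where "T = \<lparr>verts = W, edges = {e \<in> edges H. ends H e \<in> D}, ends = ends H\<rparr>"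
  define T' :: "('v, 'e) mgraph" where "T' = \<lparr>verts = f ` W, edges = {e \<in> edges H. ends H e \<in> (`) f ` D}, ends = ends H\<rparr>"
  have T: "verts T = W" "edges T = {e \<in> edges H. ends H e \<in> D}" "ends T = ends H" by (simp_all add: T_def)
  have T': "verts T' = f ` W" "edges T' = {e \<in> edges H. ends H e \<in> (`) f ` D}" "ends T' = ends H" by (simp_all add: T'_def)
  have mT: "multigraph T"
    using finV mH DW VW unfolding multigraph_def T by auto
  have "D \<subseteq> ends H ` edges H" using U by blast
  then have "grown (ends T) (verts T) (edges T)" unfolding T by (rule grown_transfer[OF gr inj])
  then have tree: "tree T" using tree_iff_grown[OF mT] by blast
  have deg: "degree T v = tree_degree D v" for v
  proof -
    have "{d \<in> D. v \<in> d} = ends H ` {e \<in> edges T. v \<in> ends T e}" using \<open>D \<subseteq> ends H ` edges H\<close> unfolding T by blast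
    moreover have "inj_on (ends H) {e \<in> edges T. v \<in> ends T e}" by (rule inj_on_subset[OF inj]) (auto simp: T)
    ultimately show ?thesis by (simp add: degree_def tree_degree_def card_image)
  qed
  have leaves: "leaves T = {l \<in> W. tree_degree D l = 1}" unfolding leaves_def T(1) deg ..
  have "degree T v = 3" if v: "v \<in> verts T - leaves T" for v
  proof -
    have vW: "v \<in> W" "tree_degree D v \<noteq> 1" using v unfolding leaves T(1) by blast+
    \<comment> \<open>The degree in the tree is neither 0, 1 nor 2, and the degree in H bounds it by
      3, so it is exactly three.\<close>
    have "tree_degree D v \<noteq> 0"
    proof
      assume "tree_degree D v = 0"
      then have "\<forall>d\<in>D. v \<notin> d" using grown_finite[OF gr] unfolding tree_degree_def by auto
      then have "W = {v}" by (rule grown_isolated[OF gr vW(1)])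
      then show False using cW by simp
    qed
    moreover have "tree_degree D v \<le> degree H v"
      unfolding deg[symmetric] degree_def T using mH by (intro card_mono) (auto simp: multigraph_def)
    moreover have "degree H v \<le> 3" using le3 vW(1) VW by blast
    moreover have "tree_degree D v \<noteq> 2" using n2 vW(1) by blast
    ultimately show ?thesis using vW(2) unfolding deg by linarith
  qed
  then have cubic: "cubic_halin_tree T" using tree cW unfolding cubic_halin_tree_def T(1) by blast
  \<comment> \<open>The inverse of \<open>ends H\<close> on edges, well defined because a minimal
    graph has no parallel edges; it names the copy of an edge and the matching edge at a
    leaf.\<close>
  define pick where "pick u = (THE e. e \<in> edges H \<and> ends H e = u)" for u
  have pick: "pick u \<in> edges H \<and> ends H (pick u) = u" if "u \<in> ends H ` edges H" for u
  proof -
    have "\<exists>!e. e \<in> edges H \<and> ends H e = u" using that inj by (auto dest: inj_onD)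
    then show ?thesis unfolding pick_def by (rule theI')
  qed
  have pick_ends: "pick (ends H e) = e" if "e \<in> edges H" for e
    using pick[of "ends H e"] that inj by (auto dest: inj_onD)
  have copy: "f ` d \<in> ends H ` edges H" if "d \<in> D" for d using U that by blast
  have leafU: "{l, f l} \<in> ends H ` edges H" if "l \<in> leaves T" for l using U that unfolding leaves by blast
  define g where "g e = pick (f ` ends H e)" for e
  define m where "m l = pick {l, f l}" for l
  have g: "g e \<in> edges H" "ends H (g e) = f ` ends H e" if "e \<in> edges T" for e
    using pick[OF copy] that unfolding g_def T by auto
  have m: "m l \<in> edges H" "ends H (m l) = {l, f l}" if "l \<in> leaves T" for l
    using pick[OF leafU[OF that]] unfolding m_def by auto
  have injD: "inj_on ((`) f) D" using injf DW(1) by (meson inj_on_image_eq_iff inj_onI)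
  have "isomorphism T T' f g"
    unfolding isomorphism_def
  proof (intro conjI ballI)
    show "bij_betw f (verts T) (verts T')" using injf unfolding bij_betw_def T T' by simp
    show "ends T' (g e) = f ` ends T e" if "e \<in> edges T" for e using g(2)[OF that] unfolding T T' by simp
    have "inj_on g (edges T)"
    proof (rule inj_onI)
      fix x y assume xy: "x \<in> edges T" "y \<in> edges T" "g x = g y"
      then have "f ` ends H x = f ` ends H y" using g(2) by metis
      then have "ends H x = ends H y" using xy injD unfolding T by (auto dest: inj_onD)
      then show "x = y" using xy inj unfolding T by (auto dest: inj_onD)
    qed
    moreover have "g ` edges T = edges T'"
    proof
      show "g ` edges T \<subseteq> edges T'" using g unfolding T T' by auto
      show "edges T' \<subseteq> g ` edges T"
      proof
        fix e assume e: "e \<in> edges T'"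
        then obtain d where d: "d \<in> D" "ends H e = f ` d" "e \<in> edges H" unfolding T' by auto
        then obtain e' where e': "e' \<in> edges H" "ends H e' = d" using \<open>D \<subseteq> ends H ` edges H\<close> by blast
        then have "g e' = e" unfolding g_def using d pick_ends by metis
        moreover have "e' \<in> edges T" using e' d(1) unfolding T by simp
        ultimately show "e \<in> g ` edges T" by blast
      qed
    qed
    ultimately show "bij_betw g (edges T) (edges T')" unfolding bij_betw_def by blast
  qed
  moreover have "verts T \<inter> verts T' = {}" using dj unfolding T T' .
  moreover have "edges T \<inter> edges T' = {}"
  proof -
    have "d \<notin> (`) f ` D" if d: "d \<in> D" for d
    proof
      assume "d \<in> (`) f ` D"
      then have "d \<subseteq> f ` W" using DW(1) by blast
      then have "d = {}" using DW(1)[OF d] dj by blast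
      then show False using DW(2)[OF d] by simp
    qed
    then show ?thesis unfolding T T' by auto
  qed
  moreover have "inj_on m (leaves T)"
  proof (rule inj_onI)
    fix x y assume xy: "x \<in> leaves T" "y \<in> leaves T" "m x = m y"
    then have "{x, f x} = {y, f y}" using m(2) by metis
    moreover have "x \<noteq> f y" using xy dj unfolding leaves by blast
    ultimately show "x = y" by (auto simp: doubleton_eq_iff)
  qed
  moreover have "m ` leaves T \<inter> (edges T \<union> edges T') = {}"
  proof -
    have "{l, f l} \<notin> D" "{l, f l} \<notin> (`) f ` D" if l: "l \<in> leaves T" for l
    proof -
      have lW: "l \<in> W" using l unfolding leaves by blast
      then have "f l \<notin> W" "l \<notin> f ` W" using dj by blast+
      then show "{l, f l} \<notin> D" "{l, f l} \<notin> (`) f ` D" using DW(1) by blast+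
    qed
    then have "m l \<notin> edges T" "m l \<notin> edges T'" if "l \<in> leaves T" for l
      using m(2)[OF that] that unfolding T T' by simp_all
    then show ?thesis by blast
  qed
  moreover have "verts H = verts T \<union> verts T'" using VW unfolding T T' .
  moreover have "edges H = edges T \<union> edges T' \<union> m ` leaves T"
  proof
    show "edges T \<union> edges T' \<union> m ` leaves T \<subseteq> edges H" using m(1) unfolding T T' by auto
    show "edges H \<subseteq> edges T \<union> edges T' \<union> m ` leaves T"
    proof
      fix e assume e: "e \<in> edges H"
      then have "ends H e \<in> D \<union> (`) f ` D \<union> (\<lambda>l. {l, f l}) ` leaves T" using U unfolding leaves by blast
      then consider "ends H e \<in> D" | "ends H e \<in> (`) f ` D" | l where "l \<in> leaves T" "ends H e = {l, f l}" by blast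
      then show "e \<in> edges T \<union> edges T' \<union> m ` leaves T"
      proof cases
        case 3
        then have "m l = e" unfolding m_def using pick_ends[OF e] by simp
        then show ?thesis using 3(1) by blast
      qed (use e in \<open>simp_all add: T T'\<close>)
    qed
  qed
  moreover have "\<forall>e\<in>edges T. ends H e = ends T e" "\<forall>e\<in>edges T'. ends H e = ends T' e"
    unfolding T T' by simp_all
  moreover have "\<forall>l\<in>leaves T. ends H (m l) = {l, f l}" using m(2) by blast
  moreover have "2 \<le> card (verts T)" using cW unfolding T .
  ultimately have "isomorphic_leaf_matching T H"
    using tree unfolding isomorphic_leaf_matching_def
    by (intro conjI exI[of _ T'] exI[of _ f] exI[of _ g] exI[of _ m])
  then show ?thesis using cubic by blast
qed

theorem theorem1p4:
  fixes H :: "('v, 'e) mgraph"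
  assumes "multigraph H"
  shows "two_vertex_n_extremal H \<longleftrightarrow>
    (\<exists>T :: ('v, 'e) mgraph. cubic_halin_tree T \<and> isomorphic_leaf_matching T H)"
proof
  assume "two_vertex_n_extremal H"
  then show "\<exists>T :: ('v, 'e) mgraph. cubic_halin_tree T \<and> isomorphic_leaf_matching T H"
    by (rule extremal_imp_doubled_tree[OF assms])
next
  assume "\<exists>T :: ('v, 'e) mgraph. cubic_halin_tree T \<and> isomorphic_leaf_matching T H"
  then obtain T :: "('v, 'e) mgraph" where T: "cubic_halin_tree T" "isomorphic_leaf_matching T H" by blast
  from T(2) have "\<exists>T' f g m. doubled_tree T T' H f g m"
    using assms T(1) unfolding isomorphic_leaf_matching_def doubled_tree_def
    by (elim conjE exE) (intro exI conjI; assumption)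
  then obtain T' f g m where "doubled_tree T T' H f g m" by blast
  then interpret doubled_tree T T' H f g m .
  show "two_vertex_n_extremal H" by (rule two_vertex_n_extremal)
qed

end
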